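(* Let $n\ge 2$ and let $a_1,a_2,\ldots,a_n\ge 2$ be pairwise relatively prime integers. Put $\alpha:=a_1a_2\cdots a_{n-1}$. Then the maximal monotone subroots of the lattice homologies of the two Seifert fibered integral homology spheres $$\Sigma(a_1,a_2,\ldots,a_n)\qquad\text{and}\qquad\Sigma(a_1,a_2,\ldots,a_n+2\alpha)$$ are the same (as graded roots, including gradings).
   Context: **Seifert homology spheres.** For pairwise coprime integers $a_1,\dots,a_n\ge 2$, let $(e_0,b_1,\dots,b_n)$ be the unique integers with $1\le b_i<a_i$ for all $i$ and $$\sum_{i=1}^n \frac{b_i}{a_i}\Big(\prod_{j=1}^n a_j\Big)=-1-e_0a_1a_2\cdots a_n .$$ One has $e_0<0$. The Seifert homology sphere $\Sigma(a_1,\dots,a_n)$ is the Seifert manifold $M(e_0,(a_1,b_1),\dots,(a_n,b_n))$ over $S^2$. It is given by the rational surgery diagram with a central unknot of framing $e_0$ and $n$ meridional unknots with coefficients $-a_i/b_i$. Write $a_i/b_i=[x_{i,1},\dots,x_{i,m_i}]=x_{i,1}-\cfrac{1}{x_{i,2}-\cdots}$ with all $x_{i,j}\ge 2$. Then $\Sigma(a_1,\dots,a_n)$ is the boundary of the plumbing on the negative-definite star-shaped tree $\Gamma$ with a central vertex decorated $e_0$ and $n$ legs, where the $i$-th leg has vertices decorated, going outwards from the centre, by $-x_{i,1},\dots,-x_{i,m_i}$. **Lattice homology.** Let $\Gamma$ be a negative-definite plumbing tree with vertices $v_1,\dots,v_N$, and write $|\Gamma|=N$. Let $L=\mathrm{Span}_{\mathbb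 Z}(v_1,\dots,v_N)$ with the bilinear form $(v_i,v_i)=$ decoration of $v_i$, $(v_i,v_j)=1$ if $v_i,v_j$ are distinct and adjacent, and $(v_i,v_j)=0$ otherwise. Extend this form to $L\otimes\mathbb Q$. A characteristic vector is $k\in L\otimes\mathbb Q$ with $(k,x)\equiv(x,x)\pmod 2$ for all $x\in L$. Two characteristic vectors are equivalent if they differ by an element of $2L$; for an integral homology sphere there is only one class, and $k\in L$. Fix a characteristic vector $k$ and put $w(x)=\frac{(x,x)+(k,x)}{2}$ for $x\in L$. For a unit lattice cube (of any dimension $\ge 0$, with vertices in $L$ and edges parallel to the $v_i$) let its weight be the minimum of $w$ over its vertices. Let $S_m$ ($m\in\mathbb Z$) be the union of all such cubes of weight $\ge m$, so that $S_{m+1}\subseteq S_m$. The graded root has one vertex at height $-2m$ for each connected component of $S_m$, and an edge joining each component of $S_{m+1}$ to the component of $S_m$ containing it. The lattice homology is this graded root with all heights shifted by $-\frac{(k,k)+|\Gamma|}{4}$. The shifted height of a vertex is its grading. The result does not depend on the choice of $k$ in its class, nor on the plumbing graph chosen for the manifold. **Symmetry and stem.** The graded root of a Seifert homology sphere is symmetric under a grading-preserving reflection $J_0$ across its vertical axis, namely the involution induced by $x\mapsto -x-k$ on $L$. The stem is the infinite upward tower of vertices lying on the axis, i.e. fixed by $J_0$. **Monotone graded roots.** Let $h_1<\cdots<h_q$ and $r_1>\cdots>r_q$ be rational numbers, with the $h_i$ differing from each other by even integers, the $r_i$ differing from each other by even integers, and $h_q\le r_q$. The monotone graded root $M(h_1,r_1;\dots;h_q,r_q)$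 consists of an infinite stem going upwards from a vertex of grading $r_q$, together with, for each $i$, a pair of vertices $v_i,J_0v_i$ of grading $h_i$ that are mirror images of each other, each joined by a descending path to the stem at grading $r_i$. If $h_q=r_q$, then $v_q=J_0v_q$ is the lowest stem vertex. **Maximal monotone subroot.** For a vertex $v$ of the graded root let $\gamma_v$ be the infinite path going upwards from $v$. The base $b(v)$ is the first point where $\gamma_v$ meets the stem. For a stem vertex $b$, the cluster $C_b$ is the set of all vertices with base $b$. The tip of $C_b$ is a $J_0$-symmetric pair of vertices of $C_b$ of minimal grading (any such pair may be chosen if there are several); if $|C_b|=1$ the tip is the single vertex of $C_b$. The maximal monotone subroot is built as follows. Start at the stem vertex $r$ of smallest grading and add the tips of $C_r$, attached to the stem as in the original root. Then move up the stem one vertex at a time. At each stem vertex $s$, add the tips of $C_s$, attached to the stem as in the original root, if and only if they have strictly smaller grading than all tips previously added. Continue until all remaining clusters have size $1$. The result is a monotone graded root: the stem together with the paths from the added tips to the stem. *)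

theory Defs
  imports "HOL-Analysis.Analysis" "HOL-Number_Theory.Cong"
begin

section \<open>Plumbing graphs and their lattices\<close>

record 'v plumbing =
  pverts :: "'v set"
  padj :: "'v \<Rightarrow> 'v \<Rightarrow> bool"
  pdec :: "'v \<Rightarrow> int"

text \<open>Elements of \<open>L\<close>, \<open>L \<otimes> \<rat>\<close> and \<open>L \<otimes> \<real>\<close> are all represented by their real coordinate
  functions with respect to the vertices, extended by \<open>0\<close> off the vertex set.\<close>

definition lattice :: "('v, 'm) plumbing_scheme \<Rightarrow> ('v \<Rightarrow> real) set" where
  "lattice \<Gamma> = {x. (\<forall>v \<in> pverts \<Gamma>. x v \<in> \<int>) \<and> (\<forall>v. v \<notin> pverts \<Gamma> \<longrightarrow> x v = 0)}"

definition lattice_rat :: "('v, 'm) plumbing_scheme \<Rightarrow> ('v \<Rightarrow> real) set" where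
  "lattice_rat \<Gamma> = {x. (\<forall>v \<in> pverts \<Gamma>. x v \<in> \<rat>) \<and> (\<forall>v. v \<notin> pverts \<Gamma> \<longrightarrow> x v = 0)}"

definition vertex_form :: "('v, 'm) plumbing_scheme \<Rightarrow> 'v \<Rightarrow> 'v \<Rightarrow> int" where
  "vertex_form \<Gamma> u v = (if u = v then pdec \<Gamma> v else if padj \<Gamma> u v then 1 else 0)"

definition pairing :: "('v, 'm) plumbing_scheme \<Rightarrow> ('v \<Rightarrow> real) \<Rightarrow> ('v \<Rightarrow> real) \<Rightarrow> real" where
  "pairing \<Gamma> x y =
     (\<Sum>u \<in> pverts \<Gamma>. \<Sum>v \<in> pverts \<Gamma>. x u * y v * of_int (vertex_form \<Gamma> u v))"

definition characteristic :: "('v, 'm) plumbing_scheme \<Rightarrow> ('v \<Rightarrow> real) \<Rightarrow> bool" where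
  "characteristic \<Gamma> k \<longleftrightarrow> k \<in> lattice_rat \<Gamma> \<and>
     (\<forall>x \<in> lattice \<Gamma>. \<exists>j :: int. pairing \<Gamma> k x = pairing \<Gamma> x x + 2 * of_int j)"

definition weight :: "('v, 'm) plumbing_scheme \<Rightarrow> ('v \<Rightarrow> real) \<Rightarrow> ('v \<Rightarrow> real) \<Rightarrow> real" where
  "weight \<Gamma> k x = (pairing \<Gamma> x x + pairing \<Gamma> k x) / 2"

text \<open>The unit cube with lowest corner \<open>x\<close> and edge directions \<open>I\<close>; its dimension is \<open>card I\<close>.\<close>

definition cube :: "('v \<Rightarrow> real) \<Rightarrow> 'v set \<Rightarrow> ('v \<Rightarrow> real) set" where
  "cube x I = {y. (\<forall>v \<in> I. x v \<le> y v \<and> y v \<le> x v + 1) \<and> (\<forall>v. v \<notin> I \<longrightarrow> y v = x v)}"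

definition cube_corners :: "('v \<Rightarrow> real) \<Rightarrow> 'v set \<Rightarrow> ('v \<Rightarrow> real) set" where
  "cube_corners x I = (\<lambda>J v. x v + (if v \<in> J then 1 else 0)) ` Pow I"

definition cube_weight ::
    "('v, 'm) plumbing_scheme \<Rightarrow> ('v \<Rightarrow> real) \<Rightarrow> ('v \<Rightarrow> real) \<Rightarrow> 'v set \<Rightarrow> real" where
  "cube_weight \<Gamma> k x I = Min (weight \<Gamma> k ` cube_corners x I)"

definition superlevel :: "('v, 'm) plumbing_scheme \<Rightarrow> ('v \<Rightarrow> real) \<Rightarrow> int \<Rightarrow> ('v \<Rightarrow> real) set" where
  "superlevel \<Gamma> k m =
     \<Union> {cube x I | x I. x \<in> lattice \<Gamma> \<and> I \<subseteq> pverts \<Gamma> \<and> of_int m \<le> cube_weight \<Gamma> k x I}"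


section \<open>Symmetric graded roots\<close>

text \<open>Edges are stored as pairs oriented in the direction of increasing grading.\<close>

record 'a graded_root =
  rverts :: "'a set"
  rup :: "('a \<times> 'a) set"
  rgrade :: "'a \<Rightarrow> real"
  rrefl :: "'a \<Rightarrow> 'a"

text \<open>A vertex \<open>(m, C)\<close> of the lattice homology is a connected component \<open>C\<close> of the superlevel set
  of \<open>m\<close>; connectedness refers to the product topology on coordinate functions, which is the
  Euclidean one because all points are supported on the finite set of vertices. The reflection is
  induced by \<open>x \<mapsto> - x - k\<close>.\<close>

definition lattice_homology ::
    "('v, 'm) plumbing_scheme \<Rightarrow> ('v \<Rightarrow> real) \<Rightarrow> (int \<times> ('v \<Rightarrow> real) set) graded_root" where
  "lattice_homology \<Gamma> k =
     \<lparr> rverts = {(m, C). C \<in> components (superlevel \<Gamma> k m)},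
       rup = {((m + 1, C), (m, D)) | m C D.
                C \<in> components (superlevel \<Gamma> k (m + 1)) \<and>
                D \<in> components (superlevel \<Gamma> k m) \<and> C \<subseteq> D},
       rgrade = (\<lambda>(m, C). - 2 * of_int m - (pairing \<Gamma> k k + of_nat (card (pverts \<Gamma>))) / 4),
       rrefl = (\<lambda>(m, C). (m, (\<lambda>x v. - x v - k v) ` C)) \<rparr>"

definition root_iso :: "'a graded_root \<Rightarrow> 'b graded_root \<Rightarrow> bool" where
  "root_iso R R' \<longleftrightarrow> (\<exists>f. bij_betw f (rverts R) (rverts R') \<and>
     (\<forall>u \<in> rverts R. \<forall>v \<in> rverts R. (u, v) \<in> rup R \<longleftrightarrow> (f u, f v) \<in> rup R') \<and>
     (\<forall>v \<in> rverts R. rgrade R' (f v) = rgrade R v) \<and>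
     (\<forall>v \<in> rverts R. f (rrefl R v) = rrefl R' (f v)))"

definition stem :: "'a graded_root \<Rightarrow> 'a set" where
  "stem R = {v \<in> rverts R. rrefl R v = v}"

definition up_path :: "'a graded_root \<Rightarrow> 'a \<Rightarrow> 'a set" where
  "up_path R v = {u. (v, u) \<in> (rup R)\<^sup>*}"

definition is_base :: "'a graded_root \<Rightarrow> 'a \<Rightarrow> 'a \<Rightarrow> bool" where
  "is_base R v b \<longleftrightarrow> b \<in> up_path R v \<inter> stem R \<and>
     (\<forall>u \<in> up_path R v \<inter> stem R. u \<in> up_path R b)"

definition cluster :: "'a graded_root \<Rightarrow> 'a \<Rightarrow> 'a set" where
  "cluster R b = {v \<in> rverts R. is_base R v b}"

text \<open>The pair collapses to a single vertex exactly when the cluster is the singleton \<open>{b}\<close>.\<close>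

definition is_tip :: "'a graded_root \<Rightarrow> 'a \<Rightarrow> 'a set \<Rightarrow> bool" where
  "is_tip R b t \<longleftrightarrow> (\<exists>v \<in> cluster R b. (\<forall>u \<in> cluster R b. rgrade R v \<le> rgrade R u) \<and>
     t = {v, rrefl R v})"

definition tip_choice :: "'a graded_root \<Rightarrow> ('a \<Rightarrow> 'a set) \<Rightarrow> bool" where
  "tip_choice R T \<longleftrightarrow> (\<forall>b \<in> stem R. is_tip R b (T b))"

definition stem_bottom :: "'a graded_root \<Rightarrow> 'a" where
  "stem_bottom R = (THE r. r \<in> stem R \<and> (\<forall>s \<in> stem R. rgrade R r \<le> rgrade R s))"

definition root_parent :: "'a graded_root \<Rightarrow> 'a \<Rightarrow> 'a" where
  "root_parent R v = (THE u. (v, u) \<in> rup R)"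

definition stem_vertex :: "'a graded_root \<Rightarrow> nat \<Rightarrow> 'a" where
  "stem_vertex R j = (root_parent R ^^ j) (stem_bottom R)"

primrec added_tips :: "'a graded_root \<Rightarrow> ('a \<Rightarrow> 'a set) \<Rightarrow> nat \<Rightarrow> 'a set" where
  "added_tips R T 0 = T (stem_vertex R 0)"
| "added_tips R T (Suc j) = added_tips R T j \<union>
     (if \<forall>v \<in> T (stem_vertex R (Suc j)). \<forall>u \<in> added_tips R T j. rgrade R v < rgrade R u
      then T (stem_vertex R (Suc j)) else {})"

text \<open>The walk up the stem need not be stopped: the tip of a singleton cluster above the bottom
  of the stem is a stem vertex, so it has larger grading than the first tips and is never added.\<close>

definition max_monotone_subroot :: "'a graded_root \<Rightarrow> ('a \<Rightarrow> 'a set) \<Rightarrow> 'a graded_root" where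
  "max_monotone_subroot R T =
     (let V = stem R \<union> (\<Union>j. \<Union>v \<in> added_tips R T j. up_path R v)
      in R \<lparr> rverts := V, rup := rup R \<inter> (V \<times> V) \<rparr>)"


section \<open>Seifert homology spheres\<close>

text \<open>Tuples are indexed by \<open>{1..n}\<close>; the \<open>b i\<close> are set to \<open>0\<close> elsewhere for uniqueness.\<close>

definition seifert_data :: "nat \<Rightarrow> (nat \<Rightarrow> int) \<Rightarrow> int \<Rightarrow> (nat \<Rightarrow> int) \<Rightarrow> bool" where
  "seifert_data n a e\<^sub>0 b \<longleftrightarrow>
     (\<forall>i \<in> {1..n}. 1 \<le> b i \<and> b i < a i) \<and> (\<forall>i. i \<notin> {1..n} \<longrightarrow> b i = 0) \<and>
     (\<Sum>i=1..n. of_int (b i) / of_int (a i)) * (\<Prod>j=1..n. of_int (a j)) =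
       (- 1 - of_int e\<^sub>0 * (\<Prod>j=1..n. of_int (a j)) :: rat)"

definition seifert_e0 :: "nat \<Rightarrow> (nat \<Rightarrow> int) \<Rightarrow> int" where
  "seifert_e0 n a = (THE e\<^sub>0. \<exists>b. seifert_data n a e\<^sub>0 b)"

definition seifert_b :: "nat \<Rightarrow> (nat \<Rightarrow> int) \<Rightarrow> nat \<Rightarrow> int" where
  "seifert_b n a = (THE b. \<exists>e\<^sub>0. seifert_data n a e\<^sub>0 b)"

fun neg_cfrac :: "int list \<Rightarrow> rat" where
  "neg_cfrac [] = 0"
| "neg_cfrac [x] = of_int x"
| "neg_cfrac (x # y # xs) = of_int x - 1 / neg_cfrac (y # xs)"

definition is_neg_cfrac :: "int \<Rightarrow> int \<Rightarrow> int list \<Rightarrow> bool" where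
  "is_neg_cfrac p q xs \<longleftrightarrow>
     xs \<noteq> [] \<and> (\<forall>x \<in> set xs. 2 \<le> x) \<and> of_int p / of_int q = neg_cfrac xs"

definition leg_expansion :: "int \<Rightarrow> int \<Rightarrow> int list" where
  "leg_expansion p q = (THE xs. is_neg_cfrac p q xs)"

text \<open>\<open>Leg i j\<close> is the vertex of the \<open>i\<close>-th leg at distance \<open>j + 1\<close> from the centre.\<close>

datatype star_vertex = Center | Leg nat nat

fun star_adj :: "star_vertex \<Rightarrow> star_vertex \<Rightarrow> bool" where
  "star_adj Center Center = False"
| "star_adj Center (Leg i j) = (j = 0)"
| "star_adj (Leg i j) Center = (j = 0)"
| "star_adj (Leg i j) (Leg i' j') = (i = i' \<and> (j' = Suc j \<or> j = Suc j'))"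

definition star_plumbing :: "nat \<Rightarrow> int \<Rightarrow> (nat \<Rightarrow> int list) \<Rightarrow> star_vertex plumbing" where
  "star_plumbing n e\<^sub>0 xs =
     \<lparr> pverts = insert Center {Leg i j | i j. i \<in> {1..n} \<and> j < length (xs i)},
       padj = star_adj,
       pdec = (\<lambda>v. case v of Center \<Rightarrow> e\<^sub>0 | Leg i j \<Rightarrow> - (xs i ! j)) \<rparr>"

definition seifert_plumbing :: "nat \<Rightarrow> (nat \<Rightarrow> int) \<Rightarrow> star_vertex plumbing" where
  "seifert_plumbing n a =
     star_plumbing n (seifert_e0 n a) (\<lambda>i. leg_expansion (a i) (seifert_b n a i))"


subsection \<open>The descriptions above determine unique objects\<close>

lemma neg_cfrac_bounds:
  assumes "xs \<noteq> []" "\<forall>x \<in> set xs. 2 \<le> x"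
  shows "of_int (hd xs) - 1 < neg_cfrac xs \<and> neg_cfrac xs \<le> of_int (hd xs)"
  using assms
proof (induction xs rule: neg_cfrac.induct)
  case (3 x y xs)
  then have "of_int y - 1 < neg_cfrac (y # xs)" "(2::rat) \<le> of_int y"
    by (auto simp del: neg_cfrac.simps)
  then have "1 < neg_cfrac (y # xs)" by linarith
  then show ?case by (simp del: neg_cfrac.simps(2) add: neg_cfrac.simps(3))
qed auto

lemma neg_cfrac_gt_1:
  assumes "xs \<noteq> []" "\<forall>x \<in> set xs. 2 \<le> x"
  shows "1 < neg_cfrac xs"
proof -
  have "2 \<le> hd xs" using assms by auto
  then have "(2::rat) \<le> of_int (hd xs)" by simp
  then show ?thesis using neg_cfrac_bounds[OF assms] by linarith
qed

lemma neg_cfrac_hd: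
  assumes "xs \<noteq> []" "\<forall>x \<in> set xs. 2 \<le> x"
  shows "hd xs = \<lceil>neg_cfrac xs\<rceil>"
  using neg_cfrac_bounds[OF assms] by (intro ceiling_unique[symmetric]) auto

lemma neg_cfrac_inj:
  assumes "xs \<noteq> []" "\<forall>x \<in> set xs. 2 \<le> x" "ys \<noteq> []" "\<forall>y \<in> set ys. 2 \<le> y"
    and "neg_cfrac xs = neg_cfrac ys"
  shows "xs = ys"
  using assms
proof (induction xs arbitrary: ys rule: neg_cfrac.induct)
  case (2 x)
  have h: "hd ys = x" using 2 neg_cfrac_hd[of "[x]"] neg_cfrac_hd[of ys] by auto
  show ?case
  proof (cases ys rule: neg_cfrac.cases)
    case (3 y z zs)
    then have "1 < neg_cfrac (z # zs)" using 2 by (intro neg_cfrac_gt_1) auto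
    then show ?thesis using 2 3 h by auto
  qed (use h 2 in auto)
next
  case (3 x y xs)
  have h: "hd ys = x" using 3 neg_cfrac_hd[of "x # y # xs"] neg_cfrac_hd[of ys] by simp
  have g: "1 < neg_cfrac (y # xs)" using 3 by (intro neg_cfrac_gt_1) auto
  show ?case
  proof (cases ys rule: neg_cfrac.cases)
    case (2 z)
    then show ?thesis using 3 h g by auto
  next
    case (3 z w zs)
    note c = this
    have "neg_cfrac (y # xs) = neg_cfrac (w # zs)" using "3.prems"(5) c h by simp
    then have "y # xs = w # zs" by (intro "3.IH") (use "3.prems" c in auto)
    then show ?thesis using c h by simp
  qed (use 3 in auto)
qed auto

lemma neg_cfrac_ex:
  assumes "1 \<le> q" "q < p"
  shows "\<exists>xs. is_neg_cfrac p q xs"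
  using assms
proof (induction "nat q" arbitrary: p q rule: less_induct)
  case less
  show ?case
  proof (cases "q dvd p")
    case True
    then obtain x where x: "p = q * x" by blast
    have "2 \<le> x"
    proof (rule ccontr)
      assume "\<not> 2 \<le> x"
      then have "q * x \<le> q * 1" using less.prems by (intro mult_left_mono) auto
      then show False using x less.prems by simp
    qed
    then have "is_neg_cfrac p q [x]" using x less.prems by (simp add: is_neg_cfrac_def)
    then show ?thesis ..
  next
    case False
    define x r where "x = p div q + 1" and "r = q - p mod q"
    have "p mod q \<noteq> 0" using False by (simp add: dvd_eq_mod_eq_0)
    moreover have "0 \<le> p mod q" "p mod q < q" using less.prems by auto
    ultimately have r: "1 \<le> r" "r < q" unfolding r_def by auto
    have x2: "2 \<le> x"
      using less.prems pos_imp_zdiv_pos_iff[of q p] unfolding x_def by linarith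
    have e: "p = x * q - r"
      unfolding x_def r_def using div_mult_mod_eq[of p q] by (simp add: algebra_simps)
    obtain xs where xs: "is_neg_cfrac q r xs" using less.hyps[of r q] r by auto
    then obtain y ys where ys: "xs = y # ys" unfolding is_neg_cfrac_def by (cases xs) auto
    have "(of_int p / of_int q :: rat) = of_int x - of_int r / of_int q"
      using less.prems unfolding e by (simp add: field_simps)
    also have "\<dots> = of_int x - 1 / neg_cfrac xs"
      using xs unfolding is_neg_cfrac_def by (metis divide_divide_eq_right mult_1)
    finally have "is_neg_cfrac p q (x # xs)" using xs x2 ys unfolding is_neg_cfrac_def by auto
    then show ?thesis ..
  qed
qed

lemma neg_cfrac_ex1:
  assumes "1 \<le> q" "q < p"
  shows "\<exists>!xs. is_neg_cfrac p q xs"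
proof -
  obtain xs where "is_neg_cfrac p q xs" using neg_cfrac_ex[OF assms] by blast
  then show ?thesis unfolding is_neg_cfrac_def by (intro ex1I[of _ xs]) (auto intro: neg_cfrac_inj)
qed

lemma seifert_data_int:
  fixes a b :: "nat \<Rightarrow> int"
  assumes "\<forall>i \<in> {1..n}. 2 \<le> a i"
  shows "((\<Sum>i=1..n. of_int (b i) / of_int (a i)) * (\<Prod>j=1..n. of_int (a j)) =
       (- 1 - of_int e\<^sub>0 * (\<Prod>j=1..n. of_int (a j)) :: rat)) \<longleftrightarrow>
     (\<Sum>i=1..n. b i * (\<Prod>j \<in> {1..n} - {i}. a j)) = - 1 - e\<^sub>0 * (\<Prod>j=1..n. a j)"
proof -
  have "(\<Sum>i=1..n. of_int (b i) / of_int (a i)) * (\<Prod>j=1..n. of_int (a j)) =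
      (\<Sum>i=1..n. (of_int (b i * (\<Prod>j \<in> {1..n} - {i}. a j)) :: rat))"
    unfolding sum_distrib_right
  proof (rule sum.cong[OF refl])
    fix i assume i: "i \<in> {1..n}"
    have "a i \<noteq> 0" using i assms by force
    moreover have "(\<Prod>j=1..n. (of_int (a j) :: rat)) =
        of_int (a i) * (\<Prod>j \<in> {1..n} - {i}. of_int (a j))"
      using i by (intro prod.remove) auto
    ultimately show "of_int (b i) / of_int (a i) * (\<Prod>j=1..n. of_int (a j)) =
        (of_int (b i * (\<Prod>j \<in> {1..n} - {i}. a j)) :: rat)"
      by simp
  qed
  also have "\<dots> = of_int (\<Sum>i=1..n. b i * (\<Prod>j \<in> {1..n} - {i}. a j))" by simp
  finally have l: "(\<Sum>i=1..n. of_int (b i) / of_int (a i)) * (\<Prod>j=1..n. of_int (a j)) =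
      (of_int (\<Sum>i=1..n. b i * (\<Prod>j \<in> {1..n} - {i}. a j)) :: rat)" .
  have r: "(- 1 - of_int e\<^sub>0 * (\<Prod>j=1..n. of_int (a j)) :: rat) =
      of_int (- 1 - e\<^sub>0 * (\<Prod>j=1..n. a j))" by simp
  show ?thesis unfolding l r of_int_eq_iff ..
qed

lemma sum_cofactor_cong:
  fixes a b :: "nat \<Rightarrow> int"
  assumes "i \<in> {1..n}"
  shows "[(\<Sum>l=1..n. b l * (\<Prod>j \<in> {1..n} - {l}. a j)) =
    b i * (\<Prod>j \<in> {1..n} - {i}. a j)] (mod a i)"
proof -
  have "(\<Sum>l=1..n. b l * (\<Prod>j \<in> {1..n} - {l}. a j)) =
      b i * (\<Prod>j \<in> {1..n} - {i}. a j) +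
      (\<Sum>l \<in> {1..n} - {i}. b l * (\<Prod>j \<in> {1..n} - {l}. a j))"
    using assms by (intro sum.remove) auto
  moreover have "a i dvd (\<Sum>l \<in> {1..n} - {i}. b l * (\<Prod>j \<in> {1..n} - {l}. a j))"
    using assms by (intro dvd_sum dvd_mult dvd_prodI) auto
  ultimately show ?thesis by (simp add: cong_iff_dvd_diff)
qed

lemma seifert_data_ex:
  assumes a2: "\<forall>i \<in> {1..n}. 2 \<le> a i"
    and cop: "\<forall>i \<in> {1..n}. \<forall>j \<in> {1..n}. i \<noteq> j \<longrightarrow> coprime (a i) (a j)"
  shows "\<exists>e\<^sub>0 b. seifert_data n a e\<^sub>0 b"
proof -
  define P where "P i = (\<Prod>j \<in> {1..n} - {i}. a j)" for i
  have "\<exists>c. 1 \<le> c \<and> c < a i \<and> [c * P i = - 1] (mod a i)" if i: "i \<in> {1..n}" for i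
  proof -
    have "coprime (P i) (a i)"
      unfolding P_def using cop i by (intro prod_coprime_left) auto
    then obtain x where x: "[P i * x = 1] (mod a i)" using cong_solve_coprime_int by blast
    define c where "c = (- x) mod a i"
    have ai: "2 \<le> a i" using a2 i by auto
    have "[c * P i = (- x) * P i] (mod a i)"
      unfolding c_def by (intro cong_mult) auto
    also have "(- x) * P i = - (P i * x)" by simp
    also have "[- (P i * x) = - 1] (mod a i)" using x by (simp add: cong_minus_minus_iff)
    finally have c: "[c * P i = - 1] (mod a i)" .
    have "c \<noteq> 0"
    proof
      assume "c = 0"
      then have "a i dvd 1" using c by (simp add: cong_iff_dvd_diff)
      then show False using ai by simp
    qed
    moreover have "0 \<le> c" "c < a i" unfolding c_def using ai by auto
    ultimately show ?thesis using c by (intro exI[of _ c]) auto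
  qed
  then obtain b0 where b0: "\<And>i. i \<in> {1..n} \<Longrightarrow>
      1 \<le> b0 i \<and> b0 i < a i \<and> [b0 i * P i = - 1] (mod a i)" by metis
  define b where "b i = (if i \<in> {1..n} then b0 i else 0)" for i
  have "[(\<Sum>l=1..n. b l * P l) = - 1] (mod (\<Prod>j=1..n. a j))"
  proof (rule cong_cong_prod_coprime)
    show "\<forall>i \<in> {1..n}. \<forall>j \<in> {1..n}. i \<noteq> j \<longrightarrow> coprime (a i) (a j)" by (fact cop)
    show "\<forall>i \<in> {1..n}. [(\<Sum>l=1..n. b l * P l) = - 1] (mod a i)"
    proof
      fix i assume i: "i \<in> {1..n}"
      have "[(\<Sum>l=1..n. b l * P l) = b i * P i] (mod a i)"
        unfolding P_def using sum_cofactor_cong[OF i] .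
      also have "[b i * P i = - 1] (mod a i)" using b0[OF i] i by (simp add: b_def)
      finally show "[(\<Sum>l=1..n. b l * P l) = - 1] (mod a i)" .
    qed
  qed
  then obtain c where "(\<Sum>l=1..n. b l * P l) - (- 1) = (\<Prod>j=1..n. a j) * c"
    unfolding cong_iff_dvd_diff by blast
  then have "(\<Sum>l=1..n. b l * P l) = - 1 - (- c) * (\<Prod>j=1..n. a j)" by (simp add: algebra_simps)
  then have "seifert_data n a (- c) b"
    unfolding seifert_data_def seifert_data_int[OF a2] P_def using b0 by (auto simp: b_def)
  then show ?thesis by blast
qed

lemma seifert_data_unique:
  assumes a2: "\<forall>i \<in> {1..n}. 2 \<le> a i"
    and d: "seifert_data n a e b" "seifert_data n a e' b'"
  shows "e = e' \<and> b = b'"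
proof -
  define P where "P i = (\<Prod>j \<in> {1..n} - {i}. a j)" for i
  define A where "A = (\<Prod>j=1..n. a j)"
  have A0: "A \<noteq> 0" unfolding A_def using a2 by force
  have s: "(\<Sum>l=1..n. b l * P l) = - 1 - e * A" "(\<Sum>l=1..n. b' l * P l) = - 1 - e' * A"
    using d unfolding seifert_data_def seifert_data_int[OF a2] P_def A_def by auto
  have "b i = b' i" for i
  proof (cases "i \<in> {1..n}")
    case i: True
    have dA: "a i dvd A" unfolding A_def using i by (intro dvd_prodI) auto
    have "[- 1 - e * A = - 1] (mod a i)" "[- 1 - e' * A = - 1] (mod a i)"
      using dA by (simp_all add: cong_iff_dvd_diff)
    then have c1: "[b i * P i = - 1] (mod a i)" and c2: "[b' i * P i = - 1] (mod a i)"
      using sum_cofactor_cong[OF i, of b a] sum_cofactor_cong[OF i, of b' a] s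
      unfolding P_def[symmetric] by (metis cong_sym cong_trans)+
    have "coprime (P i) (a i)"
    proof (rule coprimeI)
      fix t assume t: "t dvd P i" "t dvd a i"
      then have "[b i * P i = - 1] (mod t)" using c1 cong_dvd_modulus by blast
      then have "t dvd b i * P i + 1" by (simp add: cong_iff_dvd_diff)
      moreover have "t dvd b i * P i" using t(1) by simp
      ultimately show "is_unit t" using dvd_add_right_iff by blast
    qed
    moreover have "[b i * P i = b' i * P i] (mod a i)" using c1 c2 cong_sym cong_trans by blast
    ultimately have "[b i = b' i] (mod a i)" using cong_mult_rcancel by blast
    moreover have "0 \<le> b i" "b i < a i" "0 \<le> b' i" "b' i < a i"
      using d i unfolding seifert_data_def by fastforce+
    ultimately show ?thesis by (simp add: cong_def)
  qed (use d in \<open>auto simp: seifert_data_def\<close>)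
  then have bb: "b = b'" by blast
  then have "e * A = e' * A" using s by simp
  then show ?thesis using A0 bb by simp
qed

lemma seifert_data_e0_b:
  assumes "\<forall>i \<in> {1..n}. 2 \<le> a i"
    and "\<forall>i \<in> {1..n}. \<forall>j \<in> {1..n}. i \<noteq> j \<longrightarrow> coprime (a i) (a j)"
  shows "seifert_data n a (seifert_e0 n a) (seifert_b n a)"
proof -
  obtain e b where d: "seifert_data n a e b" using seifert_data_ex[OF assms] by blast
  have "seifert_e0 n a = e"
    unfolding seifert_e0_def using d seifert_data_unique[OF assms(1)] by (intro the_equality) blast+
  moreover have "seifert_b n a = b"
    unfolding seifert_b_def using d seifert_data_unique[OF assms(1)] by (intro the_equality) blast+
  ultimately show ?thesis using d by simp
qed

lemma leg_expansion_neg_cfrac: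
  assumes "\<forall>i \<in> {1..n}. 2 \<le> a i"
    and "\<forall>i \<in> {1..n}. \<forall>j \<in> {1..n}. i \<noteq> j \<longrightarrow> coprime (a i) (a j)"
    and "i \<in> {1..n}"
  shows "is_neg_cfrac (a i) (seifert_b n a i) (leg_expansion (a i) (seifert_b n a i))"
proof -
  have "1 \<le> seifert_b n a i" "seifert_b n a i < a i"
    using seifert_data_e0_b[OF assms(1,2)] assms(3) by (auto simp: seifert_data_def)
  then show ?thesis unfolding leg_expansion_def by (rule theI'[OF neg_cfrac_ex1])
qed

end

theory Submission
  imports Defs
begin

text \<open>
  Fix a characteristic vector \<open>k\<close>. A leg with decorations at most \<open>- 2\<close> contributes to \<open>- weight\<close> a
  convex function of each coordinate, given the preceding one, with integral slopes; hence for a fixed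
  central coordinate \<open>t\<close> every lattice point can be moved to an optimal one without decreasing the
  weight, and the components of the superlevel sets are the maximal runs of \<open>t\<close> on which the minimum
  \<open>tau t\<close> of \<open>- weight\<close> is small. The reflection acts by \<open>t \<mapsto> \<sigma> - t\<close>, so the stem consists of the
  symmetric runs, and the monotone subroot is determined by the minimum of \<open>tau\<close> on each of them.

  The Seifert invariants change only in \<open>(a\<^sub>n, b\<^sub>n)\<close>, which becomes \<open>(a\<^sub>n + 2 \<alpha>, b\<^sub>n + 2 B)\<close> with
  \<open>a\<^sub>n B - b\<^sub>n \<alpha> = 1\<close>; on continued fractions this appends \<open>[k + 1, 2]\<close> to the last leg. The
  larger lattice is the orthogonal sum of the smaller one and two copies of \<open>\<langle>- 1\<rangle>\<close>, whose generators
  have central coordinate \<open>\<alpha>\<close> and differ by the outermost vertex. So graded characteristic vectors can be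
  compared in both directions, up to multiples of \<open>2 \<alpha>\<close> in the central coordinate. Finally
  \<open>tau (t + \<alpha>) - tau t\<close> is nondecreasing in \<open>t\<close> and odd about the centre, so \<open>tau\<close> attains its smallest
  value in each class modulo \<open>\<alpha>\<close> within \<open>\<alpha> / 2\<close> of the centre. On this window the two functions \<open>tau\<close>
  agree, and nothing outside of it can be seen by the monotone subroots.
\<close>

section \<open>Graded roots with a reflection\<close>

text \<open>Two vertices are appended, and not one, for reasons of parity. Let \<open>\<eta>\<close>
  be the lattice vector dual to the outermost old vertex of the last leg and \<open>u1\<close>,
  \<open>u2\<close> the new vertices; then \<open>u1 - \<eta>\<close> and
  \<open>u1 - \<eta> + u2\<close> are the generators of square - 1. A characteristic vector has an
  odd coefficient on each of them. Coefficients - 1 and 1 add just \<open>u2\<close>, so the central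
  coordinate is kept, whereas a single generator would move it by an odd multiple of \<alpha>. In
  the other direction, two odd squares sum to at least 2, which is exactly what the normalisation by
  the number of vertices gains, so projecting to the smaller lattice never raises the grading. But
  the projection moves the centre, and so gradings can be matched only where \<open>tau\<close> is
  least in its residue class. This is enough because the monotone subroot records only how low one
  can get inside the part of the root below each stem vertex, and such a minimum does not change
  when a point is replaced by one that is nearer to the axis and not higher.\<close>

locale sym_root =
  fixes R :: "'a graded_root" and par :: "'a \<Rightarrow> 'a" and lev :: "'a \<Rightarrow> int" and g0 :: real
  assumes par_verts: "v \<in> rverts R \<Longrightarrow> par v \<in> rverts R"
    and rup_iff: "(u, v) \<in> rup R \<longleftrightarrow> u \<in> rverts R \<and> v = par u"
    and grade: "v \<in> rverts R \<Longrightarrow> rgrade R v = g0 + 2 * of_int (lev v)"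
    and lev_par: "v \<in> rverts R \<Longrightarrow> lev (par v) = lev v + 1"
    and refl_verts: "v \<in> rverts R \<Longrightarrow> rrefl R v \<in> rverts R"
    and refl_refl: "v \<in> rverts R \<Longrightarrow> rrefl R (rrefl R v) = v"
    and lev_refl: "v \<in> rverts R \<Longrightarrow> lev (rrefl R v) = lev v"
    and refl_par: "v \<in> rverts R \<Longrightarrow> rrefl R (par v) = par (rrefl R v)"
    and stem_unique: "u \<in> stem R \<Longrightarrow> v \<in> stem R \<Longrightarrow> lev u = lev v \<Longrightarrow> u = v"
    and reaches_stem: "v \<in> rverts R \<Longrightarrow> \<exists>d. (par ^^ d) v \<in> stem R"
    and stem_bounded: "\<exists>r \<in> stem R. \<forall>s \<in> stem R. lev r \<le> lev s"
begin

abbreviation bot where "bot \<equiv> stem_bottom R"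
abbreviation sv where "sv \<equiv> stem_vertex R"
abbreviation J where "J \<equiv> rrefl R"

lemma stem_verts: "v \<in> stem R \<Longrightarrow> v \<in> rverts R"
  by (simp add: stem_def)

lemma par_pow_verts: "v \<in> rverts R \<Longrightarrow> (par ^^ d) v \<in> rverts R"
  by (induction d) (auto intro: par_verts)

lemma lev_par_pow: "v \<in> rverts R \<Longrightarrow> lev ((par ^^ d) v) = lev v + int d"
  by (induction d) (auto simp: lev_par par_pow_verts)

lemma refl_par_pow: "v \<in> rverts R \<Longrightarrow> J ((par ^^ d) v) = (par ^^ d) (J v)"
  by (induction d) (auto simp: refl_par par_pow_verts)

lemma par_stem: "v \<in> stem R \<Longrightarrow> par v \<in> stem R"
  by (simp add: stem_def par_verts refl_par)

lemma par_pow_stem: "v \<in> stem R \<Longrightarrow> (par ^^ d) v \<in> stem R"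
  by (induction d) (auto intro: par_stem)

text \<open>Edges form the graph of a function, so climbing the root is iterating
  \<open>par\<close>, and path lengths become differences of \<open>lev\<close>.\<close>

lemma up_path_eq:
  assumes "v \<in> rverts R"
  shows "up_path R v = range (\<lambda>d. (par ^^ d) v)"
proof (intro equalityI subsetI)
  fix u assume "u \<in> up_path R v"
  then have "(v, u) \<in> (rup R)\<^sup>*" by (simp add: up_path_def)
  then show "u \<in> range (\<lambda>d. (par ^^ d) v)"
  proof induction
    case base
    show ?case by (rule range_eqI[of _ _ 0]) simp
  next
    case (step y z)
    then obtain d where "y = (par ^^ d) v" by auto
    with step(2) have "z = (par ^^ Suc d) v" by (simp add: rup_iff)
    then show ?case by blast
  qed
next
  fix u assume "u \<in> range (\<lambda>d. (par ^^ d) v)"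
  then obtain d where u: "u = (par ^^ d) v" by auto
  have "(v, (par ^^ d) v) \<in> (rup R)\<^sup>*"
  proof (induction d)
    case (Suc d)
    have "((par ^^ d) v, (par ^^ Suc d) v) \<in> rup R"
      using assms by (simp add: rup_iff par_pow_verts)
    with Suc show ?case by (rule rtrancl_into_rtrancl)
  qed simp
  then show "u \<in> up_path R v" using u by (simp add: up_path_def)
qed

lemma bot_stem: "bot \<in> stem R"
  and bot_least: "s \<in> stem R \<Longrightarrow> lev bot \<le> lev s"
proof -
  obtain r where r: "r \<in> stem R" "\<forall>s \<in> stem R. lev r \<le> lev s" using stem_bounded by blast
  have "bot = r"
    unfolding stem_bottom_def
  proof (rule the_equality)
    show "r \<in> stem R \<and> (\<forall>s \<in> stem R. rgrade R r \<le> rgrade R s)"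
      using r stem_verts by (auto simp: grade)
  next
    fix q assume q: "q \<in> stem R \<and> (\<forall>s \<in> stem R. rgrade R q \<le> rgrade R s)"
    then have "rgrade R q \<le> rgrade R r" using r by blast
    then have "lev q \<le> lev r" using q r stem_verts by (simp add: grade)
    then show "q = r" using q r stem_unique by (meson order_antisym)
  qed
  then show "bot \<in> stem R" "s \<in> stem R \<Longrightarrow> lev bot \<le> lev s" using r by auto
qed

lemma root_parent_eq: "v \<in> rverts R \<Longrightarrow> root_parent R v = par v"
  unfolding root_parent_def by (rule the_equality) (auto simp: rup_iff)

lemma sv_eq: "sv j = (par ^^ j) bot"
proof (induction j)
  case (Suc j)
  have "sv (Suc j) = root_parent R (sv j)" by (simp add: stem_vertex_def)
  also have "\<dots> = par (sv j)"
    by (rule root_parent_eq) (use Suc bot_stem in \<open>simp add: par_pow_verts stem_verts\<close>)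
  finally show ?case using Suc by simp
qed (simp add: stem_vertex_def)

lemma sv_stem: "sv j \<in> stem R"
  unfolding sv_eq by (rule par_pow_stem) (rule bot_stem)

lemma refl_sv: "J (sv j) = sv j"
  using sv_stem[of j] by (simp add: stem_def)

lemma refl_stem_iff: "v \<in> rverts R \<Longrightarrow> J v \<in> stem R \<longleftrightarrow> v \<in> stem R"
  using refl_refl[of v] refl_verts[of v] by (auto simp: stem_def)

lemma lev_sv: "lev (sv j) = lev bot + int j"
  unfolding sv_eq by (rule lev_par_pow) (rule stem_verts, rule bot_stem)

lemma par_sv: "par (sv j) = sv (Suc j)"
  by (simp add: sv_eq)

lemma stem_sv: "s \<in> stem R \<longleftrightarrow> (\<exists>j. s = sv j)"
proof
  assume s: "s \<in> stem R"
  then have "lev s = lev (sv (nat (lev s - lev bot)))" using bot_least by (simp add: lev_sv)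
  then have "s = sv (nat (lev s - lev bot))" using s sv_stem stem_unique by blast
  then show "\<exists>j. s = sv j" ..
qed (auto simp: sv_stem)

lemma sv_inj:
  assumes "sv i = sv j" shows "i = j"
proof -
  have "lev (sv i) = lev (sv j)" by (simp only: assms)
  then show ?thesis by (simp add: lev_sv)
qed

definition dep :: "'a \<Rightarrow> nat" where
  "dep v = (LEAST d. (par ^^ d) v \<in> stem R)"

lemma dep_stem: "v \<in> rverts R \<Longrightarrow> (par ^^ dep v) v \<in> stem R"
  unfolding dep_def by (rule LeastI_ex) (rule reaches_stem)

lemma dep_less: "d < dep v \<Longrightarrow> (par ^^ d) v \<notin> stem R"
  unfolding dep_def by (rule not_less_Least)

text \<open>The stem is closed under \<open>par\<close>, so the first stem vertex met above
  \<open>v\<close> lies below all later ones. Conversely a base is both at or above and at or below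
  this first hit.\<close>

lemma is_base_iff:
  assumes v: "v \<in> rverts R"
  shows "is_base R v b \<longleftrightarrow> b = (par ^^ dep v) v"
proof
  assume b: "is_base R v b"
  have up: "(par ^^ dep v) v \<in> up_path R b"
    using b dep_stem[OF v] unfolding is_base_def up_path_eq[OF v] by blast
  have bs: "b \<in> stem R" and "b \<in> up_path R v" using b by (auto simp: is_base_def)
  then obtain d where d: "b = (par ^^ d) v" using up_path_eq[OF v] by auto
  have "(par ^^ dep v) v \<in> range (\<lambda>d. (par ^^ d) b)"
    using up up_path_eq[OF stem_verts[OF bs]] by simp
  then obtain d' where d': "(par ^^ dep v) v = (par ^^ d') b" by auto
  have "lev ((par ^^ dep v) v) = lev ((par ^^ d') ((par ^^ d) v))" using d d' by simp
  then have "dep v = d' + d" using v by (simp add: lev_par_pow par_pow_verts)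
  moreover have "dep v \<le> d" using dep_less[of d v] bs d by (meson not_le)
  ultimately show "b = (par ^^ dep v) v" using d by simp
next
  assume b: "b = (par ^^ dep v) v"
  have "u \<in> up_path R b" if u: "u \<in> up_path R v \<inter> stem R" for u
  proof -
    obtain d where d: "u = (par ^^ d) v" using u up_path_eq[OF v] by auto
    then have "dep v \<le> d" using u dep_less[of d v] by (meson IntD2 not_le)
    then have "u = (par ^^ (d - dep v)) b" using b d by (simp flip: funpow_add comp_apply[of "par ^^ _"])
    then show ?thesis using up_path_eq[of b] par_pow_verts[OF v] b by auto
  qed
  then show "is_base R v b"
    unfolding is_base_def using b dep_stem[OF v] up_path_eq[OF v] by auto
qed

definition bidx :: "'a \<Rightarrow> nat" where
  "bidx v = (THE j. (par ^^ dep v) v = sv j)"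

lemma bidx: "v \<in> rverts R \<Longrightarrow> (par ^^ dep v) v = sv (bidx v)"
  unfolding bidx_def
  by (rule theI') (use dep_stem[of v] stem_sv sv_inj in \<open>metis\<close>)

lemma cluster_sv: "cluster R (sv j) = {v \<in> rverts R. bidx v = j}"
proof -
  have "is_base R v (sv j) \<longleftrightarrow> bidx v = j" if "v \<in> rverts R" for v
    using that bidx[of v] sv_inj by (auto simp: is_base_iff)
  then show ?thesis by (auto simp: cluster_def)
qed

lemma bidx_le: 
  assumes v: "v \<in> rverts R" and d: "(par ^^ d) v = sv j"
  shows "bidx v \<le> j"
proof -
  have "dep v \<le> d" using dep_less[of d v] d sv_stem[of j] by (metis not_le)
  moreover have "lev v + int d = lev bot + int j" using lev_par_pow[OF v, of d] d lev_sv by simp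
  moreover have "lev v + int (dep v) = lev bot + int (bidx v)"
    using lev_par_pow[OF v, of "dep v"] bidx[OF v] lev_sv by simp
  ultimately show ?thesis by linarith
qed

text \<open>Serves to show that equal gradings of bottoms and tips force branches of equal
  length.\<close>

lemma dep_lev: "v \<in> rverts R \<Longrightarrow> int (dep v) = lev bot + int (bidx v) - lev v"
  using lev_par_pow[of v "dep v"] bidx[of v] lev_sv by simp

lemma sv_below:
  assumes "i \<le> j" shows "(par ^^ (j - i)) (sv i) = sv j"
proof -
  have "(par ^^ (j - i)) ((par ^^ i) bot) = (par ^^ (j - i + i)) bot"
    by (simp only: funpow_add comp_apply)
  then show ?thesis using assms by (simp add: sv_eq)
qed

lemma bidx_below:
  assumes v: "v \<in> rverts R" and "bidx v \<le> j"
  shows "\<exists>d. (par ^^ d) v = sv j"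
proof -
  have "(par ^^ (j - bidx v + dep v)) v = sv j"
    using bidx[OF v] sv_below[OF assms(2)] by (simp add: funpow_add)
  then show ?thesis ..
qed

end

section \<open>The maximal monotone subroot in coordinates\<close>

locale tipped_root = sym_root R par lev g0
  for R :: "'a graded_root" and par lev g0 +
  fixes T :: "'a \<Rightarrow> 'a set"
  assumes tips: "tip_choice R T"
begin

text \<open>\<open>T\<close> offers an unordered mirror pair; one member is chosen here, and
  \<open>J\<close> gives the other.\<close>

definition tip :: "nat \<Rightarrow> 'a" where
  "tip j = (SOME v. v \<in> cluster R (sv j) \<and> (\<forall>u \<in> cluster R (sv j). rgrade R v \<le> rgrade R u) \<and>
     T (sv j) = {v, J v})"

lemma tip: "tip j \<in> cluster R (sv j) \<and> (\<forall>u \<in> cluster R (sv j). rgrade R (tip j) \<le> rgrade R u) \<and>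
     T (sv j) = {tip j, J (tip j)}"
proof -
  have "is_tip R (sv j) (T (sv j))" using tips sv_stem by (auto simp: tip_choice_def)
  then have "\<exists>v. v \<in> cluster R (sv j) \<and> (\<forall>u \<in> cluster R (sv j). rgrade R v \<le> rgrade R u) \<and>
     T (sv j) = {v, J v}" by (auto simp: is_tip_def)
  from someI_ex[OF this] show ?thesis unfolding tip_def .
qed

lemma tip_verts: "tip j \<in> rverts R" and bidx_tip: "bidx (tip j) = j"
  and T_sv: "T (sv j) = {tip j, J (tip j)}"
  using tip[of j] by (auto simp: cluster_sv)

lemma lev_tip_le: "v \<in> rverts R \<Longrightarrow> lev (tip (bidx v)) \<le> lev v"
  using tip[of "bidx v"] tip_verts[of "bidx v"] by (auto simp: cluster_sv grade)

definition records :: "nat set" where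
  "records = {j. \<forall>i<j. lev (tip j) < lev (tip i)}"

text \<open>Why comparing with the added tips alone amounts to comparing with all earlier ones: if
  \<open>tip j\<close> is no record, some earlier tip is at most as high, and repeating this ends at
  a record.\<close>

lemma record_le: "\<exists>i \<in> records. i \<le> j \<and> lev (tip i) \<le> lev (tip j)"
proof (induction j rule: less_induct)
  case (less j)
  show ?case
  proof (cases "j \<in> records")
    case False
    then obtain i where i: "i < j" "lev (tip i) \<le> lev (tip j)" by (auto simp: records_def not_less)
    then obtain i' where "i' \<in> records" "i' \<le> i" "lev (tip i') \<le> lev (tip i)"
      using less.IH by blast
    then show ?thesis using i by (intro bexI[of _ i']) auto
  qed auto
qed

lemma added_tips_eq: "added_tips R T j = (\<Union>i \<in> {i \<in> records. i \<le> j}. {tip i, J (tip i)})"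
proof (induction j)
  case 0
  have "{i \<in> records. i \<le> 0} = {0}" by (auto simp: records_def)
  then show ?case by (simp add: T_sv)
next
  case (Suc j)
  have "(\<forall>v \<in> T (sv (Suc j)). \<forall>u \<in> added_tips R T j. rgrade R v < rgrade R u) \<longleftrightarrow>
      (\<forall>i \<in> records. i \<le> j \<longrightarrow> lev (tip (Suc j)) < lev (tip i))"
    unfolding Suc T_sv by (auto simp: grade tip_verts refl_verts lev_refl)
  also have "\<dots> \<longleftrightarrow> Suc j \<in> records"
  proof
    assume a: "\<forall>i \<in> records. i \<le> j \<longrightarrow> lev (tip (Suc j)) < lev (tip i)"
    have "lev (tip (Suc j)) < lev (tip i)" if i: "i \<le> j" for i
    proof -
      obtain i' where "i' \<in> records" "i' \<le> i" "lev (tip i') \<le> lev (tip i)"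
        using record_le by blast
      then show ?thesis using a i by fastforce
    qed
    then show "Suc j \<in> records" by (auto simp: records_def less_Suc_eq_le)
  qed (auto simp: records_def)
  finally have e: "(\<forall>v \<in> T (sv (Suc j)). \<forall>u \<in> added_tips R T j. rgrade R v < rgrade R u) \<longleftrightarrow>
      Suc j \<in> records" .
  have "{i \<in> records. i \<le> Suc j} = {i \<in> records. i \<le> j} \<union> (if Suc j \<in> records then {Suc j} else {})"
    by (auto simp: le_Suc_eq)
  moreover have "added_tips R T (Suc j) =
      added_tips R T j \<union> (if Suc j \<in> records then T (sv (Suc j)) else {})"
    by (simp only: added_tips.simps e)
  ultimately show ?case unfolding Suc T_sv by auto
qed

text \<open>\<open>Inl j\<close> stands for the \<open>j\<close>-th stem vertex; \<open>Inr (j, d, b)\<close> for the vertex \<open>d\<close> steps above the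
  tip of the \<open>j\<close>-th cluster, reflected if \<open>b\<close>.\<close>

definition indices :: "(nat + nat \<times> nat \<times> bool) set" where
  "indices = range Inl \<union> {Inr (j, d, b) | j d b. j \<in> records \<and> d < dep (tip j)}"

lemma Inl_indices [simp]: "Inl j \<in> indices"
  and Inr_indices [simp]: "Inr (j, d, b) \<in> indices \<longleftrightarrow> j \<in> records \<and> d < dep (tip j)"
  by (auto simp: indices_def)

lemma indices_cases:
  assumes "x \<in> indices"
  obtains j where "x = Inl j"
    | j d b where "x = Inr (j, d, b)" "j \<in> records" "d < dep (tip j)"
  using assms by (auto simp: indices_def)

definition vert :: "nat + nat \<times> nat \<times> bool \<Rightarrow> 'a" where
  "vert x = (case x of Inl j \<Rightarrow> sv j
     | Inr (j, d, b) \<Rightarrow> (if b then J ((par ^^ d) (tip j)) else (par ^^ d) (tip j)))"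

abbreviation (input) M where "M \<equiv> max_monotone_subroot R T"

lemma bidx_pow:
  assumes v: "v \<in> rverts R" and d: "d \<le> dep v"
  shows "dep ((par ^^ d) v) = dep v - d" "bidx ((par ^^ d) v) = bidx v"
proof -
  have e: "(par ^^ e) ((par ^^ d) v) = (par ^^ (e + d)) v" for e by (simp add: funpow_add)
  show dd: "dep ((par ^^ d) v) = dep v - d"
    unfolding dep_def[of "(par ^^ d) v"] e
  proof (rule Least_equality)
    show "(par ^^ (dep v - d + d)) v \<in> stem R" using dep_stem[OF v] d by simp
  next
    fix y assume "(par ^^ (y + d)) v \<in> stem R"
    then have "dep v \<le> y + d" using dep_less[of "y + d" v] by (meson not_le)
    then show "dep v - d \<le> y" by simp
  qed
  show "bidx ((par ^^ d) v) = bidx v"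
    unfolding bidx_def dd e using d by simp
qed

lemma bidx_refl:
  assumes v: "v \<in> rverts R"
  shows "dep (J v) = dep v" "bidx (J v) = bidx v"
proof -
  have e: "(par ^^ d) (J v) = J ((par ^^ d) v)" for d using v by (simp add: refl_par_pow)
  show d: "dep (J v) = dep v"
    unfolding dep_def e using refl_stem_iff par_pow_verts[OF v] by simp
  have "J ((par ^^ dep v) v) = (par ^^ dep v) v" using dep_stem[OF v] by (simp add: stem_def)
  then show "bidx (J v) = bidx v" unfolding bidx_def d e by simp
qed

lemma vert_verts: "x \<in> indices \<Longrightarrow> vert x \<in> rverts R"
  by (auto simp: indices_def vert_def sv_stem stem_verts refl_verts par_pow_verts tip_verts)

lemma stem_vert_iff:
  assumes "x \<in> indices" shows "vert x \<in> stem R \<longleftrightarrow> (\<exists>j. x = Inl j)"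
proof (cases x)
  case (Inr y)
  then obtain j d b where x: "x = Inr (j, d, b)" and d: "d < dep (tip j)"
    using assms by (auto simp: indices_def)
  show ?thesis
    using refl_stem_iff x dep_less[OF d] par_pow_verts[OF tip_verts] by (auto simp: vert_def)
qed (simp add: vert_def sv_stem)

text \<open>The index can be recovered from the vertex: the cluster from the base, the height from
  the level, and the side because no vertex of a branch strictly below its base is fixed by
  \<open>J\<close>.\<close>

lemma vert_inj: "inj_on vert indices"
proof (rule inj_onI)
  fix x y assume x: "x \<in> indices" and y: "y \<in> indices" and e: "vert x = vert y"
  show "x = y"
  proof (cases "vert x \<in> stem R")
    case True
    then obtain i j where "x = Inl i" "y = Inl j" using x y e stem_vert_iff by metis
    then show ?thesis using e sv_inj by (simp add: vert_def)
  next
    case False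
    then obtain j d b j' d' b' where x': "x = Inr (j, d, b)" "d < dep (tip j)"
      and y': "y = Inr (j', d', b')" "d' < dep (tip j')"
      using x y e stem_vert_iff[OF x] stem_vert_iff[OF y] by (auto simp: indices_def)
    have "bidx (vert x) = j" using x' 
      by (auto simp: vert_def bidx_refl bidx_pow par_pow_verts tip_verts bidx_tip)
    moreover have "bidx (vert y) = j'" using y'
      by (auto simp: vert_def bidx_refl bidx_pow par_pow_verts tip_verts bidx_tip)
    ultimately have j: "j = j'" using e by simp
    have "lev (vert x) = lev (tip j) + int d" using x'
      by (auto simp: vert_def lev_refl lev_par_pow par_pow_verts tip_verts)
    moreover have "lev (vert y) = lev (tip j') + int d'" using y'
      by (auto simp: vert_def lev_refl lev_par_pow par_pow_verts tip_verts)
    ultimately have d: "d = d'" using e j by simp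
    have "J ((par ^^ d) (tip j)) \<noteq> (par ^^ d) (tip j)"
      using dep_less[OF x'(2)] par_pow_verts[OF tip_verts] by (auto simp: stem_def)
    then have "b = b'" using e x' y' j d by (auto simp: vert_def split: if_splits)
    then show ?thesis using x' y' j d by simp
  qed
qed

lemma up_path_tip:
  "up_path R (tip j) = {(par ^^ d) (tip j) | d. d < dep (tip j)} \<union> range (\<lambda>i. sv (i + j))"
proof -
  have "range (\<lambda>d. (par ^^ d) (tip j)) = {(par ^^ d) (tip j) | d. d < dep (tip j)} \<union>
      range (\<lambda>i. (par ^^ (i + dep (tip j))) (tip j))"
  proof (intro equalityI subsetI)
    fix u assume "u \<in> range (\<lambda>d. (par ^^ d) (tip j))"
    then obtain d where d: "u = (par ^^ d) (tip j)" by auto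
    show "u \<in> {(par ^^ d) (tip j) | d. d < dep (tip j)} \<union>
      range (\<lambda>i. (par ^^ (i + dep (tip j))) (tip j))"
    proof (cases "d < dep (tip j)")
      case False
      then have "u = (par ^^ (d - dep (tip j) + dep (tip j))) (tip j)" using d by simp
      then show ?thesis by blast
    qed (use d in auto)
  qed auto
  moreover have "(par ^^ (i + dep (tip j))) (tip j) = sv (i + j)" for i
    using bidx[OF tip_verts[of j]] by (simp add: funpow_add bidx_tip sv_eq)
  ultimately show ?thesis using up_path_eq[OF tip_verts] by simp
qed

lemma up_path_refl_tip: "up_path R (J (tip j)) = J ` up_path R (tip j)"
  using up_path_eq[OF tip_verts] up_path_eq[OF refl_verts[OF tip_verts]]
  by (simp add: refl_par_pow[OF tip_verts] image_image)

lemma subroot_verts: "rverts M = vert ` indices"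
proof -
  have "rverts M = stem R \<union> (\<Union>j. \<Union>v \<in> added_tips R T j. up_path R v)"
    by (simp add: max_monotone_subroot_def Let_def)
  also have "(\<Union>j. \<Union>v \<in> added_tips R T j. up_path R v) =
      (\<Union>j \<in> records. up_path R (tip j) \<union> J ` up_path R (tip j))"
    unfolding added_tips_eq by (auto simp: up_path_refl_tip)
  also have "stem R \<union> \<dots> = vert ` indices"
  proof (intro equalityI subsetI)
    fix u assume u: "u \<in> stem R \<union> (\<Union>j \<in> records. up_path R (tip j) \<union> J ` up_path R (tip j))"
    show "u \<in> vert ` indices"
    proof (cases "u \<in> stem R")
      case True
      then obtain j where "u = vert (Inl j)" using stem_sv by (auto simp: vert_def)
      then show ?thesis by (auto simp: indices_def)
    next
      case False
      then obtain j where j: "j \<in> records"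
        and "u \<in> up_path R (tip j) \<union> J ` up_path R (tip j)" using u by blast
      then obtain w where w: "w \<in> up_path R (tip j)" "u = w \<or> u = J w" by blast
      have "w \<notin> stem R" using w False by (auto simp: stem_def)
      then have "w \<notin> range (\<lambda>i. sv (i + j))" using sv_stem by blast
      then obtain d where d: "d < dep (tip j)" "w = (par ^^ d) (tip j)"
        using w(1) unfolding up_path_tip by blast
      have "u = vert (Inr (j, d, u \<noteq> w))" using w(2) d(2) by (auto simp: vert_def)
      moreover have "Inr (j, d, u \<noteq> w) \<in> indices" using j d by simp
      ultimately show ?thesis by (rule image_eqI)
    qed
  next
    fix u assume "u \<in> vert ` indices"
    then obtain x where x: "x \<in> indices" "u = vert x" by blast
    from x(1) show "u \<in> stem R \<union> (\<Union>j \<in> records. up_path R (tip j) \<union> J ` up_path R (tip j))"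
    proof (cases rule: indices_cases)
      case (1 j)
      then show ?thesis using x(2) sv_stem by (simp add: vert_def)
    next
      case (2 j d b)
      have "(par ^^ d) (tip j) \<in> up_path R (tip j)" unfolding up_path_eq[OF tip_verts] by blast
      then have "u \<in> up_path R (tip j) \<union> J ` up_path R (tip j)" using x(2) 2(1) by (simp add: vert_def)
      then show ?thesis using 2(2) by blast
    qed
  qed
  finally show ?thesis .
qed

definition pidx :: "nat + nat \<times> nat \<times> bool \<Rightarrow> nat + nat \<times> nat \<times> bool" where
  "pidx x = (case x of Inl j \<Rightarrow> Inl (Suc j)
     | Inr (j, d, b) \<Rightarrow> if Suc d < dep (tip j) then Inr (j, Suc d, b) else Inl j)"

lemma vert_pidx:
  assumes "x \<in> indices"
  shows "pidx x \<in> indices" "par (vert x) = vert (pidx x)"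
proof -
  have "par ((par ^^ d) (tip j)) = sv j" if "d < dep (tip j)" "\<not> Suc d < dep (tip j)" for d j
  proof -
    have "dep (tip j) = Suc d" using that by simp
    then show ?thesis using bidx[OF tip_verts[of j]] by (simp add: bidx_tip)
  qed
  then show "par (vert x) = vert (pidx x)" using assms
    by (auto simp: indices_def vert_def pidx_def par_sv par_pow_verts tip_verts refl_sv
        simp flip: refl_par)
  show "pidx x \<in> indices" using assms by (cases rule: indices_cases) (auto simp: pidx_def)
qed

lemma vert_refl:
  assumes "x \<in> indices"
  shows "J (vert x) = vert (map_sum id (map_prod id (map_prod id Not)) x)"
proof -
  show ?thesis using assms
    by (auto simp: indices_def vert_def refl_sv refl_refl par_pow_verts tip_verts)
qed

lemma refl_indices: "x \<in> indices \<Longrightarrow> map_sum id (map_prod id (map_prod id Not)) x \<in> indices"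
  by (erule indices_cases) auto

lemma vert_rgrade:
  assumes "x \<in> indices"
  shows "rgrade M (vert x) = g0 + 2 * of_int (case x of Inl j \<Rightarrow> lev bot + int j
     | Inr (j, d, b) \<Rightarrow> lev (tip j) + int d)"
proof -
  have "rgrade M (vert x) = g0 + 2 * of_int (lev (vert x))"
    using vert_verts[OF assms] by (simp add: max_monotone_subroot_def Let_def grade)
  also have "lev (vert x) = (case x of Inl j \<Rightarrow> lev bot + int j
     | Inr (j, d, b) \<Rightarrow> lev (tip j) + int d)"
    using assms
    by (auto simp: indices_def vert_def lev_sv lev_refl lev_par_pow par_pow_verts tip_verts)
  finally show ?thesis .
qed

lemma subroot_rup:
  assumes "x \<in> indices" "y \<in> indices"
  shows "(vert x, vert y) \<in> rup M \<longleftrightarrow> y = pidx x"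
proof -
  have "rup M = rup R \<inter> (rverts M \<times> rverts M)"
    by (simp add: max_monotone_subroot_def Let_def)
  then have "(vert x, vert y) \<in> rup M \<longleftrightarrow> vert y = vert (pidx x)"
    using assms subroot_verts vert_verts vert_pidx by (auto simp: rup_iff)
  also have "\<dots> \<longleftrightarrow> y = pidx x"
    using inj_on_eq_iff[OF vert_inj] assms vert_pidx by blast
  finally show ?thesis .
qed

lemma subroot_refl: "rrefl M = J"
  by (simp add: max_monotone_subroot_def Let_def)

end

section \<open>Comparing the monotone subroots of two graded roots\<close>

definition root_below :: "'a graded_root \<Rightarrow> nat \<Rightarrow> 'a set" where
  "root_below R j = {v \<in> rverts R. stem_vertex R j \<in> up_path R v}"

lemma (in sym_root) root_below_iff: "v \<in> root_below R j \<longleftrightarrow> v \<in> rverts R \<and> bidx v \<le> j"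
proof
  assume "v \<in> root_below R j"
  then show "v \<in> rverts R \<and> bidx v \<le> j"
    using up_path_eq[of v] bidx_le[of v] by (auto simp: root_below_def)
next
  assume v: "v \<in> rverts R \<and> bidx v \<le> j"
  then obtain d where "(par ^^ d) v = sv j" using bidx_below by blast
  then have "sv j \<in> range (\<lambda>d. (par ^^ d) v)" by (metis rangeI)
  then show "v \<in> root_below R j" using v up_path_eq[of v] by (simp add: root_below_def)
qed

text \<open>Vertices are compared inside the down-sets of stem vertices and not inside clusters: the
  comparison need not respect bases, and the lowest gradings in the down-sets already determine the
  records and their tips.\<close>

locale two_roots = A: tipped_root R par lev g0 T + B: tipped_root R' par' lev' g0' T'
  for R :: "'a graded_root" and par lev g0 T and R' :: "'b graded_root" and par' lev' g0' T' +
  assumes bottom: "rgrade R (stem_bottom R) = rgrade R' (stem_bottom R')"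
    and below: "v \<in> root_below R j \<Longrightarrow> \<exists>v' \<in> root_below R' j. rgrade R' v' \<le> rgrade R v"
    and below': "v' \<in> root_below R' j \<Longrightarrow> \<exists>v \<in> root_below R j. rgrade R v \<le> rgrade R' v'"
begin

text \<open>Index \<open>j\<close> is the first at which the first root gets as low as
  \<open>tip j\<close>, so by \<open>below'\<close> no tip of the second root with smaller index
  gets that low (\<open>lower\<close>). The vertex that \<open>below\<close> provides for
  \<open>tip j\<close> therefore has base index exactly \<open>j\<close>.\<close>

lemma record_transfer:
  assumes j: "j \<in> A.records"
  shows "j \<in> B.records" "rgrade R' (B.tip j) \<le> rgrade R (A.tip j)"
proof -
  have lower: "j \<le> i" if i: "rgrade R' (B.tip i) \<le> rgrade R (A.tip j)" for i
  proof -
    have "B.tip i \<in> root_below R' i" using B.root_below_iff B.tip_verts B.bidx_tip by simp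
    then obtain v where v: "v \<in> root_below R i" "rgrade R v \<le> rgrade R' (B.tip i)"
      using below' by blast
    then have vi: "v \<in> rverts R" "A.bidx v \<le> i" using A.root_below_iff by auto
    have "rgrade R v \<le> rgrade R (A.tip j)" using v i by simp
    then have "lev v \<le> lev (A.tip j)" using vi A.tip_verts by (simp add: A.grade)
    then have "lev (A.tip (A.bidx v)) \<le> lev (A.tip j)" using A.lev_tip_le[OF vi(1)] by simp
    then have "\<not> A.bidx v < j" using j by (auto simp: A.records_def)
    then show ?thesis using vi by simp
  qed
  have "A.tip j \<in> root_below R j" using A.root_below_iff A.tip_verts A.bidx_tip by simp
  then obtain v where v: "v \<in> root_below R' j" "rgrade R' v \<le> rgrade R (A.tip j)"
    using below by blast
  then have vj: "v \<in> rverts R'" "B.bidx v \<le> j" using B.root_below_iff by auto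
  have "rgrade R' (B.tip (B.bidx v)) \<le> rgrade R' v"
    using B.lev_tip_le[OF vj(1)] vj B.tip_verts by (simp add: B.grade)
  then have le: "rgrade R' (B.tip (B.bidx v)) \<le> rgrade R (A.tip j)" using v by simp
  then have "B.bidx v = j" using lower vj by fastforce
  then show le': "rgrade R' (B.tip j) \<le> rgrade R (A.tip j)" using le by simp
  have "lev' (B.tip j) < lev' (B.tip i)" if "i < j" for i
  proof (rule ccontr)
    assume "\<not> ?thesis"
    then have "rgrade R' (B.tip i) \<le> rgrade R' (B.tip j)" using B.tip_verts by (simp add: B.grade)
    then have "j \<le> i" using lower le' by simp
    then show False using that by simp
  qed
  then show "j \<in> B.records" by (simp add: B.records_def)
qed

end

lemma root_iso_index:
  assumes e: "bij_betw e I (rverts R)" and e': "bij_betw e' I (rverts R')"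
    and up: "\<And>x y. x \<in> I \<Longrightarrow> y \<in> I \<Longrightarrow> (e x, e y) \<in> rup R \<longleftrightarrow> (e' x, e' y) \<in> rup R'"
    and gr: "\<And>x. x \<in> I \<Longrightarrow> rgrade R (e x) = rgrade R' (e' x)"
    and r: "\<And>x. x \<in> I \<Longrightarrow> \<rho> x \<in> I"
    and re: "\<And>x. x \<in> I \<Longrightarrow> rrefl R (e x) = e (\<rho> x)"
    and re': "\<And>x. x \<in> I \<Longrightarrow> rrefl R' (e' x) = e' (\<rho> x)"
  shows "root_iso R R'"
proof -
  define f where "f = e' \<circ> inv_into I e"
  have "bij_betw f (rverts R) (rverts R')"
    unfolding f_def by (rule bij_betw_trans[OF bij_betw_inv_into[OF e] e'])
  moreover have f: "f (e x) = e' x" if "x \<in> I" for x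
    using that bij_betw_inv_into_left[OF e that] by (simp add: f_def)
  moreover have "\<exists>x \<in> I. v = e x" if "v \<in> rverts R" for v
    using that e by (auto simp: bij_betw_def)
  ultimately show ?thesis
    unfolding root_iso_def using up gr r re re' by (intro exI[of _ f]) (smt (verit, best))
qed

context two_roots
begin

lemma flipped: "two_roots R' par' lev' g0' T' R par lev g0 T"
  by unfold_locales (use bottom below below' in auto)

lemma records_eq: "A.records = B.records"
  using record_transfer(1) two_roots.record_transfer(1)[OF flipped] by blast

lemma tip_grade_eq: "j \<in> A.records \<Longrightarrow> rgrade R (A.tip j) = rgrade R' (B.tip j)"
  using record_transfer[of j] two_roots.record_transfer(2)[OF flipped, of j] by fastforce

lemma dep_tip_eq:
  assumes "j \<in> A.records" shows "A.dep (A.tip j) = B.dep (B.tip j)"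
proof -
  have "rgrade R (A.tip j) = rgrade R' (B.tip j)" by (rule tip_grade_eq) fact
  moreover have "rgrade R (stem_bottom R) = rgrade R' (stem_bottom R')" by (rule bottom)
  ultimately have "lev (stem_bottom R) - lev (A.tip j) = lev' (stem_bottom R') - lev' (B.tip j)"
    using A.tip_verts B.tip_verts A.stem_verts[OF A.bot_stem] B.stem_verts[OF B.bot_stem]
    by (simp add: A.grade B.grade)
  then show ?thesis
    using A.dep_lev[OF A.tip_verts[of j]] B.dep_lev[OF B.tip_verts[of j]]
    by (simp add: A.bidx_tip B.bidx_tip)
qed

lemma indices_eq: "A.indices = B.indices"
  unfolding A.indices_def B.indices_def using records_eq dep_tip_eq by auto

theorem monotone_subroots_iso:
  "root_iso (max_monotone_subroot R T) (max_monotone_subroot R' T')"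
proof (rule root_iso_index)
  show "bij_betw A.vert A.indices (rverts (max_monotone_subroot R T))"
    using A.vert_inj A.subroot_verts by (simp add: bij_betw_def)
  show "bij_betw B.vert A.indices (rverts (max_monotone_subroot R' T'))"
    unfolding indices_eq using B.vert_inj B.subroot_verts by (simp add: bij_betw_def)
  show "(A.vert x, A.vert y) \<in> rup (max_monotone_subroot R T) \<longleftrightarrow>
      (B.vert x, B.vert y) \<in> rup (max_monotone_subroot R' T')"
    if x: "x \<in> A.indices" and y: "y \<in> A.indices" for x y
  proof -
    have "A.pidx x = B.pidx x"
      using x dep_tip_eq by (auto simp: A.indices_def A.pidx_def B.pidx_def)
    then show ?thesis
      using x y A.subroot_rup B.subroot_rup indices_eq by simp
  qed
  show "rgrade (max_monotone_subroot R T) (A.vert x) = rgrade (max_monotone_subroot R' T') (B.vert x)"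
    if x: "x \<in> A.indices" for x
  proof -
    have "g0 + 2 * of_int (lev (A.tip j)) = g0' + 2 * of_int (lev' (B.tip j))" if "j \<in> A.records" for j
      using tip_grade_eq[OF that] A.tip_verts B.tip_verts by (simp add: A.grade B.grade)
    moreover have "g0 + 2 * of_int (lev (stem_bottom R)) = g0' + 2 * of_int (lev' (stem_bottom R'))"
      using bottom A.stem_verts[OF A.bot_stem] B.stem_verts[OF B.bot_stem]
      by (simp add: A.grade B.grade)
    ultimately show ?thesis
      using x A.vert_rgrade[OF x] B.vert_rgrade[of x] unfolding indices_eq[symmetric]
      by (auto simp: A.indices_def algebra_simps)
  qed
qed (use A.refl_indices A.vert_refl B.vert_refl indices_eq A.subroot_refl B.subroot_refl in auto)

end

section \<open>Components of superlevel sets\<close>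

lemma lattice_Ints: "x \<in> lattice \<Gamma> \<Longrightarrow> x v \<in> \<int>"
  by (cases "v \<in> pverts \<Gamma>") (auto simp: lattice_def)

definition lat_step :: "('v, 'm) plumbing_scheme \<Rightarrow> ('v \<Rightarrow> real) \<Rightarrow> int \<Rightarrow> (('v \<Rightarrow> real) \<times> ('v \<Rightarrow> real)) set" where
  "lat_step \<Gamma> k m = {(x, y). x \<in> lattice \<Gamma> \<and> y \<in> lattice \<Gamma> \<and>
     of_int m \<le> weight \<Gamma> k x \<and> of_int m \<le> weight \<Gamma> k y \<and>
     (\<exists>v \<in> pverts \<Gamma>. y = x(v := x v + 1) \<or> x = y(v := y v + 1))}"

text \<open>Membership of \<open>x\<close> is demanded because the reflexive closure alone would
  relate every function to itself.\<close>

definition lat_conn :: "('v, 'm) plumbing_scheme \<Rightarrow> ('v \<Rightarrow> real) \<Rightarrow> int \<Rightarrow> ('v \<Rightarrow> real) \<Rightarrow> ('v \<Rightarrow> real) \<Rightarrow> bool" where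
  "lat_conn \<Gamma> k m x y \<longleftrightarrow> x \<in> lattice \<Gamma> \<and> of_int m \<le> weight \<Gamma> k x \<and> (x, y) \<in> (lat_step \<Gamma> k m)\<^sup>*"

lemma lat_step_sym: "(x, y) \<in> lat_step \<Gamma> k m \<Longrightarrow> (y, x) \<in> lat_step \<Gamma> k m"
  by (auto simp: lat_step_def)

lemma lat_conn_in:
  assumes "lat_conn \<Gamma> k m x y"
  shows "x \<in> lattice \<Gamma>" "y \<in> lattice \<Gamma>" "of_int m \<le> weight \<Gamma> k x" "of_int m \<le> weight \<Gamma> k y"
proof -
  have "(x, y) \<in> (lat_step \<Gamma> k m)\<^sup>*" using assms by (simp add: lat_conn_def)
  then show "y \<in> lattice \<Gamma>" "of_int m \<le> weight \<Gamma> k y"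
    using assms by (induction; auto simp: lat_step_def lat_conn_def)+
qed (use assms in \<open>auto simp: lat_conn_def\<close>)

lemma lat_conn_refl: "x \<in> lattice \<Gamma> \<Longrightarrow> of_int m \<le> weight \<Gamma> k x \<Longrightarrow> lat_conn \<Gamma> k m x x"
  by (simp add: lat_conn_def)

lemma lat_conn_trans: "lat_conn \<Gamma> k m x y \<Longrightarrow> lat_conn \<Gamma> k m y z \<Longrightarrow> lat_conn \<Gamma> k m x z"
  by (auto simp: lat_conn_def)

lemma lat_conn_sym:
  assumes "lat_conn \<Gamma> k m x y" shows "lat_conn \<Gamma> k m y x"
proof -
  have "sym (lat_step \<Gamma> k m)" by (auto intro: symI lat_step_sym)
  then have "(y, x) \<in> (lat_step \<Gamma> k m)\<^sup>*"
    using assms by (auto simp: lat_conn_def dest: sym_rtrancl symD)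
  then show ?thesis using lat_conn_in[OF assms] by (simp add: lat_conn_def)
qed

lemma lat_conn_step: "(x, y) \<in> lat_step \<Gamma> k m \<Longrightarrow> lat_conn \<Gamma> k m x y"
  by (auto simp: lat_conn_def lat_step_def)

lemma cube_corners_lattice:
  assumes "x \<in> lattice \<Gamma>" "I \<subseteq> pverts \<Gamma>" "y \<in> cube_corners x I"
  shows "y \<in> lattice \<Gamma>"
  using assms by (auto simp: cube_corners_def lattice_def)

definition vfloor :: "('v \<Rightarrow> real) \<Rightarrow> 'v \<Rightarrow> real" where
  "vfloor p v = of_int \<lfloor>p v\<rfloor>"

text \<open>Gives each point a lattice representative that does not depend on the cube in which it
  is found. A coordinate is taken at the upper end of its edge only if the point attains that
  end.\<close>

lemma vfloor_corner:
  assumes x: "x \<in> lattice \<Gamma>" and I: "I \<subseteq> pverts \<Gamma>" and p: "p \<in> cube x I"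
  shows "vfloor p \<in> cube_corners x I"
proof -
  let ?J = "{v \<in> I. p v = x v + 1}"
  have "vfloor p v = x v + (if v \<in> ?J then 1 else 0)" for v
  proof -
    obtain j where j: "x v = of_int j" using lattice_Ints[OF x] Ints_cases by metis
    show ?thesis
    proof (cases "v \<in> I")
      case True
      then have "x v \<le> p v" "p v \<le> x v + 1" using p by (auto simp: cube_def)
      then show ?thesis using j True by (auto simp: vfloor_def floor_eq_iff)
    next
      case False
      then have "p v = x v" using p by (auto simp: cube_def)
      then show ?thesis using j False by (auto simp: vfloor_def)
    qed
  qed
  then have "vfloor p = (\<lambda>v. x v + (if v \<in> ?J then 1 else 0))" by blast
  then show ?thesis unfolding cube_corners_def by blast
qed

lemma vfloor_lattice:
  assumes "x \<in> lattice \<Gamma>" shows "vfloor x = x"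
proof
  fix v
  obtain j where "x v = of_int j" using lattice_Ints[OF assms] Ints_cases by metis
  then show "vfloor x v = x v" by (simp add: vfloor_def)
qed

text \<open>The open box around \<open>p\<close> meets no integral coordinate hyperplane except
  those through \<open>p\<close>, while the faces of a cube lie on such hyperplanes. So a cube that
  meets the box contains \<open>p\<close>.\<close>

lemma cube_near:
  assumes x: "x \<in> lattice \<Gamma>" and I: "I \<subseteq> pverts \<Gamma>" and q: "q \<in> cube x I"
    and near: "\<forall>v \<in> pverts \<Gamma>. of_int \<lceil>p v\<rceil> - 1 < q v \<and> q v < of_int \<lfloor>p v\<rfloor> + 1"
    and p0: "\<forall>v. v \<notin> pverts \<Gamma> \<longrightarrow> p v = 0"
  shows "p \<in> cube x I"
  unfolding cube_def
proof (intro CollectI conjI ballI allI impI)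
  fix v assume v: "v \<in> I"
  then have vV: "v \<in> pverts \<Gamma>" using I by auto
  obtain j where j: "x v = of_int j" using lattice_Ints[OF x] Ints_cases by metis
  have a: "x v \<le> q v" "q v \<le> x v + 1" using q v by (auto simp: cube_def)
  have "of_int j < real_of_int \<lfloor>p v\<rfloor> + 1" using a near vV j by fastforce
  then have "j \<le> \<lfloor>p v\<rfloor>" by linarith
  then show "x v \<le> p v" using j by (simp add: le_floor_iff)
  have "real_of_int \<lceil>p v\<rceil> - 1 < of_int j + 1" using a near vV j by fastforce
  then have "\<lceil>p v\<rceil> \<le> j + 1" by linarith
  then have "p v \<le> of_int (j + 1)" by (simp add: ceiling_le_iff)
  then show "p v \<le> x v + 1" using j by simp
next
  fix v assume v: "v \<notin> I"
  then have qx: "q v = x v" using q by (auto simp: cube_def)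
  show "p v = x v"
  proof (cases "v \<in> pverts \<Gamma>")
    case True
    obtain j where j: "x v = of_int j" using lattice_Ints[OF x] Ints_cases by metis
    have "real_of_int \<lceil>p v\<rceil> - 1 < of_int j" "of_int j < real_of_int \<lfloor>p v\<rfloor> + 1"
      using near True qx j by fastforce+
    then have "\<lceil>p v\<rceil> \<le> j" "j \<le> \<lfloor>p v\<rfloor>" by linarith+
    then have "p v \<le> of_int j" "of_int j \<le> p v" by (simp_all add: ceiling_le_iff le_floor_iff)
    then show ?thesis using j by simp
  qed (use x p0 in \<open>simp add: lattice_def\<close>)
qed

lemma openin_near:
  fixes S :: "('v \<Rightarrow> real) set"
  assumes "finite V"
  shows "openin (top_of_set S) (S \<inter> {q. \<forall>v \<in> V. l v < q v \<and> q v < u v})"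
proof -
  have "{q. \<forall>v \<in> V. l v < q v \<and> q v < u v} = (\<Inter>v \<in> V. (\<lambda>q :: 'v \<Rightarrow> real. q v) -` {l v<..<u v})"
    by auto
  moreover have "open ((\<lambda>q :: 'v \<Rightarrow> real. q v) -` {l v<..<u v})" for v
    by (rule open_vimage) (auto intro: continuous_intros continuous_on_product_coordinates)
  ultimately have "open {q. \<forall>v \<in> V. l v < q v \<and> q v < u v}" using assms by auto
  then show ?thesis by (rule openin_open_Int)
qed

lemma cube_segment:
  assumes "p \<in> cube x I" "q \<in> cube x I" "0 \<le> t" "t \<le> 1"
  shows "(\<lambda>v. (1 - t) * p v + t * q v) \<in> cube x I"
  unfolding cube_def
proof (intro CollectI conjI ballI allI impI)
  fix v assume "v \<in> I"
  then have b: "x v \<le> p v" "p v \<le> x v + 1" "x v \<le> q v" "q v \<le> x v + 1"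
    using assms by (auto simp: cube_def)
  show "x v \<le> (1 - t) * p v + t * q v"
    using convex_bound_le[of "- p v" "- x v" "- q v" "1 - t" t] b assms by simp
  show "(1 - t) * p v + t * q v \<le> x v + 1"
    using convex_bound_le[of "p v" "x v + 1" "q v" "1 - t" t] b assms by simp
next
  fix v assume "v \<notin> I"
  then have "p v = x v" "q v = x v" using assms by (auto simp: cube_def)
  then show "(1 - t) * p v + t * q v = x v" by (simp add: algebra_simps)
qed

lemma cube_connected_component:
  assumes "p \<in> cube x I" "q \<in> cube x I" "cube x I \<subseteq> S"
  shows "connected_component S p q"
proof -
  let ?f = "\<lambda>t :: real. \<lambda>v. (1 - t) * p v + t * q v"
  have "continuous_on {0..1} ?f"
    by (rule continuous_on_coordinatewise_then_product) (intro continuous_intros)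
  then have "connected (?f ` {0..1})" by (rule connected_continuous_image) simp
  moreover have "?f ` {0..1} \<subseteq> S" using cube_segment[OF assms(1,2)] assms(3) by auto
  moreover have "p \<in> ?f ` {0..1}" by (rule image_eqI[of _ _ 0]) auto
  moreover have "q \<in> ?f ` {0..1}" by (rule image_eqI[of _ _ 1]) auto
  ultimately show ?thesis unfolding connected_component_def by blast
qed

lemma corner_in_cube: "y \<in> cube_corners x I \<Longrightarrow> y \<in> cube x I"
  by (auto simp: cube_corners_def cube_def)

definition comp_of :: "('v, 'm) plumbing_scheme \<Rightarrow> ('v \<Rightarrow> real) \<Rightarrow> int \<Rightarrow> ('v \<Rightarrow> real) \<Rightarrow> ('v \<Rightarrow> real) set" where
  "comp_of \<Gamma> k m x = connected_component_set (superlevel \<Gamma> k m) x"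

section \<open>The bilinear form, the weight and the reflection\<close>

lemma pairing_add_left: "pairing \<Gamma> (\<lambda>v. x v + y v) z = pairing \<Gamma> x z + pairing \<Gamma> y z"
  by (simp add: pairing_def algebra_simps sum.distrib)

lemma pairing_add_right: "pairing \<Gamma> z (\<lambda>v. x v + y v) = pairing \<Gamma> z x + pairing \<Gamma> z y"
  by (simp add: pairing_def algebra_simps sum.distrib)

lemma pairing_scale_left: "pairing \<Gamma> (\<lambda>v. c * x v) z = c * pairing \<Gamma> x z"
  by (simp add: pairing_def algebra_simps sum_distrib_left)

lemma pairing_scale_right: "pairing \<Gamma> z (\<lambda>v. c * x v) = c * pairing \<Gamma> z x"
  by (simp add: pairing_def algebra_simps sum_distrib_left)

lemma pairing_sym:
  assumes "\<And>u v. padj \<Gamma> u v \<longleftrightarrow> padj \<Gamma> v u"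
  shows "pairing \<Gamma> x y = pairing \<Gamma> y x"
proof -
  have "vertex_form \<Gamma> u v = vertex_form \<Gamma> v u" for u v
    using assms by (auto simp: vertex_form_def)
  then show ?thesis unfolding pairing_def by (subst sum.swap) (simp add: mult_ac)
qed

definition reflect :: "('v \<Rightarrow> real) \<Rightarrow> ('v \<Rightarrow> real) \<Rightarrow> 'v \<Rightarrow> real" where
  "reflect k x v = - x v - k v"

lemma reflect_reflect [simp]: "reflect k (reflect k x) = x"
  by (simp add: reflect_def fun_eq_iff)

lemma reflect_lattice: "k \<in> lattice \<Gamma> \<Longrightarrow> x \<in> lattice \<Gamma> \<Longrightarrow> reflect k x \<in> lattice \<Gamma>"
  by (auto simp: lattice_def reflect_def)

text \<open>Completing the square. The vectors \<open>2 x + k\<close> run through the class of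
  \<open>k\<close>, and \<open>x \<mapsto> - x - k\<close> becomes a change of sign, so weights and
  reflections can be handled through squares of characteristic vectors alone.\<close>

lemma weight_square:
  assumes "\<And>u v. padj \<Gamma> u v \<longleftrightarrow> padj \<Gamma> v u"
  shows "8 * weight \<Gamma> k x =
    pairing \<Gamma> (\<lambda>v. 2 * x v + k v) (\<lambda>v. 2 * x v + k v) - pairing \<Gamma> k k"
proof -
  have "pairing \<Gamma> x k = pairing \<Gamma> k x" by (rule pairing_sym) fact
  then show ?thesis
    by (simp add: weight_def pairing_add_left pairing_add_right pairing_scale_left
        pairing_scale_right add_divide_distrib distrib_left)
qed

lemma weight_reflect:
  assumes "\<And>u v. padj \<Gamma> u v \<longleftrightarrow> padj \<Gamma> v u"
  shows "weight \<Gamma> k (reflect k x) = weight \<Gamma> k x"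
proof -
  have e: "(\<lambda>v. 2 * reflect k x v + k v) = (\<lambda>v. (- 1) * (2 * x v + k v))"
    by (simp add: reflect_def fun_eq_iff)
  have "8 * weight \<Gamma> k (reflect k x) = 8 * weight \<Gamma> k x"
    unfolding weight_square[OF assms] e by (simp only: pairing_scale_left pairing_scale_right)
  then show ?thesis by simp
qed

section \<open>Connected components as classes of lattice paths\<close>

context
  fixes \<Gamma> :: "('v, 'm) plumbing_scheme"
  assumes fin: "finite (pverts \<Gamma>)"
begin

lemma le_cube_weight_iff:
  assumes "I \<subseteq> pverts \<Gamma>"
  shows "m \<le> cube_weight \<Gamma> k x I \<longleftrightarrow> (\<forall>y \<in> cube_corners x I. m \<le> weight \<Gamma> k y)"
proof -
  have "finite (Pow I)" using assms fin finite_subset by auto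
  then show ?thesis unfolding cube_weight_def cube_corners_def
    by (subst Min_ge_iff) auto
qed

lemma superlevel_iff:
  shows "p \<in> superlevel \<Gamma> k m \<longleftrightarrow> (\<exists>x I. p \<in> cube x I \<and> x \<in> lattice \<Gamma> \<and> I \<subseteq> pverts \<Gamma> \<and>
     (\<forall>y \<in> cube_corners x I. of_int m \<le> weight \<Gamma> k y))"
  unfolding superlevel_def using le_cube_weight_iff by blast

lemma corners_conn:
  assumes x: "x \<in> lattice \<Gamma>" and I: "I \<subseteq> pverts \<Gamma>"
    and w: "\<forall>y \<in> cube_corners x I. of_int m \<le> weight \<Gamma> k y" and y: "y \<in> cube_corners x I"
  shows "lat_conn \<Gamma> k m x y"
proof -
  let ?c = "\<lambda>J v. x v + (if v \<in> J then 1 else 0)"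
  obtain J where J: "J \<subseteq> I" "y = ?c J" using y by (auto simp: cube_corners_def)
  have "finite J" using J I fin by (meson finite_subset)
  then have "lat_conn \<Gamma> k m x (?c J)" using J(1)
  proof (induction J)
    case empty
    have "x \<in> cube_corners x I" unfolding cube_corners_def by (rule image_eqI[of _ _ "{}"]) auto
    then show ?case using x w by (simp add: lat_conn_refl)
  next
    case (insert v J)
    have c: "?c J \<in> cube_corners x I" "?c (insert v J) \<in> cube_corners x I"
      using insert.prems unfolding cube_corners_def by blast+
    have "?c (insert v J) = (?c J)(v := ?c J v + 1)" using insert.hyps by auto
    moreover have "v \<in> pverts \<Gamma>" using insert.prems I by auto
    ultimately have "(?c J, ?c (insert v J)) \<in> lat_step \<Gamma> k m"
      unfolding lat_step_def using w c cube_corners_lattice[OF x I] by blast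
    then have "lat_conn \<Gamma> k m (?c J) (?c (insert v J))" by (rule lat_conn_step)
    moreover have "lat_conn \<Gamma> k m x (?c J)" using insert by auto
    ultimately show ?case using lat_conn_trans by blast
  qed
  then show ?thesis using J(2) by simp
qed

lemma lattice_superlevel:
  assumes "x \<in> lattice \<Gamma>" "of_int m \<le> weight \<Gamma> k x"
  shows "x \<in> superlevel \<Gamma> k m"
proof -
  have "cube_corners x {} = {x}" by (auto simp: cube_corners_def)
  moreover have "x \<in> cube x {}" by (simp add: cube_def)
  ultimately show ?thesis unfolding superlevel_iff using assms
    by (intro exI[of _ x] exI[of _ "{}"]) simp
qed

lemma vfloor_superlevel:
  assumes p: "p \<in> superlevel \<Gamma> k m"
  shows "vfloor p \<in> lattice \<Gamma>" "of_int m \<le> weight \<Gamma> k (vfloor p)"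
proof -
  obtain x I where x: "p \<in> cube x I" "x \<in> lattice \<Gamma>" "I \<subseteq> pverts \<Gamma>"
    "\<forall>y \<in> cube_corners x I. of_int m \<le> weight \<Gamma> k y"
    using p superlevel_iff by blast
  have "vfloor p \<in> cube_corners x I" using vfloor_corner x by blast
  then show "vfloor p \<in> lattice \<Gamma>" "of_int m \<le> weight \<Gamma> k (vfloor p)"
    using x cube_corners_lattice by blast+
qed

text \<open>The relation between floors is locally constant: by \<open>cube_near\<close> every
  nearby point shares a cube with \<open>a\<close>, and the corners of this cube are joined by edges
  of sufficient weight. A locally constant equivalence relation is constant on connected
  sets.\<close>

lemma connected_component_imp_conn:
  assumes pq: "connected_component (superlevel \<Gamma> k m) p q"
  shows "lat_conn \<Gamma> k m (vfloor p) (vfloor q)"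
proof -
  obtain C where C: "connected C" "C \<subseteq> superlevel \<Gamma> k m" "p \<in> C" "q \<in> C"
    using pq by (auto simp: connected_component_def)
  show ?thesis
  proof (rule connected_equivalence_relation[OF C(1,3,4),
        where R = "\<lambda>p q. lat_conn \<Gamma> k m (vfloor p) (vfloor q)"])
    fix a assume a: "a \<in> C"
    have a0: "\<forall>v. v \<notin> pverts \<Gamma> \<longrightarrow> a v = 0"
    proof -
      obtain x I where "a \<in> cube x I" "x \<in> lattice \<Gamma>" "I \<subseteq> pverts \<Gamma>"
        using a C(2) superlevel_iff by blast
      then show ?thesis unfolding cube_def lattice_def by fastforce
    qed
    define T where "T = C \<inter> {q. \<forall>v \<in> pverts \<Gamma>. of_int \<lceil>a v\<rceil> - 1 < q v \<and> q v < of_int \<lfloor>a v\<rfloor> + 1}"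
    have "openin (top_of_set C) T" unfolding T_def by (rule openin_near) (rule fin)
    moreover have "real_of_int \<lceil>a v\<rceil> - 1 < a v" for v by linarith
    then have "a \<in> T" unfolding T_def using a by simp
    moreover have "lat_conn \<Gamma> k m (vfloor a) (vfloor b)" if b: "b \<in> T" for b
    proof -
      have "b \<in> superlevel \<Gamma> k m" using b C(2) by (auto simp: T_def)
      then obtain x I where x: "b \<in> cube x I" "x \<in> lattice \<Gamma>" "I \<subseteq> pverts \<Gamma>"
        "\<forall>y \<in> cube_corners x I. of_int m \<le> weight \<Gamma> k y"
        using superlevel_iff by blast
      have "a \<in> cube x I" by (rule cube_near[OF x(2,3,1) _ a0]) (use b in \<open>simp add: T_def\<close>)
      then have "lat_conn \<Gamma> k m x (vfloor a)" "lat_conn \<Gamma> k m x (vfloor b)"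
        using corners_conn[OF x(2,3,4)] vfloor_corner[OF x(2,3)] x(1) by blast+
      then show ?thesis using lat_conn_sym lat_conn_trans by blast
    qed
    ultimately show "\<exists>T. openin (top_of_set C) T \<and> a \<in> T \<and>
        (\<forall>b \<in> T. lat_conn \<Gamma> k m (vfloor a) (vfloor b))" by blast
  qed (blast intro: lat_conn_sym lat_conn_trans)+
qed

lemma connected_component_vfloor:
  assumes p: "p \<in> superlevel \<Gamma> k m"
  shows "connected_component (superlevel \<Gamma> k m) (vfloor p) p"
proof -
  obtain x I where x: "p \<in> cube x I" "x \<in> lattice \<Gamma>" "I \<subseteq> pverts \<Gamma>"
    "\<forall>y \<in> cube_corners x I. of_int m \<le> weight \<Gamma> k y"
    using p superlevel_iff by blast
  moreover have "cube x I \<subseteq> superlevel \<Gamma> k m" using superlevel_iff x by blast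
  ultimately show ?thesis
    using cube_connected_component corner_in_cube vfloor_corner by metis
qed

lemma step_connected_component:
  assumes v: "v \<in> pverts \<Gamma>" and x: "x \<in> lattice \<Gamma>"
    and w: "of_int m \<le> weight \<Gamma> k x" "of_int m \<le> weight \<Gamma> k (x(v := x v + 1))"
  shows "connected_component (superlevel \<Gamma> k m) x (x(v := x v + 1))"
proof (rule cube_connected_component)
  have e: "cube_corners x {v} = {x, x(v := x v + 1)}"
    by (auto simp: cube_corners_def Pow_insert fun_eq_iff)
  show "x \<in> cube x {v}" "x(v := x v + 1) \<in> cube x {v}" by (auto simp: cube_def)
  have "p \<in> superlevel \<Gamma> k m" if "p \<in> cube x {v}" for p
    unfolding superlevel_iff using that e v x w
    by (intro exI[of _ x] exI[of _ "{v}"]) simp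
  then show "cube x {v} \<subseteq> superlevel \<Gamma> k m" by blast
qed

lemma conn_imp_connected_component:
  assumes xy: "lat_conn \<Gamma> k m x y"
  shows "connected_component (superlevel \<Gamma> k m) x y"
proof -
  have "(x, y) \<in> (lat_step \<Gamma> k m)\<^sup>*" using xy by (simp add: lat_conn_def)
  then show ?thesis
  proof induction
    case base
    show ?case using lat_conn_in[OF xy] lattice_superlevel by simp
  next
    case (step y z)
    have "connected_component (superlevel \<Gamma> k m) y z"
      using step(2) step_connected_component connected_component_sym
      unfolding lat_step_def by blast
    then show ?case using step(3) connected_component_trans by blast
  qed
qed

lemma components_eq:
  shows "components (superlevel \<Gamma> k m) =
    {comp_of \<Gamma> k m x | x. x \<in> lattice \<Gamma> \<and> of_int m \<le> weight \<Gamma> k x}"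
proof (intro equalityI subsetI)
  fix C assume "C \<in> components (superlevel \<Gamma> k m)"
  then obtain p where p: "p \<in> superlevel \<Gamma> k m" "C = connected_component_set (superlevel \<Gamma> k m) p"
    by (auto simp: components_def)
  have "C = comp_of \<Gamma> k m (vfloor p)"
    unfolding p comp_of_def
    using connected_component_eq[of p "superlevel \<Gamma> k m" "vfloor p"]
      connected_component_vfloor[OF p(1)] by simp
  then show "C \<in> {comp_of \<Gamma> k m x | x. x \<in> lattice \<Gamma> \<and> of_int m \<le> weight \<Gamma> k x}"
    using vfloor_superlevel[OF p(1)] by blast
next
  fix C assume "C \<in> {comp_of \<Gamma> k m x | x. x \<in> lattice \<Gamma> \<and> of_int m \<le> weight \<Gamma> k x}"
  then show "C \<in> components (superlevel \<Gamma> k m)"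
    using lattice_superlevel by (auto simp: components_def comp_of_def)
qed

lemma comp_of_eq_iff:
  assumes x: "x \<in> lattice \<Gamma>" "of_int m \<le> weight \<Gamma> k x"
    and y: "y \<in> lattice \<Gamma>" "of_int m \<le> weight \<Gamma> k y"
  shows "comp_of \<Gamma> k m x = comp_of \<Gamma> k m y \<longleftrightarrow> lat_conn \<Gamma> k m x y"
proof -
  have "comp_of \<Gamma> k m x = comp_of \<Gamma> k m y \<longleftrightarrow> connected_component (superlevel \<Gamma> k m) x y"
    unfolding comp_of_def
    using lattice_superlevel[OF x] lattice_superlevel[OF y]
    by (simp add: connected_component_eq_eq)
  also have "\<dots> \<longleftrightarrow> lat_conn \<Gamma> k m x y"
    using conn_imp_connected_component connected_component_imp_conn
      vfloor_lattice x(1) y(1) by metis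
  finally show ?thesis .
qed

lemma superlevel_mono:
  assumes "m' \<le> m"
  shows "superlevel \<Gamma> k m \<subseteq> superlevel \<Gamma> k m'"
proof -
  have "real_of_int m' \<le> of_int m" using assms by simp
  then show ?thesis unfolding subset_iff superlevel_iff by (meson order_trans)
qed

lemma comp_of_self:
  assumes "x \<in> lattice \<Gamma>" "of_int m \<le> weight \<Gamma> k x"
  shows "x \<in> comp_of \<Gamma> k m x"
  using lattice_superlevel[OF assms] by (simp add: comp_of_def)

lemma comp_of_mono:
  assumes "m' \<le> m"
  shows "comp_of \<Gamma> k m x \<subseteq> comp_of \<Gamma> k m' x"
  unfolding comp_of_def by (rule connected_component_mono) (rule superlevel_mono[OF assms])

lemma comp_of_subset_iff:
  assumes m: "m' \<le> m"
    and x: "x \<in> lattice \<Gamma>" "of_int m \<le> weight \<Gamma> k x"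
    and y: "y \<in> lattice \<Gamma>" "of_int m' \<le> weight \<Gamma> k y"
  shows "comp_of \<Gamma> k m x \<subseteq> comp_of \<Gamma> k m' y \<longleftrightarrow> comp_of \<Gamma> k m' x = comp_of \<Gamma> k m' y"
proof
  assume "comp_of \<Gamma> k m x \<subseteq> comp_of \<Gamma> k m' y"
  then have "x \<in> comp_of \<Gamma> k m' y" using comp_of_self[OF x] by blast
  then have "connected_component (superlevel \<Gamma> k m') y x" by (simp add: comp_of_def)
  then show "comp_of \<Gamma> k m' x = comp_of \<Gamma> k m' y"
    unfolding comp_of_def using connected_component_eq[of x _ y] by simp
qed (use comp_of_mono[OF m, of k x] in simp)

lemma reflect_superlevel:
  assumes adj: "\<And>u v. padj \<Gamma> u v \<longleftrightarrow> padj \<Gamma> v u"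
    and k: "k \<in> lattice \<Gamma>" and p: "p \<in> superlevel \<Gamma> k m"
  shows "reflect k p \<in> superlevel \<Gamma> k m"
proof -
  obtain x I where x: "p \<in> cube x I" "x \<in> lattice \<Gamma>" "I \<subseteq> pverts \<Gamma>"
    "\<forall>y \<in> cube_corners x I. of_int m \<le> weight \<Gamma> k y"
    using p superlevel_iff by blast
  \<comment> \<open>The lowest corner of the mirror cube is the reflection of the highest corner of
    the given one.\<close>
  define z where "z v = reflect k x v - (if v \<in> I then 1 else 0)" for v
  have "z \<in> lattice \<Gamma>" using reflect_lattice[OF k x(2)] x(3) unfolding z_def lattice_def by auto
  moreover have "reflect k p \<in> cube z I" using x(1) by (auto simp: cube_def z_def reflect_def)
  moreover have "of_int m \<le> weight \<Gamma> k y" if y: "y \<in> cube_corners z I" for y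
  proof -
    obtain H where H: "H \<subseteq> I" "y = (\<lambda>v. z v + (if v \<in> H then 1 else 0))"
      using y by (auto simp: cube_corners_def)
    have "reflect k y = (\<lambda>v. x v + (if v \<in> I - H then 1 else 0))"
      using H by (auto simp: reflect_def z_def fun_eq_iff)
    then have "reflect k y \<in> cube_corners x I" unfolding cube_corners_def by blast
    then have "of_int m \<le> weight \<Gamma> k (reflect k y)" using x(4) by blast
    then show ?thesis by (simp add: weight_reflect adj)
  qed
  ultimately show ?thesis unfolding superlevel_iff using x(3) by blast
qed

text \<open>Continuity gives one inclusion. The same inclusion at the reflected point gives the
  other, since the reflection is an involution.\<close>

lemma reflect_comp_of:
  assumes adj: "\<And>u v. padj \<Gamma> u v \<longleftrightarrow> padj \<Gamma> v u"
    and k: "k \<in> lattice \<Gamma>" and x: "x \<in> lattice \<Gamma>" "of_int m \<le> weight \<Gamma> k x"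
  shows "reflect k ` comp_of \<Gamma> k m x = comp_of \<Gamma> k m (reflect k x)"
proof -
  have sub: "reflect k ` comp_of \<Gamma> k m x \<subseteq> comp_of \<Gamma> k m (reflect k x)"
    if x: "x \<in> lattice \<Gamma>" "of_int m \<le> weight \<Gamma> k x" for x
    unfolding comp_of_def
  proof (rule connected_component_maximal)
    show "reflect k x \<in> reflect k ` connected_component_set (superlevel \<Gamma> k m) x"
      using comp_of_self[OF x] by (auto simp: comp_of_def)
    have "continuous_on UNIV (reflect k)" unfolding reflect_def
      by (rule continuous_on_coordinatewise_then_product)
        (intro continuous_intros continuous_on_product_coordinates)
    then show "connected (reflect k ` connected_component_set (superlevel \<Gamma> k m) x)"
      by (intro connected_continuous_image) (auto intro: continuous_on_subset)
    show "reflect k ` connected_component_set (superlevel \<Gamma> k m) x \<subseteq> superlevel \<Gamma> k m"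
      using connected_component_subset reflect_superlevel[OF adj k] by fast
  qed
  have r: "reflect k x \<in> lattice \<Gamma>" "of_int m \<le> weight \<Gamma> k (reflect k x)"
    using x reflect_lattice[OF k] by (simp_all add: weight_reflect adj)
  have "reflect k ` reflect k ` comp_of \<Gamma> k m (reflect k x) \<subseteq> reflect k ` comp_of \<Gamma> k m x"
    using sub[OF r] by (intro image_mono) simp
  then have "comp_of \<Gamma> k m (reflect k x) \<subseteq> reflect k ` comp_of \<Gamma> k m x"
    by (simp add: image_image)
  then show ?thesis using sub[OF x] by blast
qed

end

section \<open>Legs\<close>

lemma int_step_mono:
  fixes \<sigma> :: "int \<Rightarrow> int"
  assumes step: "\<And>y. \<sigma> y \<le> \<sigma> (y + 1)" and "y \<le> z"
  shows "\<sigma> y \<le> \<sigma> z"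
  using assms(2) by (induction z rule: int_ge_induct) (use step order_trans in blast)+

lemma int_slope_ex1:
  fixes \<sigma> :: "int \<Rightarrow> int"
  assumes step: "\<And>y. \<sigma> y + 1 \<le> \<sigma> (y + 1)"
  shows "\<exists>!y. \<sigma> (y - 1) \<le> t \<and> t < \<sigma> y"
proof -
  have up: "\<sigma> y + int n \<le> \<sigma> (y + int n)" for y n
  proof (induction n)
    case (Suc n)
    then show ?case using step[of "y + int n"] by (simp add: algebra_simps)
  qed simp
  have mono: "\<sigma> y \<le> \<sigma> z" if "y \<le> z" for y z
    using up[of y "nat (z - y)"] that by simp
  \<comment> \<open>Increments of at least 1 give \<open>\<sigma> l \<le> \<sigma> 0 + l\<close> for
    \<open>l \<le> 0\<close>, so the search starts at a value not above \<open>t\<close>.\<close>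
  define l where "l = min 0 (t - \<sigma> 0)"
  have "\<sigma> l \<le> t" using up[of l "nat (- l)"] by (auto simp: l_def)
  moreover have "\<exists>n. t < \<sigma> (l + int n)"
    using up[of l "nat (t - \<sigma> l) + 1"] by (intro exI[of _ "nat (t - \<sigma> l) + 1"]) linarith
  ultimately obtain n where n: "t < \<sigma> (l + int n)" "\<sigma> (l + int n - 1) \<le> t"
  proof -
    assume l: "\<sigma> l \<le> t" and ex: "\<exists>n. t < \<sigma> (l + int n)"
      and that: "\<And>n. t < \<sigma> (l + int n) \<Longrightarrow> \<sigma> (l + int n - 1) \<le> t \<Longrightarrow> thesis"
    define n where "n = (LEAST n. t < \<sigma> (l + int n))"
    have n1: "t < \<sigma> (l + int n)" unfolding n_def by (rule LeastI_ex) (rule ex)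
    then have "n \<noteq> 0" using l by (intro notI) simp
    then have "n - 1 < n" by simp
    then have "\<not> t < \<sigma> (l + int (n - 1))" unfolding n_def by (rule not_less_Least)
    moreover have "l + int (n - 1) = l + int n - 1" using \<open>n \<noteq> 0\<close> by simp
    ultimately show thesis using n1 that by (metis not_less)
  qed
  show ?thesis
  proof (rule ex1I[of _ "l + int n"])
    fix y assume y: "\<sigma> (y - 1) \<le> t \<and> t < \<sigma> y"
    have "\<not> y \<le> l + int n - 1" using mono[of y "l + int n - 1"] y n by auto
    moreover have "\<not> l + int n \<le> y - 1" using mono[of "l + int n" "y - 1"] y n by auto
    ultimately show "y = l + int n" by simp
  qed (use n in auto)
qed

text \<open>An entry \<open>(x, c)\<close> of a leg is a vertex with decoration \<open>- x\<close> on which the characteristic vector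
  takes the value \<open>x - 2 c\<close>; \<open>t\<close> is the coordinate of the vertex preceding the leg. \<open>leg_val\<close> is the
  contribution of the leg to \<open>- weight\<close>.\<close>

primrec leg_val :: "(int \<times> int) list \<Rightarrow> int \<Rightarrow> (nat \<Rightarrow> int) \<Rightarrow> int" where
  "leg_val [] t y = 0"
| "leg_val (d # ds) t y = fst d * (y 0 * (y 0 - 1) div 2) + snd d * y 0 - t * y 0 +
     leg_val ds (y 0) (\<lambda>j. y (Suc j))"

text \<open>The largest optimal first coordinate of the leg, and at the same time the drop of the
  minimum when \<open>t\<close> is raised by one. Taking the largest of the minimisers keeps it
  optimal for \<open>t + 1\<close>.\<close>

primrec leg_slope :: "(int \<times> int) list \<Rightarrow> int \<Rightarrow> int" where
  "leg_slope [] t = 0"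
| "leg_slope (d # ds) t = (THE y. fst d * (y - 1) + snd d - leg_slope ds (y - 1) \<le> t \<and>
     t < fst d * y + snd d - leg_slope ds y)"

primrec leg_opt :: "(int \<times> int) list \<Rightarrow> int \<Rightarrow> nat \<Rightarrow> int" where
  "leg_opt [] t = (\<lambda>_. 0)"
| "leg_opt (d # ds) t = case_nat (leg_slope (d # ds) t) (leg_opt ds (leg_slope (d # ds) t))"

abbreviation leg_min :: "(int \<times> int) list \<Rightarrow> int \<Rightarrow> int" where
  "leg_min ds t \<equiv> leg_val ds t (leg_opt ds t)"

abbreviation good_leg :: "(int \<times> int) list \<Rightarrow> bool" where
  "good_leg ds \<equiv> \<forall>d \<in> set ds. 2 \<le> fst d"

text \<open>Forward difference of the value of the leg in its first coordinate, the rest of the leg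
  being optimal and the coupling to \<open>t\<close> left out; see
  \<open>out_val_step\<close>.\<close>

definition out_slope :: "int \<times> int \<Rightarrow> (int \<times> int) list \<Rightarrow> int \<Rightarrow> int" where
  "out_slope d ds y = fst d * y + snd d - leg_slope ds y"

text \<open>A decoration of size at least 2 outweighs the growth by at most 1 of the rest of the
  leg, so \<open>out_slope\<close> is strictly increasing. The growth bound is a premise here
  because it is established together with longer legs in \<open>slope_incr\<close>.\<close>

lemma slope_cons_aux:
  assumes incr: "\<And>t. leg_slope ds (t + 1) \<le> leg_slope ds t + 1" and d: "2 \<le> fst d"
  shows "out_slope d ds y + 1 \<le> out_slope d ds (y + 1)"
    and "out_slope d ds (leg_slope (d # ds) t - 1) \<le> t \<and> t < out_slope d ds (leg_slope (d # ds) t)"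
    and "out_slope d ds (y - 1) \<le> t \<Longrightarrow> t < out_slope d ds y \<Longrightarrow> leg_slope (d # ds) t = y"
proof -
  show step: "out_slope d ds y + 1 \<le> out_slope d ds (y + 1)" for y
    using incr[of y] d by (simp add: out_slope_def algebra_simps)
  have ex: "\<exists>!y. out_slope d ds (y - 1) \<le> t \<and> t < out_slope d ds y"
    by (rule int_slope_ex1) (rule step)
  have e: "leg_slope (d # ds) t = (THE y. out_slope d ds (y - 1) \<le> t \<and> t < out_slope d ds y)"
    by (simp add: out_slope_def)
  show "out_slope d ds (leg_slope (d # ds) t - 1) \<le> t \<and> t < out_slope d ds (leg_slope (d # ds) t)"
    unfolding e by (rule theI'[OF ex])
  show "out_slope d ds (y - 1) \<le> t \<Longrightarrow> t < out_slope d ds y \<Longrightarrow> leg_slope (d # ds) t = y"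
    unfolding e by (rule the1_equality[OF ex]) simp
qed

text \<open>\<open>leg_slope\<close> inverts a strictly increasing integer function, so it moves by
  0 or 1 when the level rises by one.\<close>

lemma slope_incr:
  assumes "good_leg ds"
  shows "leg_slope ds t \<le> leg_slope ds (t + 1) \<and> leg_slope ds (t + 1) \<le> leg_slope ds t + 1"
  using assms
proof (induction ds arbitrary: t)
  case (Cons d ds)
  have incr: "leg_slope ds (t + 1) \<le> leg_slope ds t + 1" and d: "2 \<le> fst d" for t
    using Cons by auto
  let ?s = "leg_slope (d # ds)"
  have a: "out_slope d ds (?s t - 1) \<le> t" "t < out_slope d ds (?s t)" for t
    using slope_cons_aux(2)[OF incr d] by auto
  have step: "out_slope d ds z + 1 \<le> out_slope d ds (z + 1)" for z
    by (rule slope_cons_aux(1)[OF incr d])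
  have mono: "out_slope d ds y \<le> out_slope d ds z" if "y \<le> z" for y z
    using int_step_mono[OF _ that, of "out_slope d ds"] step by (smt (verit))
  have "\<not> ?s (t + 1) \<le> ?s t - 1"
    using mono[of "?s (t + 1)" "?s t - 1"] a(1)[of t] a(2)[of "t + 1"] by linarith
  moreover have "\<not> ?s t + 1 \<le> ?s (t + 1) - 1"
    using mono[of "?s t + 1" "?s (t + 1) - 1"] a(2)[of t] a(1)[of "t + 1"] step[of "?s t"] by linarith
  ultimately show ?case by linarith
qed simp

lemma
  assumes "good_leg (d # ds)"
  shows out_slope_incr: "out_slope d ds y + 1 \<le> out_slope d ds (y + 1)"
    and slope_cons:
      "out_slope d ds (leg_slope (d # ds) t - 1) \<le> t \<and> t < out_slope d ds (leg_slope (d # ds) t)"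
    and slope_unique:
      "out_slope d ds (y - 1) \<le> t \<Longrightarrow> t < out_slope d ds y \<Longrightarrow> leg_slope (d # ds) t = y"
  using slope_cons_aux[of ds d] slope_incr[of ds] assms by auto

lemma out_slope_mono:
  assumes "good_leg (d # ds)" "y \<le> z"
  shows "out_slope d ds y \<le> out_slope d ds z"
  using int_step_mono[OF _ assms(2), of "out_slope d ds"] out_slope_incr[OF assms(1)] by (smt (verit))

lemma leg_opt_support: "length ds \<le> j \<Longrightarrow> leg_opt ds t j = 0"
  by (induction ds arbitrary: t j) (auto split: nat.split)

lemma leg_val_opt_shift:
  "leg_val ds t' (leg_opt ds t) = leg_min ds t - (t' - t) * leg_slope ds t"
  by (cases ds) (auto simp: algebra_simps simp del: leg_slope.simps(2))

lemma half_step: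
  fixes y :: int
  shows "(y + 1) * y div 2 = y * (y - 1) div 2 + y"
proof -
  have "(y + 1) * y = y * (y - 1) + y * 2" by (simp add: algebra_simps)
  then show ?thesis by simp
qed

definition out_val :: "int \<times> int \<Rightarrow> (int \<times> int) list \<Rightarrow> int \<Rightarrow> int" where
  "out_val d ds y = fst d * (y * (y - 1) div 2) + snd d * y + leg_min ds y"

lemma leg_val_case_nat:
  "leg_val (d # ds) t (case_nat u y) =
     fst d * (u * (u - 1) div 2) + snd d * u - t * u + leg_val ds u y"
  by simp

lemma leg_min_cons: "leg_min (d # ds) t = out_val d ds (leg_slope (d # ds) t) - t * leg_slope (d # ds) t"
  by (simp add: out_val_def del: leg_slope.simps(2))

text \<open>\<open>out_val\<close> is convex with forward difference \<open>out_slope\<close>, so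
  its minimum after subtracting \<open>t * u\<close> sits where the difference crosses
  \<open>t\<close>. The difference formula of the shorter leg is what yields this convexity for the
  longer one, hence the joint induction.\<close>

lemma leg_opt_props_aux:
  assumes "good_leg ds"
  shows "leg_min ds (t + 1) = leg_min ds t - leg_slope ds t \<and> leg_min ds t \<le> leg_val ds t y"
  using assms
proof (induction ds arbitrary: t y)
  case (Cons d ds)
  have g: "good_leg ds" using Cons.prems by simp
  have IH: "leg_min ds (t + 1) = leg_min ds t - leg_slope ds t" "leg_min ds t \<le> leg_val ds t y" for t y
    using Cons.IH[OF g] by auto
    let ?s = "leg_slope (d # ds)" and ?F = "out_val d ds"
    have F: "?F (u + 1) = ?F u + out_slope d ds u" for u
      using IH(1)[of u] half_step[of u]
      by (simp add: out_val_def out_slope_def algebra_simps)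
    have conv_up: "?F u - t * u \<le> ?F (u + int n) - t * (u + int n)" if "?s t \<le> u" for u n
    proof (induction n)
      case (Suc n)
      have "t \<le> out_slope d ds (u + int n)"
        using slope_cons[OF Cons.prems, of t] out_slope_mono[OF Cons.prems, of "?s t" "u + int n"] that
        by simp
      then have "?F (u + int n) - t * (u + int n) \<le> ?F (u + int (Suc n)) - t * (u + int (Suc n))"
        using F[of "u + int n"] by (simp add: algebra_simps)
      then show ?case using Suc by simp
    qed simp
    have conv_dn: "?F (u + int n) - t * (u + int n) \<le> ?F u - t * u" if "u + int n \<le> ?s t" for u n
      using that
    proof (induction n)
      case (Suc n)
      have "out_slope d ds (u + int n) \<le> t"
        using slope_cons[OF Cons.prems, of t]
          out_slope_mono[OF Cons.prems, of "u + int n" "?s t - 1"] Suc.prems by simp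
      then have "?F (u + int (Suc n)) - t * (u + int (Suc n)) \<le> ?F (u + int n) - t * (u + int n)"
        using F[of "u + int n"] by (simp add: algebra_simps)
      then show ?case using Suc by simp
    qed simp
    have min: "?F (?s t) - t * ?s t \<le> ?F u - t * u" for u
      using conv_up[of "?s t" "nat (u - ?s t)"] conv_dn[of u "nat (?s t - u)"] by (cases "?s t \<le> u") auto
    have "leg_val (d # ds) t y \<ge> ?F (y 0) - t * y 0"
      using IH(2)[of "y 0" "\<lambda>j. y (Suc j)"] by (simp add: out_val_def)
    then have *: "leg_min (d # ds) t \<le> leg_val (d # ds) t y"
      unfolding leg_min_cons using min[of "y 0"] by simp
    have "leg_min (d # ds) (t + 1) = leg_min (d # ds) t - ?s t"
    proof (cases "?s (t + 1) = ?s t")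
      case True
      then show ?thesis unfolding leg_min_cons by (simp add: algebra_simps del: leg_slope.simps(2))
    next
      case False
      then have s: "?s (t + 1) = ?s t + 1" using slope_incr[OF Cons.prems, of t] by linarith
      \<comment> \<open>If the minimiser jumps, the level \<open>t + 1\<close> is hit exactly, so
        the old and the new coordinate are both optimal for \<open>t + 1\<close>.\<close>
      have "out_slope d ds (?s t) = t + 1"
        using slope_cons[OF Cons.prems, of t] slope_cons[OF Cons.prems, of "t + 1"] s by simp
      then show ?thesis unfolding leg_min_cons s using F[of "?s t"]
        by (simp add: algebra_simps del: leg_slope.simps(2))
    qed
  with * show ?case by blast
qed simp

lemma
  assumes "good_leg ds"
  shows leg_min_step: "leg_min ds (t + 1) = leg_min ds t - leg_slope ds t"
    and leg_min_le: "leg_min ds t \<le> leg_val ds t y"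
  using leg_opt_props_aux[OF assms] by auto

text \<open>Raising the preceding coordinate with the leg frozen lowers the value by the first
  coordinate of the leg, which is exactly the drop of the minimum. So a path may move one coordinate
  first and repair the leg afterwards.\<close>

lemma leg_opt_next:
  assumes "good_leg ds"
  shows "leg_val ds (t + 1) (leg_opt ds t) = leg_min ds (t + 1)"
  using leg_val_opt_shift[of ds "t + 1" t] leg_min_step[OF assms, of t] by simp

lemma out_val_step:
  assumes "good_leg (d # ds)"
  shows "out_val d ds (u + 1) = out_val d ds u + out_slope d ds u"
proof -
  have "good_leg ds" using assms by simp
  from leg_min_step[OF this, of u] show ?thesis
    using half_step[of u] by (simp add: out_val_def out_slope_def algebra_simps)
qed

section \<open>Paths inside a leg\<close>

definition leg_step :: "(int \<times> int) list \<Rightarrow> int \<Rightarrow> int \<Rightarrow> ((nat \<Rightarrow> int) \<times> (nat \<Rightarrow> int)) set" where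
  "leg_step ds t B = {(y, y'). leg_val ds t y \<le> B \<and> leg_val ds t y' \<le> B \<and>
     (\<exists>j < length ds. y' = y(j := y j + 1) \<or> y = y'(j := y' j + 1))}"

lemma leg_steps_sym: "(y, y') \<in> (leg_step ds t B)\<^sup>* \<Longrightarrow> (y', y) \<in> (leg_step ds t B)\<^sup>*"
proof -
  have "sym (leg_step ds t B)" by (auto simp: sym_def leg_step_def)
  then show "(y, y') \<in> (leg_step ds t B)\<^sup>* \<Longrightarrow> (y', y) \<in> (leg_step ds t B)\<^sup>*"
    by (auto dest: sym_rtrancl symD)
qed

lemma case_nat_upd: "(case_nat u y)(Suc j := z) = case_nat u (y(j := z))"
  by (auto simp: fun_eq_iff split: nat.split)

lemma case_nat_upd_0: "(case_nat u y)(0 := z) = case_nat z y"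
  by (auto simp: fun_eq_iff split: nat.split)

lemma leg_steps_lift:
  assumes "(y, y') \<in> (leg_step ds u (B - (fst d * (u * (u - 1) div 2) + snd d * u - t * u)))\<^sup>*"
  shows "(case_nat u y, case_nat u y') \<in> (leg_step (d # ds) t B)\<^sup>*"
  using assms
proof induction
  case (step y z)
  obtain j where j: "j < length ds" "z = y(j := y j + 1) \<or> y = z(j := z j + 1)"
    using step(2) by (auto simp: leg_step_def)
  then have "case_nat u z = (case_nat u y)(Suc j := case_nat u y (Suc j) + 1) \<or>
      case_nat u y = (case_nat u z)(Suc j := case_nat u z (Suc j) + 1)"
    by (auto simp: case_nat_upd)
  then have "\<exists>j < length (d # ds). case_nat u z = (case_nat u y)(j := case_nat u y j + 1) \<or>
      case_nat u y = (case_nat u z)(j := case_nat u z j + 1)"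
    using j(1) by (intro exI[of _ "Suc j"]) simp
  moreover have "leg_val (d # ds) t (case_nat u y) \<le> B" "leg_val (d # ds) t (case_nat u z) \<le> B"
    using step(2) unfolding leg_val_case_nat by (auto simp: leg_step_def)
  ultimately have "(case_nat u y, case_nat u z) \<in> leg_step (d # ds) t B"
    unfolding leg_step_def by blast
  then show ?case using step(3) by (rule rtrancl_into_rtrancl[rotated])
qed simp

text \<open>The optimal extension for \<open>u\<close> is still optimal for \<open>u + 1\<close>, so moving \<open>u\<close> first and then
  reoptimising the rest of the leg passes only through values attained at the ends.\<close>

lemma leg_steps_to_opt:
  assumes "good_leg ds" "\<forall>j \<ge> length ds. y j = 0" "leg_val ds t y \<le> B"
  shows "(y, leg_opt ds t) \<in> (leg_step ds t B)\<^sup>*"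
  using assms
proof (induction ds arbitrary: t y B)
  case Nil
  then have "y = (\<lambda>_. 0)" by auto
  then show ?case by simp
next
  case (Cons d ds)
  have g: "good_leg ds" using Cons.prems by simp
  let ?s = "leg_slope (d # ds) t" and ?F = "out_val d ds" and ?R = "(leg_step (d # ds) t B)\<^sup>*"
  let ?z = "\<lambda>u. case_nat u (leg_opt ds u)"
  have Fz: "leg_val (d # ds) t (?z u) = ?F u - t * u" for u
    unfolding leg_val_case_nat by (simp add: out_val_def)
  have lift: "(case_nat u y', ?z u) \<in> ?R"
    if "leg_val (d # ds) t (case_nat u y') \<le> B" "\<forall>j \<ge> length ds. y' j = 0" for u y'
    using that Cons.IH[OF g, of y' u] unfolding leg_val_case_nat by (intro leg_steps_lift) simp
  have hop: "(?z u, ?z (u + 1)) \<in> ?R" if "?F u - t * u \<le> B" "?F (u + 1) - t * (u + 1) \<le> B" for u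
  proof -
    have v: "leg_val (d # ds) t (case_nat (u + 1) (leg_opt ds u)) = ?F (u + 1) - t * (u + 1)"
      unfolding leg_val_case_nat leg_opt_next[OF g] by (simp add: out_val_def)
    have "case_nat (u + 1) (leg_opt ds u) = (?z u)(0 := ?z u 0 + 1)" by (simp add: case_nat_upd_0)
    then have "\<exists>j < length (d # ds). case_nat (u + 1) (leg_opt ds u) = (?z u)(j := ?z u j + 1)"
      by (intro exI[of _ 0]) simp
    moreover have "leg_val (d # ds) t (?z u) \<le> B" unfolding Fz by (rule that(1))
    moreover have "leg_val (d # ds) t (case_nat (u + 1) (leg_opt ds u)) \<le> B" unfolding v by (rule that(2))
    ultimately have "(?z u, case_nat (u + 1) (leg_opt ds u)) \<in> leg_step (d # ds) t B"
      unfolding leg_step_def by blast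
    moreover have "(case_nat (u + 1) (leg_opt ds u), ?z (u + 1)) \<in> ?R"
      by (rule lift) (use v that in \<open>auto simp: leg_opt_support simp del: leg_val.simps\<close>)
    ultimately show ?thesis by (rule converse_rtrancl_into_rtrancl)
  qed
  have "(?z u, ?z ?s) \<in> ?R" if u: "?F u - t * u \<le> B" for u
  proof (cases "u \<le> ?s")
    case True
    have "(?z u, ?z (u + int n)) \<in> ?R \<and> ?F (u + int n) - t * (u + int n) \<le> B" if "u + int n \<le> ?s" for n
      using that
    proof (induction n)
      case (Suc n)
      have "out_slope d ds (u + int n) \<le> t"
        using slope_cons[OF Cons.prems(1), of t]
          out_slope_mono[OF Cons.prems(1), of "u + int n" "?s - 1"] Suc.prems by simp
      then have le: "?F (u + int n + 1) - t * (u + int n + 1) \<le> B"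
        using out_val_step[OF Cons.prems(1), of "u + int n"] Suc by (simp add: algebra_simps)
      have "(?z u, ?z (u + int n)) \<in> ?R" using Suc by simp
      also have "(?z (u + int n), ?z (u + int n + 1)) \<in> ?R" by (rule hop) (use Suc le in simp_all)
      finally have "(?z u, ?z (u + int n + 1)) \<in> ?R" .
      moreover have "u + int (Suc n) = u + int n + 1" by simp
      ultimately show ?case using le by (simp only:)
    qed (use u in simp)
    from this[of "nat (?s - u)"] True show ?thesis by simp
  next
    case False
    have "(?z u, ?z (u - int n)) \<in> ?R \<and> ?F (u - int n) - t * (u - int n) \<le> B" if "?s \<le> u - int n" for n
      using that
    proof (induction n)
      case (Suc n)
      have "t \<le> out_slope d ds (u - int n - 1)"
        using slope_cons[OF Cons.prems(1), of t]
          out_slope_mono[OF Cons.prems(1), of "?s" "u - int n - 1"] Suc.prems by simp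
      then have le: "?F (u - int n - 1) - t * (u - int n - 1) \<le> B"
        using out_val_step[OF Cons.prems(1), of "u - int n - 1"] Suc by (simp add: algebra_simps)
      have "(?z u, ?z (u - int n)) \<in> ?R" using Suc by simp
      also have "(?z (u - int n), ?z (u - int n - 1)) \<in> ?R"
        using hop[of "u - int n - 1"] Suc le by (auto intro: leg_steps_sym simp del: leg_val.simps)
      finally have "(?z u, ?z (u - int n - 1)) \<in> ?R" .
      moreover have "u - int (Suc n) = u - int n - 1" by simp
      ultimately show ?case using le by (simp only:)
    qed (use u in simp)
    from this[of "nat (u - ?s)"] False show ?thesis by simp
  qed
  note to_s = this
  have y: "y = case_nat (y 0) (\<lambda>j. y (Suc j))" by (auto simp: fun_eq_iff split: nat.split)
  have "leg_val (d # ds) t (case_nat (y 0) (\<lambda>j. y (Suc j))) \<le> B" using Cons.prems(3) y by simp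
  then have 1: "(y, ?z (y 0)) \<in> ?R"
    using lift[of "y 0" "\<lambda>j. y (Suc j)"] Cons.prems(2) y by simp
  have "?F (y 0) - t * y 0 \<le> leg_val (d # ds) t y"
    using leg_min_le[OF g, of "y 0" "\<lambda>j. y (Suc j)"] by (simp add: out_val_def)
  then have "(?z (y 0), ?z ?s) \<in> ?R" using Cons.prems(3) by (intro to_s) simp
  with 1 have "(y, ?z ?s) \<in> ?R" by (rule rtrancl_trans)
  then show ?case by (simp del: leg_slope.simps(2))
qed

text \<open>The product of the matrices \<open>(x, -1; 1, 0)\<close>; the continued fraction is the quotient of the two
  components of \<open>cf_act xs (1, 0)\<close>.\<close>

primrec cf_act :: "int list \<Rightarrow> int \<times> int \<Rightarrow> int \<times> int" where
  "cf_act [] z = z"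
| "cf_act (x # xs) z = (x * fst (cf_act xs z) - snd (cf_act xs z), fst (cf_act xs z))"

text \<open>\<open>leg_slope\<close> of the longer leg is the inverse of \<open>out_slope\<close>,
  and inversion swaps the two components of a translation. This is the recursion of
  \<open>cf_act\<close>, so the translation is given by the continued fraction of the leg.\<close>

lemma leg_slope_period:
  assumes "good_leg ds" "cf_act (map fst ds) (1, 0) = (p, q)"
  shows "leg_slope ds (t + p) = leg_slope ds t + q"
  using assms
proof (induction ds arbitrary: t p q)
  case (Cons d ds)
  obtain p' q' where pq: "cf_act (map fst ds) (1, 0) = (p', q')" by fastforce
  have p: "p = fst d * p' - q'" "q = p'" using Cons.prems(2) pq by auto
  have g: "good_leg ds" using Cons.prems(1) by simp
  have s: "out_slope d ds (y + p') = out_slope d ds y + p" for y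
    using Cons.IH[OF g pq, of y] by (simp add: out_slope_def p distrib_left)
  let ?s = "leg_slope (d # ds) t"
  have a: "?s + p' - 1 = ?s - 1 + p'" by simp
  show ?case
    unfolding p(2)
    by (rule slope_unique[OF Cons.prems(1)])
      (use slope_cons[OF Cons.prems(1), of t] in \<open>simp_all only: a s\<close>; linarith)+
qed simp

text \<open>With the seed \<open>(k, 1)\<close> the empty leg has growth 0 where the pair allows 1,
  and the inequality survives each inversion. It is applied with the pair
  \<open>(\<alpha>, B)\<close> to the last leg, for which \<alpha> is no period.\<close>

lemma leg_slope_period_le:
  assumes "good_leg ds" "cf_act (map fst ds) (k, 1) = (p, q)"
  shows "leg_slope ds (t + p) \<le> leg_slope ds t + q"
  using assms
proof (induction ds arbitrary: t p q)
  case (Cons d ds)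
  obtain p' q' where pq: "cf_act (map fst ds) (k, 1) = (p', q')" by fastforce
  have p: "p = fst d * p' - q'" "q = p'" using Cons.prems(2) pq by auto
  have g: "good_leg ds" using Cons.prems(1) by simp
  have s: "out_slope d ds y + p \<le> out_slope d ds (y + p')" for y
    using Cons.IH[OF g pq, of y] by (simp add: out_slope_def p distrib_left)
  let ?s = "leg_slope (d # ds)"
  have "t + p < out_slope d ds (?s t + p')"
    using s[of "?s t"] slope_cons[OF Cons.prems(1), of t] by linarith
  moreover have "out_slope d ds (?s (t + p) - 1) \<le> t + p" using slope_cons[OF Cons.prems(1)] by blast
  ultimately have "\<not> ?s t + p' \<le> ?s (t + p) - 1"
    using out_slope_mono[OF Cons.prems(1), of "?s t + p'" "?s (t + p) - 1"] by linarith
  then show ?case using p by linarith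
qed auto

section \<open>Star-shaped plumbings\<close>

lemma star_pverts:
  "pverts (star_plumbing n e xs) = insert Center {Leg i j | i j. i \<in> {1..n} \<and> j < length (xs i)}"
  and star_padj: "padj (star_plumbing n e xs) = star_adj"
  and star_pdec: "pdec (star_plumbing n e xs) Center = e"
    "pdec (star_plumbing n e xs) (Leg i j) = - (xs i ! j)"
  by (simp_all add: star_plumbing_def)

lemma star_legs_eq: "{Leg i j | i j. i \<in> {1..n} \<and> j < length (xs i)} =
    (\<lambda>(i, j). Leg i j) ` (SIGMA i : {1..n}. {..<length (xs i)})"
  by auto

lemma star_sum:
  "(\<Sum>v \<in> pverts (star_plumbing n e xs). f v) =
    f Center + (\<Sum>i=1..n. \<Sum>j<length (xs i). f (Leg i j))"
proof -
  have inj: "inj_on (\<lambda>(i, j). Leg i j) (SIGMA i : {1..n}. {..<length (xs i)})"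
    by (auto simp: inj_on_def)
  have "(\<Sum>v \<in> {Leg i j | i j. i \<in> {1..n} \<and> j < length (xs i)}. f v) =
      (\<Sum>(i, j) \<in> (SIGMA i : {1..n}. {..<length (xs i)}). f (Leg i j))"
    unfolding star_legs_eq sum.reindex[OF inj] by (simp add: case_prod_beta)
  also have "\<dots> = (\<Sum>i=1..n. \<Sum>j<length (xs i). f (Leg i j))" by (rule sum.Sigma[symmetric]) auto
  finally have legs: "(\<Sum>v \<in> {Leg i j | i j. i \<in> {1..n} \<and> j < length (xs i)}. f v) =
      (\<Sum>i=1..n. \<Sum>j<length (xs i). f (Leg i j))" .
  have "finite {Leg i j | i j. i \<in> {1..n} \<and> j < length (xs i)}" unfolding star_legs_eq by simp
  then have "(\<Sum>v \<in> pverts (star_plumbing n e xs). f v) =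
      f Center + (\<Sum>v \<in> {Leg i j | i j. i \<in> {1..n} \<and> j < length (xs i)}. f v)"
    unfolding star_pverts by (rule sum.insert) auto
  then show ?thesis unfolding legs .
qed

lemma star_finite: "finite (pverts (star_plumbing n e xs))"
  unfolding star_pverts star_legs_eq by auto

lemma star_adj_sym: "star_adj u v \<longleftrightarrow> star_adj v u"
  by (cases u; cases v) auto

lemma star_padj_sym: "padj (star_plumbing n e xs) u v \<longleftrightarrow> padj (star_plumbing n e xs) v u"
  unfolding star_padj by (rule star_adj_sym)

text \<open>The intersection matrix applied to \<open>y\<close>, row by row. The
  \<open>case_nat\<close> supplies the centre as predecessor of the first vertex; the missing outer
  neighbour contributes 0 once \<open>y\<close> is supported on the tree.\<close>

fun star_lap :: "nat \<Rightarrow> int \<Rightarrow> (nat \<Rightarrow> int list) \<Rightarrow> (star_vertex \<Rightarrow> real) \<Rightarrow> star_vertex \<Rightarrow> real" where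
  "star_lap n e xs y Center = of_int e * y Center + (\<Sum>i=1..n. y (Leg i 0))"
| "star_lap n e xs y (Leg i j) = case_nat (y Center) (\<lambda>j. y (Leg i j)) j -
     of_int (xs i ! j) * y (Leg i j) + y (Leg i (Suc j))"

definition star_supported :: "nat \<Rightarrow> (nat \<Rightarrow> int list) \<Rightarrow> (star_vertex \<Rightarrow> real) \<Rightarrow> bool" where
  "star_supported n xs y \<longleftrightarrow> (\<forall>i j. \<not> (i \<in> {1..n} \<and> j < length (xs i)) \<longrightarrow> y (Leg i j) = 0)"

lemma star_supported_iff:
  "star_supported n xs y \<longleftrightarrow> (\<forall>v. v \<notin> pverts (star_plumbing n e xs) \<longrightarrow> y v = 0)"
proof
  assume s: "star_supported n xs y"
  show "\<forall>v. v \<notin> pverts (star_plumbing n e xs) \<longrightarrow> y v = 0"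
  proof (intro allI impI)
    fix v assume "v \<notin> pverts (star_plumbing n e xs)"
    then show "y v = 0" using s by (cases v) (auto simp: star_pverts star_supported_def)
  qed
qed (auto simp: star_supported_def star_pverts)

lemma lattice_supported: "y \<in> lattice (star_plumbing n e xs) \<Longrightarrow> star_supported n xs y"
  unfolding star_supported_iff[of n xs y e] by (simp add: lattice_def)

lemma chain_row_sum:
  fixes g :: "nat \<Rightarrow> real"
  assumes "j < m" "g m = 0"
  shows "(\<Sum>l<m. g l * (if j = l then x else if l = Suc j \<or> j = Suc l then 1 else 0)) =
    case_nat 0 g j + x * g j + g (Suc j)"
proof -
  have "(\<Sum>l<m. g l * (if j = l then x else if l = Suc j \<or> j = Suc l then 1 else 0)) =
      (\<Sum>l<m. (if j = l then x * g l else 0) + (if Suc j = l then g l else 0) +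
        (if j = Suc l then g l else 0))"
    by (rule sum.cong) auto
  also have "\<dots> = (\<Sum>l<m. if j = l then x * g l else 0) + (\<Sum>l<m. if Suc j = l then g l else 0) +
        (\<Sum>l<m. if j = Suc l then g l else 0)"
    by (simp add: sum.distrib)
  also have "(\<Sum>l<m. if j = l then x * g l else 0) = x * g j" using assms by (simp add: sum.delta)
  also have "(\<Sum>l<m. if Suc j = l then g l else 0) = g (Suc j)"
    using assms by (cases "Suc j = m") (auto simp: sum.delta)
  also have "(\<Sum>l<m. if j = Suc l then g l else 0) = case_nat 0 g j"
    using assms(1) by (cases j) (auto simp: sum.delta)
  finally show ?thesis by simp
qed

lemma star_row_sum:
  assumes ne: "\<And>i. i \<in> {1..n} \<Longrightarrow> xs i \<noteq> []" and y: "star_supported n xs y"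
    and u: "u \<in> pverts (star_plumbing n e xs)"
  shows "(\<Sum>v \<in> pverts (star_plumbing n e xs). y v * of_int (vertex_form (star_plumbing n e xs) u v)) =
    star_lap n e xs y u"
proof -
  let ?F = "\<lambda>u v. real_of_int (vertex_form (star_plumbing n e xs) u v)"
  show ?thesis
  proof (cases u)
    case Center
    have "(\<Sum>j<length (xs i). y (Leg i j) * ?F Center (Leg i j)) = y (Leg i 0)"
      if "i \<in> {1..n}" for i
    proof -
      have "(\<Sum>j<length (xs i). y (Leg i j) * ?F Center (Leg i j)) =
          (\<Sum>j<length (xs i). if 0 = j then y (Leg i j) else 0)"
        by (rule sum.cong) (auto simp: vertex_form_def star_padj)
      then show ?thesis using ne[OF that] by (simp add: sum.delta)
    qed
    then show ?thesis unfolding Center star_sum by (simp add: vertex_form_def star_pdec)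
  next
    case (Leg i j)
    then have ij: "i \<in> {1..n}" "j < length (xs i)" using u by (auto simp: star_pverts)
    have l: "(\<Sum>l<length (xs i'). y (Leg i' l) * ?F (Leg i j) (Leg i' l)) =
        (if i = i' then case_nat 0 (\<lambda>j. y (Leg i j)) j - of_int (xs i ! j) * y (Leg i j) +
          y (Leg i (Suc j)) else 0)" for i'
    proof (cases "i = i'")
      case True
      have "(\<Sum>l<length (xs i). y (Leg i l) * ?F (Leg i j) (Leg i l)) =
        (\<Sum>l<length (xs i). y (Leg i l) *
          (if j = l then - of_int (xs i ! j) else if l = Suc j \<or> j = Suc l then 1 else 0))"
        by (rule sum.cong) (auto simp: vertex_form_def star_padj star_pdec)
      also have "\<dots> = case_nat 0 (\<lambda>j. y (Leg i j)) j + - of_int (xs i ! j) * y (Leg i j) +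
          y (Leg i (Suc j))"
        by (rule chain_row_sum) (use y ij in \<open>auto simp: star_supported_def\<close>)
      finally show ?thesis using True by simp
    qed (simp add: vertex_form_def star_padj)
    show ?thesis
      unfolding Leg star_sum l using ij
      by (cases j) (auto simp: vertex_form_def star_padj sum.delta)
  qed
qed

lemma star_pairing:
  assumes ne: "\<And>i. i \<in> {1..n} \<Longrightarrow> xs i \<noteq> []" and y: "star_supported n xs y"
  shows "pairing (star_plumbing n e xs) x y =
    (\<Sum>u \<in> pverts (star_plumbing n e xs). x u * star_lap n e xs y u)"
  unfolding pairing_def
proof (rule sum.cong[OF refl])
  fix u assume "u \<in> pverts (star_plumbing n e xs)"
  from star_row_sum[OF ne y this] show "(\<Sum>v \<in> pverts (star_plumbing n e xs).
      x u * y v * of_int (vertex_form (star_plumbing n e xs) u v)) = x u * star_lap n e xs y u"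
    by (simp only: mult.assoc flip: sum_distrib_left)
qed

definition basis_vec :: "'v \<Rightarrow> 'v \<Rightarrow> real" where
  "basis_vec u v = (if v = u then 1 else 0)"

lemma pairing_basis:
  assumes ne: "\<And>i. i \<in> {1..n} \<Longrightarrow> xs i \<noteq> []" and y: "star_supported n xs y"
    and u: "u \<in> pverts (star_plumbing n e xs)"
  shows "pairing (star_plumbing n e xs) (basis_vec u) y = star_lap n e xs y u"
proof -
  have "pairing (star_plumbing n e xs) (basis_vec u) y =
    (\<Sum>w \<in> pverts (star_plumbing n e xs). basis_vec u w * star_lap n e xs y w)"
    by (rule star_pairing[OF ne y])
  also have "\<dots> = (\<Sum>w \<in> pverts (star_plumbing n e xs). if w = u then star_lap n e xs y w else 0)"
    by (rule sum.cong) (auto simp: basis_vec_def)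
  finally show ?thesis using star_finite u by (simp add: sum.delta)
qed

lemma basis_lattice: "u \<in> pverts \<Gamma> \<Longrightarrow> basis_vec u \<in> lattice \<Gamma>"
  by (auto simp: lattice_def basis_vec_def)

lemma leg_val_sum:
  "2 * leg_val ds t y = (\<Sum>j<length ds. y j * (fst (ds ! j) * y j + (2 * snd (ds ! j) - fst (ds ! j)) -
     2 * case_nat t y j))"
proof (induction ds arbitrary: t y)
  case (Cons d ds)
  have "2 * (y 0 * (y 0 - 1) div 2) = y 0 * (y 0 - 1)" by simp
  then have "2 * (fst d * (y 0 * (y 0 - 1) div 2) + snd d * y 0 - t * y 0) =
      fst d * (y 0 * (y 0 - 1)) + 2 * (snd d * y 0) - 2 * (t * y 0)"
    by (simp add: algebra_simps)
  moreover have "case_nat (y 0) (\<lambda>j. y (Suc j)) j = y j" for j by (cases j) auto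
  ultimately show ?case
    using Cons[of "y 0" "\<lambda>j. y (Suc j)"]
    by (simp add: sum.lessThan_Suc_shift algebra_simps del: sum.lessThan_Suc)
qed simp

text \<open>Evaluation on basis vectors turns the characteristic condition into one parity for each
  vertex.\<close>

lemma char_basis:
  assumes ne: "\<And>i. i \<in> {1..n} \<Longrightarrow> xs i \<noteq> []" and k: "characteristic (star_plumbing n e xs) k"
    and u: "u \<in> pverts (star_plumbing n e xs)"
  shows "\<exists>j :: int. star_lap n e xs k u = of_int (pdec (star_plumbing n e xs) u) + 2 * of_int j"
proof -
  let ?\<Gamma> = "star_plumbing n e xs"
  have ks: "star_supported n xs k"
    using k unfolding star_supported_iff[of n xs k e] characteristic_def lattice_rat_def by auto
  have bs: "star_supported n xs (basis_vec u)"
    using basis_lattice[OF u] by (rule lattice_supported)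
  obtain j :: int where "pairing ?\<Gamma> k (basis_vec u) = pairing ?\<Gamma> (basis_vec u) (basis_vec u) + 2 * of_int j"
    using k basis_lattice[OF u] by (auto simp: characteristic_def)
  moreover have "pairing ?\<Gamma> k (basis_vec u) = star_lap n e xs k u"
    using pairing_basis[OF ne ks u] pairing_sym[of ?\<Gamma>, OF star_padj_sym] by metis
  moreover have "pairing ?\<Gamma> (basis_vec u) (basis_vec u) = of_int (pdec ?\<Gamma> u)"
  proof -
    have "star_lap n e xs (basis_vec u) u = of_int (pdec ?\<Gamma> u)"
      by (cases u) (auto simp: basis_vec_def star_pdec split: nat.split)
    then show ?thesis using pairing_basis[OF ne bs u] by simp
  qed
  ultimately show ?thesis by auto
qed

section \<open>Reduction of a star-shaped plumbing to a function of the central coordinate\<close>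

locale star =
  fixes n :: nat and e :: int and xs :: "nat \<Rightarrow> int list" and k :: "star_vertex \<Rightarrow> real"
  assumes xs_ne: "\<And>i. i \<in> {1..n} \<Longrightarrow> xs i \<noteq> []"
    and xs_ge: "\<And>i x. i \<in> {1..n} \<Longrightarrow> x \<in> set (xs i) \<Longrightarrow> 2 \<le> x"
    and k_char: "characteristic (star_plumbing n e xs) k"
    and k_lattice: "k \<in> lattice (star_plumbing n e xs)"
begin

abbreviation \<Gamma> where "\<Gamma> \<equiv> star_plumbing n e xs"

definition cc :: "nat \<Rightarrow> nat \<Rightarrow> int" where
  "cc i j = (SOME c. star_lap n e xs k (Leg i j) = of_int (xs i ! j - 2 * c))"

definition c0 :: int where
  "c0 = (SOME c. star_lap n e xs k Center = of_int (- e - 2 * c))"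

definition leg :: "nat \<Rightarrow> (int \<times> int) list" where
  "leg i = map (\<lambda>j. (xs i ! j, cc i j)) [0..<length (xs i)]"

lemma cc:
  assumes "i \<in> {1..n}" "j < length (xs i)"
  shows "star_lap n e xs k (Leg i j) = of_int (xs i ! j - 2 * cc i j)"
  unfolding cc_def
proof (rule someI_ex)
  have "Leg i j \<in> pverts \<Gamma>" using assms by (auto simp: star_pverts)
  from char_basis[OF xs_ne k_char this] obtain l :: int
    where "star_lap n e xs k (Leg i j) = of_int (pdec \<Gamma> (Leg i j)) + 2 * of_int l" by blast
  then show "\<exists>c. star_lap n e xs k (Leg i j) = of_int (xs i ! j - 2 * c)"
    by (intro exI[of _ "xs i ! j - l"]) (simp add: star_pdec)
qed

lemma c0: "star_lap n e xs k Center = of_int (- e - 2 * c0)"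
  unfolding c0_def
proof (rule someI_ex)
  have "Center \<in> pverts \<Gamma>" by (simp add: star_pverts)
  from char_basis[OF xs_ne k_char this] obtain l :: int
    where "star_lap n e xs k Center = of_int (pdec \<Gamma> Center) + 2 * of_int l" by blast
  then show "\<exists>c. star_lap n e xs k Center = of_int (- e - 2 * c)"
    by (intro exI[of _ "- e - l"]) (simp add: star_pdec)
qed

lemma map_fst_leg: "map fst (leg i) = xs i"
  by (simp add: leg_def comp_def map_nth)

lemma length_leg: "length (leg i) = length (xs i)"
  by (simp add: leg_def)

lemma good_leg: "i \<in> {1..n} \<Longrightarrow> good_leg (leg i)"
  using xs_ge by (auto simp: leg_def)

definition pt :: "int \<Rightarrow> (nat \<Rightarrow> nat \<Rightarrow> int) \<Rightarrow> star_vertex \<Rightarrow> real" where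
  "pt t Y v = (case v of Center \<Rightarrow> of_int t
     | Leg i j \<Rightarrow> if i \<in> {1..n} \<and> j < length (xs i) then of_int (Y i j) else 0)"

lemma pt_lattice: "pt t Y \<in> lattice \<Gamma>"
  unfolding lattice_def star_pverts
proof (intro CollectI conjI allI impI ballI)
  fix v assume "v \<notin> insert Center {Leg i j | i j. i \<in> {1..n} \<and> j < length (xs i)}"
  then show "pt t Y v = 0" by (cases v) (auto simp: pt_def)
next
  fix v show "pt t Y v \<in> \<int>" by (cases v) (auto simp: pt_def)
qed

lemma pt_floor:
  assumes "x \<in> lattice \<Gamma>"
  shows "pt \<lfloor>x Center\<rfloor> (\<lambda>i j. \<lfloor>x (Leg i j)\<rfloor>) = x"
proof
  fix v
  have "of_int \<lfloor>x v\<rfloor> = x v" using vfloor_lattice[OF assms] by (simp add: vfloor_def fun_eq_iff)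
  then show "pt \<lfloor>x Center\<rfloor> (\<lambda>i j. \<lfloor>x (Leg i j)\<rfloor>) v = x v"
    using lattice_supported[OF assms] by (cases v) (auto simp: pt_def star_supported_def)
qed

lemma pt_Center [simp]: "pt t Y Center = of_int t"
  by (simp add: pt_def)

definition cval :: "int \<Rightarrow> int" where
  "cval t = - e * (t * (t - 1) div 2) + c0 * t"

lemma weight_pt: "weight \<Gamma> k (pt t Y) = - of_int (cval t + (\<Sum>i=1..n. leg_val (leg i) t (Y i)))"
proof -
  let ?x = "pt t Y" and ?L = "star_lap n e xs"
  \<comment> \<open>The central row contributes \<open>t\<close> times the first coordinate of every
    leg. Moving this term into the leg makes each edge count twice within a single leg, as in
    \<open>leg_val_sum\<close>.\<close>
  have leg: "(\<Sum>j<length (xs i). ?x (Leg i j) * (?L ?x (Leg i j) + ?L k (Leg i j))) +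
      of_int t * ?x (Leg i 0) = - 2 * of_int (leg_val (leg i) t (Y i))" if i: "i \<in> {1..n}" for i
  proof -
    let ?y = "\<lambda>j. ?x (Leg i j)" and ?m = "length (xs i)"
    let ?p = "case_nat (of_int t) ?y" and ?c = "\<lambda>j. of_int (xs i ! j) - 2 * of_int (cc i j) :: real"
    obtain m where m: "?m = Suc m" using xs_ne[OF i] by (cases "xs i") auto
    have ym: "?y ?m = 0" by (simp add: pt_def)
    have "(\<Sum>j<?m. ?y j * ?p j) = of_int t * ?y 0 + (\<Sum>j<m. ?y (Suc j) * ?y j)"
      unfolding m by (simp add: sum.lessThan_Suc_shift del: sum.lessThan_Suc)
    also have "(\<Sum>j<m. ?y (Suc j) * ?y j) = (\<Sum>j<?m. ?y (Suc j) * ?y j)"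
      using ym unfolding m by simp
    \<comment> \<open>Summing over the edges from their inner or from their outer ends gives the
      same, apart from the edge to the centre.\<close>
    finally have shift: "(\<Sum>j<?m. ?y j * ?p j) =
        of_int t * ?y 0 + (\<Sum>j<?m. ?y (Suc j) * ?y j)" .
    have "(\<Sum>j<?m. ?y j * (?L ?x (Leg i j) + ?L k (Leg i j))) =
      (\<Sum>j<?m. ?y j * ?p j + ?y (Suc j) * ?y j +
        ?y j * (?c j - of_int (xs i ! j) * ?y j))"
    proof (rule sum.cong[OF refl])
      fix j assume "j \<in> {..<?m}"
      then have j: "j < ?m" by simp
      show "?y j * (?L ?x (Leg i j) + ?L k (Leg i j)) =
          ?y j * ?p j + ?y (Suc j) * ?y j +
          ?y j * (?c j - of_int (xs i ! j) * ?y j)"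
        unfolding cc[OF i j] unfolding star_lap.simps pt_Center by (simp add: algebra_simps)
    qed
    also have "\<dots> = 2 * (\<Sum>j<?m. ?y j * ?p j) - of_int t * ?y 0 +
        (\<Sum>j<?m. ?y j * (?c j - of_int (xs i ! j) * ?y j))"
      unfolding sum.distrib using shift by simp
    finally have "(\<Sum>j<?m. ?y j * (?L ?x (Leg i j) + ?L k (Leg i j))) +
        of_int t * ?y 0 = 2 * (\<Sum>j<?m. ?y j * ?p j) +
        (\<Sum>j<?m. ?y j * (?c j - of_int (xs i ! j) * ?y j))"
      by simp
    also have "\<dots> = (\<Sum>j<?m. - (?y j * (of_int (xs i ! j) * ?y j - ?c j -
        2 * ?p j)))"
      unfolding sum_distrib_left sum.distrib[symmetric] by (rule sum.cong) (auto simp: algebra_simps)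
    also have "\<dots> = - of_int (\<Sum>j<?m. Y i j * (xs i ! j * Y i j + (2 * cc i j - xs i ! j) -
        2 * case_nat t (Y i) j))"
      unfolding of_int_sum sum_negf[symmetric] 
    proof (rule sum.cong[OF refl])
      fix j assume j: "j \<in> {..<?m}"
      have "?p j = of_int (case_nat t (Y i) j)"
        using j i by (cases j) (auto simp: pt_def)
      moreover have "?y j = of_int (Y i j)" using i j by (simp add: pt_def)
      ultimately show "- (?y j * (of_int (xs i ! j) * ?y j - ?c j -
          2 * ?p j)) =
          - of_int (Y i j * (xs i ! j * Y i j + (2 * cc i j - xs i ! j) - 2 * case_nat t (Y i) j))"
        by simp
    qed
    also have "(\<Sum>j<?m. Y i j * (xs i ! j * Y i j + (2 * cc i j - xs i ! j) - 2 * case_nat t (Y i) j)) =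
        2 * leg_val (leg i) t (Y i)"
      unfolding leg_val_sum length_leg by (rule sum.cong) (auto simp: leg_def)
    finally show ?thesis by simp
  qed
  have "2 * weight \<Gamma> k ?x = pairing \<Gamma> ?x ?x + pairing \<Gamma> ?x k"
    using pairing_sym[of \<Gamma>, OF star_padj_sym] by (simp add: weight_def)
  also have "\<dots> = of_int t * (?L ?x Center + ?L k Center) +
      (\<Sum>i=1..n. \<Sum>j<length (xs i). ?x (Leg i j) * (?L ?x (Leg i j) + ?L k (Leg i j)))"
    using star_pairing[OF xs_ne lattice_supported[OF pt_lattice], where e = e, unfolded star_sum]
      star_pairing[OF xs_ne lattice_supported[OF k_lattice], where e = e, unfolded star_sum]
    by (simp add: distrib_left sum.distrib del: star_lap.simps)
  also have "\<dots> = of_int t * (of_int e * of_int t + of_int (- e - 2 * c0)) +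
      (\<Sum>i=1..n. (\<Sum>j<length (xs i). ?x (Leg i j) * (?L ?x (Leg i j) + ?L k (Leg i j))) +
        of_int t * ?x (Leg i 0))"
    unfolding c0 by (simp add: distrib_left sum.distrib sum_distrib_left del: star_lap.simps(2))
  also have "\<dots> = of_int t * (of_int e * of_int t + of_int (- e - 2 * c0)) +
      (\<Sum>i=1..n. - 2 * of_int (leg_val (leg i) t (Y i)))"
    using leg by (simp del: star_lap.simps)
  also have "of_int t * (of_int e * of_int t + of_int (- e - 2 * c0)) = (- 2 * of_int (cval t) :: real)"
  proof -
    have "2 * (t * (t - 1) div 2) = t * (t - 1)" by simp
    then have "t * (e * t + (- e - 2 * c0)) = - 2 * cval t"
      unfolding cval_def by (simp add: algebra_simps)
    then have "real_of_int (t * (e * t + (- e - 2 * c0))) = of_int (- 2 * cval t)" by (simp only:)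
    then show ?thesis by simp
  qed
  also have "- 2 * of_int (cval t) + (\<Sum>i=1..n. - 2 * of_int (leg_val (leg i) t (Y i))) =
      2 * (- of_int (cval t + (\<Sum>i=1..n. leg_val (leg i) t (Y i))) :: real)"
    by (simp add: sum_negf sum_distrib_left)
  finally show ?thesis by simp
qed

definition opt :: "int \<Rightarrow> star_vertex \<Rightarrow> real" where
  "opt t = pt t (\<lambda>i. leg_opt (leg i) t)"

definition tau :: "int \<Rightarrow> int" where
  "tau t = cval t + (\<Sum>i=1..n. leg_min (leg i) t)"

lemma opt_lattice: "opt t \<in> lattice \<Gamma>"
  unfolding opt_def by (rule pt_lattice)

lemma opt_Center [simp]: "opt t Center = of_int t"
  by (simp add: opt_def)

lemma weight_opt: "weight \<Gamma> k (opt t) = - of_int (tau t)"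
  unfolding opt_def weight_pt tau_def ..

lemma weight_le_tau:
  assumes "x \<in> lattice \<Gamma>" shows "weight \<Gamma> k x \<le> - of_int (tau \<lfloor>x Center\<rfloor>)"
proof -
  let ?t = "\<lfloor>x Center\<rfloor>"
  have "(\<Sum>i=1..n. leg_min (leg i) ?t) \<le> (\<Sum>i=1..n. leg_val (leg i) ?t (\<lambda>j. \<lfloor>x (Leg i j)\<rfloor>))"
    by (intro sum_mono leg_min_le good_leg)
  then have "tau ?t \<le> cval ?t + (\<Sum>i=1..n. leg_val (leg i) ?t (\<lambda>j. \<lfloor>x (Leg i j)\<rfloor>))"
    by (simp add: tau_def)
  then have "real_of_int (tau ?t) \<le>
      of_int (cval ?t + (\<Sum>i=1..n. leg_val (leg i) ?t (\<lambda>j. \<lfloor>x (Leg i j)\<rfloor>)))"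
    by (simp only: of_int_le_iff)
  then show ?thesis
    using weight_pt[of ?t "\<lambda>i j. \<lfloor>x (Leg i j)\<rfloor>"] unfolding pt_floor[OF assms] by linarith
qed

lemma tau_step: "tau (t + 1) = tau t - e * t + c0 - (\<Sum>i=1..n. leg_slope (leg i) t)"
proof -
  have "(\<Sum>i=1..n. leg_min (leg i) (t + 1)) = (\<Sum>i=1..n. leg_min (leg i) t - leg_slope (leg i) t)"
    by (rule sum.cong) (use leg_min_step good_leg in auto)
  moreover have "cval (t + 1) = cval t - e * t + c0"
    unfolding cval_def using half_step[of t] by (simp add: algebra_simps)
  ultimately show ?thesis by (simp add: tau_def sum_subtractf)
qed

lemma leg_path_lift:
  assumes i: "i \<in> {1..n}"
    and m: "of_int m \<le> weight \<Gamma> k (pt t (Y(i := y)))"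
    and B: "B = - m - cval t - (\<Sum>l \<in> {1..n} - {i}. leg_val (leg l) t (Y l))"
    and yy: "(y, y') \<in> (leg_step (leg i) t B)\<^sup>*"
  shows "lat_conn \<Gamma> k m (pt t (Y(i := y))) (pt t (Y(i := y')))"
  using yy
proof induction
  case base
  show ?case by (rule lat_conn_refl[OF pt_lattice m])
next
  case (step y z)
  have w: "of_int m \<le> weight \<Gamma> k (pt t (Y(i := u)))" if "leg_val (leg i) t u \<le> B" for u
  proof -
    have "(\<Sum>l=1..n. leg_val (leg l) t ((Y(i := u)) l)) =
        leg_val (leg i) t u + (\<Sum>l \<in> {1..n} - {i}. leg_val (leg l) t ((Y(i := u)) l))"
      using i by (subst sum.remove[of _ i]) auto
    also have "(\<Sum>l \<in> {1..n} - {i}. leg_val (leg l) t ((Y(i := u)) l)) =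
        (\<Sum>l \<in> {1..n} - {i}. leg_val (leg l) t (Y l))"
      by (rule sum.cong) auto
    finally have "m \<le> - (cval t + (\<Sum>l=1..n. leg_val (leg l) t ((Y(i := u)) l)))" using that B by simp
    then show ?thesis unfolding weight_pt by (metis of_int_le_iff of_int_minus)
  qed
  obtain j where j: "j < length (xs i)" "z = y(j := y j + 1) \<or> y = z(j := z j + 1)"
    using step(2) by (auto simp: leg_step_def length_leg)
  have upd: "pt t (Y(i := u(j := u j + 1))) =
      (pt t (Y(i := u)))(Leg i j := pt t (Y(i := u)) (Leg i j) + 1)" for u
  proof
    fix v show "pt t (Y(i := u(j := u j + 1))) v =
      ((pt t (Y(i := u)))(Leg i j := pt t (Y(i := u)) (Leg i j) + 1)) v"
      using i j(1) by (cases v) (auto simp: pt_def)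
  qed
  have "Leg i j \<in> pverts \<Gamma>" using i j(1) by (auto simp: star_pverts)
  then have "(pt t (Y(i := y)), pt t (Y(i := z))) \<in> lat_step \<Gamma> k m"
    unfolding lat_step_def using j(2) upd pt_lattice w step(2) by (auto simp: leg_step_def)
  then show ?case using step.IH lat_conn_step lat_conn_trans by blast
qed

text \<open>For a fixed centre the legs do not interact, so they can be optimised one after another;
  \<open>F\<close> collects those already done. The bound given to a leg is what the other legs
  leave of the allowed value.\<close>

lemma conn_opt:
  assumes x: "x \<in> lattice \<Gamma>" "of_int m \<le> weight \<Gamma> k x"
  shows "lat_conn \<Gamma> k m x (opt \<lfloor>x Center\<rfloor>)"
proof -
  let ?t = "\<lfloor>x Center\<rfloor>" and ?X = "\<lambda>i j. \<lfloor>x (Leg i j)\<rfloor>"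
  let ?Y = "\<lambda>F i. if i \<in> F then leg_opt (leg i) ?t else ?X i"
  have "F \<subseteq> {1..n} \<Longrightarrow> lat_conn \<Gamma> k m x (pt ?t (?Y F))" if "finite F" for F
    using that
  proof (induction F)
    case empty
    show ?case using x pt_floor[OF x(1)] by (simp add: lat_conn_refl)
  next
    case (insert i F)
    have i: "i \<in> {1..n}" using insert by simp
    have IH: "lat_conn \<Gamma> k m x (pt ?t (?Y F))" using insert by simp
    have e: "(?Y F)(i := ?X i) = ?Y F" "(?Y F)(i := leg_opt (leg i) ?t) = ?Y (insert i F)"
      using insert.hyps by (auto simp: fun_eq_iff)
    let ?B = "- m - cval ?t - (\<Sum>l \<in> {1..n} - {i}. leg_val (leg l) ?t (?Y F l))"
    have w: "of_int m \<le> weight \<Gamma> k (pt ?t (?Y F))" using lat_conn_in[OF IH] by simp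
    then have "real_of_int m \<le> of_int (- (cval ?t + (\<Sum>l=1..n. leg_val (leg l) ?t (?Y F l))))"
      unfolding weight_pt by simp
    then have "m \<le> - (cval ?t + (\<Sum>l=1..n. leg_val (leg l) ?t (?Y F l)))" by (simp only: of_int_le_iff)
    moreover have "(\<Sum>l=1..n. leg_val (leg l) ?t (?Y F l)) =
        leg_val (leg i) ?t (?X i) + (\<Sum>l \<in> {1..n} - {i}. leg_val (leg l) ?t (?Y F l))"
      using i insert.hyps by (subst sum.remove[of _ i]) auto
    ultimately have v: "leg_val (leg i) ?t (?X i) \<le> ?B" by linarith
    have supp: "\<forall>j \<ge> length (leg i). ?X i j = 0"
      using lattice_supported[OF x(1)] by (auto simp: star_supported_def length_leg)
    have "lat_conn \<Gamma> k m (pt ?t ((?Y F)(i := ?X i))) (pt ?t ((?Y F)(i := leg_opt (leg i) ?t)))"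
      by (rule leg_path_lift[OF i _ refl leg_steps_to_opt[OF good_leg[OF i] supp v]])
        (use w e(1) in simp)
    then show ?case using IH unfolding e by (rule lat_conn_trans[rotated])
  qed
  from this[of "{1..n}"] have c: "lat_conn \<Gamma> k m x (pt ?t (?Y {1..n}))" by simp
  have "pt ?t (?Y {1..n}) v = opt ?t v" for v
    unfolding opt_def pt_def by (cases v) auto
  then have "pt ?t (?Y {1..n}) = opt ?t" by blast
  then show ?thesis using c by simp
qed

lemma conn_opt_next:
  assumes "tau t \<le> - m" "tau (t + 1) \<le> - m"
  shows "lat_conn \<Gamma> k m (opt t) (opt (t + 1))"
proof -
  let ?y = "pt (t + 1) (\<lambda>i. leg_opt (leg i) t)"
  have "(\<Sum>i=1..n. leg_val (leg i) (t + 1) (leg_opt (leg i) t)) = (\<Sum>i=1..n. leg_min (leg i) (t + 1))"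
    by (rule sum.cong) (use leg_opt_next good_leg in auto)
  then have w: "weight \<Gamma> k ?y = - of_int (tau (t + 1))" unfolding weight_pt tau_def by simp
  have upd: "?y = (opt t)(Center := opt t Center + 1)"
  proof
    fix v show "?y v = ((opt t)(Center := opt t Center + 1)) v"
      by (cases v) (auto simp: opt_def pt_def)
  qed
  have r: "real_of_int m \<le> - of_int (tau t)" "real_of_int m \<le> - of_int (tau (t + 1))"
    using assms by linarith+
  have "Center \<in> pverts \<Gamma>" by (simp add: star_pverts)
  moreover have "of_int m \<le> weight \<Gamma> k (opt t)" unfolding weight_opt by (rule r(1))
  moreover have "of_int m \<le> weight \<Gamma> k ?y" unfolding w by (rule r(2))
  ultimately have "(opt t, ?y) \<in> lat_step \<Gamma> k m"
    unfolding lat_step_def using upd opt_lattice pt_lattice by blast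
  moreover have "lat_conn \<Gamma> k m ?y (opt (t + 1))"
    using conn_opt[OF pt_lattice, of m "t + 1" "\<lambda>i. leg_opt (leg i) t"] w r by simp
  ultimately show ?thesis using lat_conn_step lat_conn_trans by blast
qed

definition low :: "int \<Rightarrow> int \<Rightarrow> int \<Rightarrow> bool" where
  "low m s t \<longleftrightarrow> (\<forall>u. min s t \<le> u \<longrightarrow> u \<le> max s t \<longrightarrow> tau u \<le> - m)"

text \<open>A lattice step moves the centre by at most one, so a path visits every central
  coordinate in between, where \<open>tau\<close> limits the weight. Conversely
  \<open>conn_opt_next\<close> joins neighbouring optimal points.\<close>

lemma conn_opt_iff: "lat_conn \<Gamma> k m (opt s) (opt t) \<longleftrightarrow> low m s t"
proof
  assume c: "lat_conn \<Gamma> k m (opt s) (opt t)"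
  have w: "tau \<lfloor>x Center\<rfloor> \<le> - m" if "x \<in> lattice \<Gamma>" "of_int m \<le> weight \<Gamma> k x" for x
    using weight_le_tau[OF that(1)] that(2) by linarith
  have "(opt s, opt t) \<in> (lat_step \<Gamma> k m)\<^sup>*" using c by (simp add: lat_conn_def)
  then have "low m s \<lfloor>opt t Center\<rfloor>"
  proof induction
    case base
    have "tau \<lfloor>opt s Center\<rfloor> \<le> - m" using w lat_conn_in[OF c] by blast
    then show ?case by (auto simp: low_def)
  next
    case (step y z)
    have z: "z \<in> lattice \<Gamma>" "of_int m \<le> weight \<Gamma> k z" and y: "y \<in> lattice \<Gamma>"
      using step(2) by (auto simp: lat_step_def)
    obtain v where "z = y(v := y v + 1) \<or> y = z(v := z v + 1)"
      using step(2) by (auto simp: lat_step_def)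
    then have "z Center = y Center \<or> z Center = y Center + 1 \<or> y Center = z Center + 1"
      by (metis fun_upd_apply)
    then have near: "\<lfloor>z Center\<rfloor> = \<lfloor>y Center\<rfloor> \<or> \<lfloor>z Center\<rfloor> = \<lfloor>y Center\<rfloor> + 1 \<or>
        \<lfloor>y Center\<rfloor> = \<lfloor>z Center\<rfloor> + 1" by auto
    show ?case unfolding low_def
    proof (intro allI impI)
      fix u assume u: "min s \<lfloor>z Center\<rfloor> \<le> u" "u \<le> max s \<lfloor>z Center\<rfloor>"
      show "tau u \<le> - m"
      proof (cases "u = \<lfloor>z Center\<rfloor>")
        case True
        then show ?thesis using w[OF z] by simp
      next
        case False
        then have "min s \<lfloor>y Center\<rfloor> \<le> u" "u \<le> max s \<lfloor>y Center\<rfloor>" using u near by linarith+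
        then show ?thesis using step.IH by (simp add: low_def)
      qed
    qed
  qed
  then show "low m s t" by simp
next
  have up: "low m s (s + int d) \<Longrightarrow> lat_conn \<Gamma> k m (opt s) (opt (s + int d))" for d s
  proof (induction d)
    case 0
    then have "tau s \<le> - m" by (simp add: low_def)
    then have "real_of_int m \<le> - of_int (tau s)" by linarith
    then show ?case using weight_opt opt_lattice by (simp add: lat_conn_refl)
  next
    case (Suc d)
    have "low m s (s + int d)" using Suc.prems by (auto simp: low_def)
    then have "lat_conn \<Gamma> k m (opt s) (opt (s + int d))" by (rule Suc.IH)
    moreover have "lat_conn \<Gamma> k m (opt (s + int d)) (opt (s + int d + 1))"
      by (rule conn_opt_next) (use Suc.prems in \<open>auto simp: low_def\<close>)
    moreover have "s + int (Suc d) = s + int d + 1" by simp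
    ultimately show ?case using lat_conn_trans by metis
  qed
  assume l: "low m s t"
  show "lat_conn \<Gamma> k m (opt s) (opt t)"
  proof (cases "s \<le> t")
    case True
    then show ?thesis using up[of s "nat (t - s)"] l by simp
  next
    case False
    have "low m t s" using l by (simp add: low_def min.commute max.commute)
    then show ?thesis using up[of t "nat (s - t)"] False lat_conn_sym by simp
  qed
qed

section \<open>The symmetric graded root of \<open>tau\<close>\<close>

definition \<sigma> :: int where
  "\<sigma> = - \<lfloor>k Center\<rfloor>"

lemma k_Center: "k Center = - of_int \<sigma>"
proof -
  have "of_int \<lfloor>k Center\<rfloor> = k Center"
    using fun_cong[OF vfloor_lattice[OF k_lattice], of Center] unfolding vfloor_def .
  then show ?thesis unfolding \<sigma>_def of_int_minus minus_minus by (rule sym)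
qed

lemma reflect_Center: "reflect k (opt t) Center = of_int (\<sigma> - t)"
  by (simp add: reflect_def k_Center)

text \<open>The reflection of an optimal point has the same weight and lies over
  \<open>\<sigma> - t\<close>. This gives one inequality, and its mirror image gives the
  other.\<close>

lemma tau_sym: "tau (\<sigma> - t) = tau t"
proof -
  have "tau (\<sigma> - t) \<le> tau t" for t
  proof -
    have "weight \<Gamma> k (reflect k (opt t)) \<le> - of_int (tau \<lfloor>reflect k (opt t) Center\<rfloor>)"
      by (rule weight_le_tau[OF reflect_lattice[OF k_lattice opt_lattice]])
    then show ?thesis unfolding reflect_Center
      by (simp add: weight_reflect[OF star_padj_sym] weight_opt)
  qed
  from this[of t] this[of "\<sigma> - t"] show ?thesis by simp
qed

lemma low_refl [simp]: "low m t t \<longleftrightarrow> tau t \<le> - m"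
  by (auto simp: low_def)

abbreviation R where "R \<equiv> lattice_homology \<Gamma> k"

definition nd :: "int \<Rightarrow> int \<Rightarrow> int \<times> (star_vertex \<Rightarrow> real) set" where
  "nd m t = (m, comp_of \<Gamma> k m (opt t))"

lemma le_weight_opt: "tau t \<le> - m \<longleftrightarrow> of_int m \<le> weight \<Gamma> k (opt t)"
  unfolding weight_opt by linarith

lemma comps: "components (superlevel \<Gamma> k m) = {comp_of \<Gamma> k m (opt t) | t. tau t \<le> - m}"
proof -
  have "comp_of \<Gamma> k m x = comp_of \<Gamma> k m (opt \<lfloor>x Center\<rfloor>) \<and> tau \<lfloor>x Center\<rfloor> \<le> - m"
    if x: "x \<in> lattice \<Gamma>" "of_int m \<le> weight \<Gamma> k x" for x
    using conn_opt[OF x] lat_conn_in[OF conn_opt[OF x]] comp_of_eq_iff[OF star_finite x]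
    by (simp add: le_weight_opt)
  then show ?thesis
    unfolding components_eq[OF star_finite] using opt_lattice le_weight_opt by blast
qed

lemma rverts_R: "rverts R = {nd m t | m t. tau t \<le> - m}"
  by (auto simp: lattice_homology_def comps nd_def)

lemma nd_eq_iff:
  assumes "tau s \<le> - m" "tau t \<le> - m"
  shows "nd m s = nd m t \<longleftrightarrow> low m s t"
  unfolding nd_def using assms comp_of_eq_iff[OF star_finite, of "opt s" n e xs m k "opt t"]
  by (simp add: opt_lattice le_weight_opt conn_opt_iff)

definition cen :: "int \<times> (star_vertex \<Rightarrow> real) set \<Rightarrow> int" where
  "cen v = (SOME t. tau t \<le> - fst v \<and> v = nd (fst v) t)"

definition par :: "int \<times> (star_vertex \<Rightarrow> real) set \<Rightarrow> int \<times> (star_vertex \<Rightarrow> real) set" where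
  "par v = nd (fst v - 1) (cen v)"

lemma low_mono: "m' \<le> m \<Longrightarrow> low m s t \<Longrightarrow> low m' s t"
  unfolding low_def by fastforce

lemma par_nd:
  assumes "tau t \<le> - m" shows "par (nd m t) = nd (m - 1) t"
proof -
  have f: "fst (nd m t) = m" by (simp add: nd_def)
  have "\<exists>s. tau s \<le> - m \<and> nd m t = nd m s" using assms by blast
  then have c: "tau (cen (nd m t)) \<le> - m \<and> nd m t = nd m (cen (nd m t))"
    unfolding cen_def f by (rule someI_ex)
  then have "low m t (cen (nd m t))" using nd_eq_iff assms by blast
  then have "low (m - 1) t (cen (nd m t))" by (rule low_mono[rotated]) simp
  then have "nd (m - 1) t = nd (m - 1) (cen (nd m t))"
    using nd_eq_iff[of t "m - 1" "cen (nd m t)"] assms c by simp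
  then show ?thesis by (simp add: par_def f)
qed

lemma par_pow_nd: "tau t \<le> - m \<Longrightarrow> (par ^^ d) (nd m t) = nd (m - int d) t"
proof (induction d)
  case (Suc d)
  have "tau t \<le> - (m - int d)" using Suc by simp
  from par_nd[OF this] Suc show ?case by (simp add: algebra_simps)
qed simp

lemma rup_R: "(u, v) \<in> rup R \<longleftrightarrow> u \<in> rverts R \<and> v = par u"
proof
  assume "(u, v) \<in> rup R"
  then obtain m C D where u: "u = (m + 1, C)" and v: "v = (m, D)"
    and C: "C \<in> components (superlevel \<Gamma> k (m + 1))" and D: "D \<in> components (superlevel \<Gamma> k m)"
    and CD: "C \<subseteq> D" by (auto simp: lattice_homology_def)
  from C obtain s where s: "C = comp_of \<Gamma> k (m + 1) (opt s)" "tau s \<le> - (m + 1)"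
    unfolding comps by blast
  from D obtain t where t: "D = comp_of \<Gamma> k m (opt t)" "tau t \<le> - m"
    unfolding comps by blast
  have "of_int (m + 1) \<le> weight \<Gamma> k (opt s)" "of_int m \<le> weight \<Gamma> k (opt t)"
    using s t le_weight_opt by blast+
  from comp_of_subset_iff[OF star_finite _ opt_lattice this(1) opt_lattice this(2)]
  have "comp_of \<Gamma> k m (opt s) = comp_of \<Gamma> k m (opt t)" using CD s t by simp
  then have "v = nd m s" using v t by (simp add: nd_def)
  moreover have u': "u = nd (m + 1) s" using u s by (simp add: nd_def)
  moreover have "u \<in> rverts R" unfolding u' rverts_R using s(2) by blast
  ultimately show "u \<in> rverts R \<and> v = par u" using par_nd[OF s(2)] by simp
next
  assume uv: "u \<in> rverts R \<and> v = par u"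
  then obtain m t where u: "u = nd m t" "tau t \<le> - m" by (auto simp: rverts_R)
  then have v: "v = nd (m - 1) t" using uv par_nd by simp
  have "(nd m t, nd (m - 1) t) = ((m - 1 + 1, comp_of \<Gamma> k (m - 1 + 1) (opt t)), (m - 1, comp_of \<Gamma> k (m - 1) (opt t)))"
    by (simp add: nd_def)
  moreover have "comp_of \<Gamma> k (m - 1 + 1) (opt t) \<in> components (superlevel \<Gamma> k (m - 1 + 1))"
    unfolding comps using u(2) by auto
  moreover have "comp_of \<Gamma> k (m - 1) (opt t) \<in> components (superlevel \<Gamma> k (m - 1))"
    unfolding comps using u(2) by force
  moreover have "comp_of \<Gamma> k (m - 1 + 1) (opt t) \<subseteq> comp_of \<Gamma> k (m - 1) (opt t)"
    by (rule comp_of_mono[OF star_finite]) simp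
  ultimately show "(u, v) \<in> rup R" unfolding u v by (auto simp: lattice_homology_def)
qed

lemma refl_nd:
  assumes "tau t \<le> - m" shows "rrefl R (nd m t) = nd m (\<sigma> - t)"
proof -
  let ?r = "reflect k (opt t)"
  have o: "opt t \<in> lattice \<Gamma>" "of_int m \<le> weight \<Gamma> k (opt t)"
    using assms by (simp_all add: opt_lattice le_weight_opt)
  have r: "?r \<in> lattice \<Gamma>" "of_int m \<le> weight \<Gamma> k ?r"
    using o reflect_lattice[OF k_lattice] by (simp_all add: weight_reflect[OF star_padj_sym])
  have "rrefl R (nd m t) = (m, reflect k ` comp_of \<Gamma> k m (opt t))"
    by (simp add: lattice_homology_def nd_def reflect_def[abs_def])
  also have "reflect k ` comp_of \<Gamma> k m (opt t) = comp_of \<Gamma> k m ?r"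
    by (rule reflect_comp_of[OF star_finite star_padj_sym k_lattice o])
  also have "\<dots> = comp_of \<Gamma> k m (opt (\<sigma> - t))"
    using conn_opt[OF r] comp_of_eq_iff[OF star_finite r] lat_conn_in[OF conn_opt[OF r]]
    unfolding reflect_Center by simp
  finally show ?thesis by (simp add: nd_def)
qed

definition g0 :: real where
  "g0 = - (pairing \<Gamma> k k + of_nat (card (pverts \<Gamma>))) / 4"

definition lev :: "int \<times> (star_vertex \<Rightarrow> real) set \<Rightarrow> int" where
  "lev v = - fst v"

lemma lev_nd [simp]: "lev (nd m t) = - m"
  by (simp add: lev_def nd_def)

lemma rgrade_nd: "rgrade R (nd m t) = g0 + 2 * of_int (- m)"
  by (simp add: lattice_homology_def nd_def g0_def add_divide_distrib)

lemma stem_nd: "nd m t \<in> stem R \<and> tau t \<le> - m \<longleftrightarrow> low m t (\<sigma> - t)"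
proof
  assume a: "nd m t \<in> stem R \<and> tau t \<le> - m"
  then have "rrefl R (nd m t) = nd m t" by (simp add: stem_def)
  then have "nd m (\<sigma> - t) = nd m t" using refl_nd[of t m] a by argo
  then show "low m t (\<sigma> - t)" using nd_eq_iff[of t m "\<sigma> - t"] a tau_sym by simp
next
  assume l: "low m t (\<sigma> - t)"
  then have t: "tau t \<le> - m" by (simp add: low_def)
  then have "nd m (\<sigma> - t) = nd m t" using nd_eq_iff[of t m "\<sigma> - t"] l tau_sym by simp
  then show "nd m t \<in> stem R \<and> tau t \<le> - m" using t refl_nd by (auto simp: stem_def rverts_R)
qed

lemma stem_cases:
  assumes "v \<in> stem R"
  obtains m t where "v = nd m t" "low m t (\<sigma> - t)"
proof -
  obtain m t where "v = nd m t" "tau t \<le> - m" using assms by (auto simp: stem_def rverts_R)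
  then show thesis using that assms stem_nd by blast
qed

lemma low_sym_hull:
  assumes "low m t (\<sigma> - t)" "min t (\<sigma> - t) \<le> s" "s \<le> max t (\<sigma> - t)"
  shows "low m s t"
  using assms unfolding low_def by auto

text \<open>The axis sits at \<open>\<sigma> / 2\<close>, which may be a half-integer; in that case
  \<open>c\<close> and \<open>c + 1\<close> are mirror images of each other.\<close>

definition c :: int where
  "c = \<sigma> div 2"

lemma c: "\<sigma> - c = c \<or> \<sigma> - c = c + 1"
  by (auto simp: c_def)

lemma low_c: "tau c \<le> - m \<Longrightarrow> low m c (\<sigma> - c)"
  unfolding low_def
proof (intro allI impI)
  fix u assume "tau c \<le> - m" "min c (\<sigma> - c) \<le> u" "u \<le> max c (\<sigma> - c)"
  moreover from this have "u = c \<or> u = \<sigma> - c" using c by linarith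
  ultimately show "tau u \<le> - m" using tau_sym[of c] by auto
qed

lemma nd_c_stem: "nd (- tau c) c \<in> stem R"
proof -
  have "low (- tau c) c (\<sigma> - c)" by (rule low_c) simp
  then show ?thesis using stem_nd by blast
qed

lemma stem_contains_c: "low m t (\<sigma> - t) \<Longrightarrow> low m c t"
  by (rule low_sym_hull) (auto simp: c_def)

sublocale sym_root R par lev g0
proof
  fix u v
  show "(u, v) \<in> rup R \<longleftrightarrow> u \<in> rverts R \<and> v = par u" by (rule rup_R)
next
  fix v assume v: "v \<in> rverts R"
  then obtain m t where mt: "v = nd m t" "tau t \<le> - m" by (auto simp: rverts_R)
  have t1: "tau t \<le> - (m - 1)" using mt by simp
  have ts: "tau (\<sigma> - t) \<le> - m" using mt tau_sym by simp
  show "par v \<in> rverts R" unfolding mt(1) par_nd[OF mt(2)] rverts_R using t1 by blast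
  show "rgrade R v = g0 + 2 * of_int (lev v)" using mt rgrade_nd by simp
  show "lev (par v) = lev v + 1" using mt par_nd by simp
  show "rrefl R v \<in> rverts R" unfolding mt(1) refl_nd[OF mt(2)] rverts_R using ts by blast
  show "rrefl R (rrefl R v) = v" unfolding mt(1) refl_nd[OF mt(2)] refl_nd[OF ts] by simp
  show "lev (rrefl R v) = lev v" using mt refl_nd by simp
  show "rrefl R (par v) = par (rrefl R v)"
    unfolding mt(1) refl_nd[OF mt(2)] par_nd[OF mt(2)] par_nd[OF ts] by (rule refl_nd[OF t1])
  show "\<exists>d. (par ^^ d) v \<in> stem R"
  proof -
    \<comment> \<open>Once the level has climbed to the largest value of \<open>tau\<close> between
      \<open>t\<close> and its mirror image, the two lie in one run, which is then
      symmetric.\<close>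
    define B where "B = Max (tau ` {min t (\<sigma> - t)..max t (\<sigma> - t)})"
    have B: "tau u \<le> B" if "min t (\<sigma> - t) \<le> u" "u \<le> max t (\<sigma> - t)" for u
      unfolding B_def using that by (intro Max_ge) auto
    have "low (m - int (nat (B + m))) t (\<sigma> - t)"
      unfolding low_def using B mt(2) by fastforce
    then have "(par ^^ nat (B + m)) (nd m t) \<in> stem R" unfolding par_pow_nd[OF mt(2)] using stem_nd by blast
    then show ?thesis using mt by blast
  qed
next
  fix u v assume uv: "u \<in> stem R" "v \<in> stem R" "lev u = lev v"
  obtain m t where u: "u = nd m t" "low m t (\<sigma> - t)" using stem_cases[OF uv(1)] .
  obtain m' s where v: "v = nd m' s" "low m' s (\<sigma> - s)" using stem_cases[OF uv(2)] .
  have m: "m' = m" using uv u v by simp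
  have "nd m c = nd m t" "nd m c = nd m s"
    using stem_contains_c[OF u(2)] stem_contains_c[OF v(2)] nd_eq_iff unfolding m
    by (auto simp: low_def)
  then show "u = v" using u v m by simp
next
  show "\<exists>r \<in> stem R. \<forall>s \<in> stem R. lev r \<le> lev s"
  proof (intro bexI ballI)
    show "nd (- tau c) c \<in> stem R" by (rule nd_c_stem)
    fix s assume "s \<in> stem R"
    then obtain m t where s: "s = nd m t" "low m t (\<sigma> - t)" by (rule stem_cases)
    then have "tau c \<le> - m" using stem_contains_c[OF s(2)] by (auto simp: low_def)
    then show "lev (nd (- tau c) c) \<le> lev s" using s by simp
  qed
qed

lemma bot_eq: "stem_bottom R = nd (- tau c) c"
proof (rule stem_unique[OF bot_stem])
  show "nd (- tau c) c \<in> stem R" by (rule nd_c_stem)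
  obtain m t where b: "stem_bottom R = nd m t" "low m t (\<sigma> - t)" using stem_cases[OF bot_stem] .
  then have "tau c \<le> - m" using stem_contains_c[OF b(2)] by (auto simp: low_def)
  then show "lev (stem_bottom R) = lev (nd (- tau c) c)" using bot_least[OF nd_c_stem] b by simp
qed

lemma stem_vertex_eq: "stem_vertex R j = nd (- tau c - int j) c"
  unfolding sv_eq bot_eq by (rule par_pow_nd) simp

lemma root_below_nd:
  assumes t: "tau t \<le> - m"
  shows "nd m t \<in> root_below R j \<longleftrightarrow> - m \<le> tau c + int j \<and> low (- tau c - int j) t c"
proof -
  have v: "nd m t \<in> rverts R" using t by (auto simp: rverts_R)
  have "nd m t \<in> root_below R j \<longleftrightarrow> (\<exists>d. nd (m - int d) t = nd (- tau c - int j) c)"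
    using v up_path_eq[OF v] par_pow_nd[OF t] unfolding root_below_def stem_vertex_eq
    by (auto simp: image_iff) metis
  also have "\<dots> \<longleftrightarrow> (\<exists>d. m - int d = - tau c - int j \<and> nd (- tau c - int j) t = nd (- tau c - int j) c)"
    by (metis fst_conv nd_def)
  also have "\<dots> \<longleftrightarrow> - m \<le> tau c + int j \<and> nd (- tau c - int j) t = nd (- tau c - int j) c"
    by (auto intro!: exI[of _ "nat (m + tau c + int j)"])
  also have "\<dots> \<longleftrightarrow> - m \<le> tau c + int j \<and> low (- tau c - int j) t c"
    using nd_eq_iff[of t "- tau c - int j" c] t by auto
  finally show ?thesis .
qed

end

text \<open>If \<open>t\<close> lies outside the window, the interval from \<open>t\<close> to
  \<open>c\<close> and its mirror image together cover the window, so \<open>tau\<close> is already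
  low on all of it. Hence a lower point inside the window can replace \<open>t\<close>.\<close>

lemma (in star) below_window:
  assumes \<alpha>: "1 \<le> \<alpha>" and cover: "\<And>t. \<exists>s. \<bar>2 * s - \<sigma>\<bar> \<le> \<alpha> \<and> tau s \<le> tau t"
    and t: "tau t \<le> - m" and low: "low m' t c"
  shows "\<exists>s. \<bar>2 * s - \<sigma>\<bar> \<le> \<alpha> \<and> tau s \<le> - m \<and> low m' s c"
proof (cases "\<bar>2 * t - \<sigma>\<bar> \<le> \<alpha>")
  case True
  then show ?thesis using t low by blast
next
  case False
  obtain s where s: "\<bar>2 * s - \<sigma>\<bar> \<le> \<alpha>" "tau s \<le> tau t" using cover by blast
  have "tau u \<le> - m'" if u: "min s c \<le> u" "u \<le> max s c" for u
  proof (cases "min t c \<le> u \<and> u \<le> max t c")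
    case True
    then show ?thesis using low by (simp add: low_def)
  next
    case nu: False
    have "min t c \<le> \<sigma> - u \<and> \<sigma> - u \<le> max t c" using u nu s(1) False c by linarith
    then have "tau (\<sigma> - u) \<le> - m'" using low by (simp add: low_def)
    then show ?thesis by (simp add: tau_sym)
  qed
  then have "low m' s c" by (simp add: low_def)
  then show ?thesis using s t by auto
qed

text \<open>\<open>\<delta>\<close> aligns the two axes. \<open>\<mu>\<close> absorbs the difference
  of the normalisations, since what has to agree is the grading \<open>g0 + 2 * tau\<close> and not
  \<open>tau\<close> itself.\<close>

locale two_stars = A: star n e xs k + B: star n' e' xs' k'
  for n e xs k n' e' xs' k' +
  fixes \<alpha> \<delta> \<mu> :: int
  assumes \<alpha>: "1 \<le> \<alpha>"
    and shift: "B.\<sigma> = A.\<sigma> + 2 * \<delta>"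
    and g0_shift: "B.g0 = A.g0 + 2 * of_int \<mu>"
    and window: "\<bar>2 * t - A.\<sigma>\<bar> \<le> \<alpha> \<Longrightarrow> A.tau t = B.tau (t + \<delta>) + \<mu>"
    and cover: "\<exists>s. \<bar>2 * s - A.\<sigma>\<bar> \<le> \<alpha> \<and> A.tau s \<le> A.tau t"
    and cover': "\<exists>s. \<bar>2 * s - B.\<sigma>\<bar> \<le> \<alpha> \<and> B.tau s \<le> B.tau t"
begin

lemma flipped: "two_stars n' e' xs' k' n e xs k \<alpha> (- \<delta>) (- \<mu>)"
proof unfold_locales
  fix t assume "\<bar>2 * t - B.\<sigma>\<bar> \<le> \<alpha>"
  then have "\<bar>2 * (t - \<delta>) - A.\<sigma>\<bar> \<le> \<alpha>" using shift by simp
  from window[OF this] show "B.tau t = A.tau (t + - \<delta>) + - \<mu>" by simp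
qed (use \<alpha> shift g0_shift cover cover' in auto)

lemma c_shift: "B.c = A.c + \<delta>"
  using shift by (simp add: A.c_def B.c_def)

lemma c_window: "\<bar>2 * A.c - A.\<sigma>\<bar> \<le> \<alpha>"
  using A.c \<alpha> by linarith

text \<open>The window is an interval that contains both \<open>s\<close> and the axis, so the whole
  run joining them carries over to the other plumbing.\<close>

lemma below:
  assumes v: "v \<in> root_below A.R j"
  shows "\<exists>v' \<in> root_below B.R j. rgrade B.R v' \<le> rgrade A.R v"
proof -
  obtain m t where mt: "v = A.nd m t" "A.tau t \<le> - m"
    using v A.root_below_iff by (auto simp: A.rverts_R)
  then have le: "- m \<le> A.tau A.c + int j" and low: "A.low (- A.tau A.c - int j) t A.c"
    using v A.root_below_nd by auto
  obtain s where s: "\<bar>2 * s - A.\<sigma>\<bar> \<le> \<alpha>" "A.tau s \<le> - m" "A.low (- A.tau A.c - int j) s A.c"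
    using A.below_window[OF \<alpha> cover mt(2) low] by blast
  have tc: "A.tau A.c = B.tau B.c + \<mu>" unfolding c_shift by (rule window[OF c_window])
  have ts: "B.tau (s + \<delta>) \<le> - (m + \<mu>)" using window[OF s(1)] s(2) by simp
  have "B.low (- B.tau B.c - int j) (s + \<delta>) B.c"
    unfolding B.low_def
  proof (intro allI impI)
    fix u assume u: "min (s + \<delta>) B.c \<le> u" "u \<le> max (s + \<delta>) B.c"
    have b: "- \<alpha> \<le> 2 * s - A.\<sigma>" "2 * s - A.\<sigma> \<le> \<alpha>"
        "- \<alpha> \<le> 2 * A.c - A.\<sigma>" "2 * A.c - A.\<sigma> \<le> \<alpha>"
      using s(1) c_window by auto
    have "s \<le> u - \<delta> \<or> A.c \<le> u - \<delta>" using u(1) c_shift by (auto simp: min_def split: if_splits)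
    then have "- \<alpha> \<le> 2 * (u - \<delta>) - A.\<sigma>"
    proof
      assume "s \<le> u - \<delta>"
      then show ?thesis using b(1) by simp
    next
      assume "A.c \<le> u - \<delta>"
      then show ?thesis using b(3) by simp
    qed
    moreover have "u - \<delta> \<le> s \<or> u - \<delta> \<le> A.c" using u(2) c_shift by (auto simp: max_def split: if_splits)
    then have "2 * (u - \<delta>) - A.\<sigma> \<le> \<alpha>"
    proof
      assume "u - \<delta> \<le> s"
      then show ?thesis using b(2) by simp
    next
      assume "u - \<delta> \<le> A.c"
      then show ?thesis using b(4) by simp
    qed
    ultimately have "\<bar>2 * (u - \<delta>) - A.\<sigma>\<bar> \<le> \<alpha>" by (simp add: abs_le_iff)
    from window[OF this] have "B.tau u = A.tau (u - \<delta>) - \<mu>" by simp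
    also have "A.tau (u - \<delta>) \<le> - (- A.tau A.c - int j)"
      using s(3) u c_shift unfolding A.low_def by (elim allE[of _ "u - \<delta>"]) linarith
    finally show "B.tau u \<le> - (- B.tau B.c - int j)" using tc by simp
  qed
  then have "B.nd (m + \<mu>) (s + \<delta>) \<in> root_below B.R j"
    using B.root_below_nd[OF ts] le tc by simp
  moreover have "rgrade B.R (B.nd (m + \<mu>) (s + \<delta>)) = rgrade A.R v"
    unfolding mt(1) A.rgrade_nd B.rgrade_nd g0_shift by simp
  ultimately show ?thesis by (intro bexI) auto
qed

lemma bottom: "rgrade A.R (stem_bottom A.R) = rgrade B.R (stem_bottom B.R)"
proof -
  have "A.tau A.c = B.tau B.c + \<mu>" unfolding c_shift by (rule window[OF c_window])
  then show ?thesis unfolding A.bot_eq B.bot_eq A.rgrade_nd B.rgrade_nd g0_shift by simp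
qed

theorem star_subroots_iso:
  assumes "tip_choice A.R T" "tip_choice B.R T'"
  shows "root_iso (max_monotone_subroot A.R T) (max_monotone_subroot B.R T')"
proof -
  interpret tipped_root A.R A.par A.lev A.g0 T by unfold_locales fact
  interpret B': tipped_root B.R B.par B.lev B.g0 T' by unfold_locales fact
  interpret two_roots A.R A.par A.lev A.g0 T B.R B.par B.lev B.g0 T'
    by unfold_locales (use below two_stars.below[OF flipped] bottom in auto)
  show ?thesis by (rule monotone_subroots_iso)
qed

end

section \<open>Continued fractions and matrices of determinant one\<close>

lemma cf_act_linear:
  "cf_act xs (p * u + q * u', p * v + q * v') =
    (p * fst (cf_act xs (u, v)) + q * fst (cf_act xs (u', v')),
     p * snd (cf_act xs (u, v)) + q * snd (cf_act xs (u', v')))"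
  by (induction xs) (auto simp: algebra_simps)

lemma cf_act_append: "cf_act (xs @ ys) z = cf_act xs (cf_act ys z)"
  by (induction xs) auto

lemma cf_act_det:
  "fst (cf_act xs (1, 0)) * snd (cf_act xs (0, 1)) - snd (cf_act xs (1, 0)) * fst (cf_act xs (0, 1)) = 1"
  by (induction xs) (auto simp: algebra_simps)

lemma cf_act_bounds:
  assumes "\<forall>x \<in> set xs. 2 \<le> x"
  shows "0 \<le> snd (cf_act xs (1, 0)) \<and> snd (cf_act xs (1, 0)) < fst (cf_act xs (1, 0)) \<and>
    fst (cf_act xs (0, 1)) \<le> 0 \<and> fst (cf_act xs (0, 1)) < snd (cf_act xs (0, 1))"
  using assms
proof (induction xs)
  case (Cons x xs)
  let ?p = "fst (cf_act xs (1, 0))" and ?q = "snd (cf_act xs (1, 0))"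
  let ?r = "fst (cf_act xs (0, 1))" and ?s = "snd (cf_act xs (0, 1))"
  have IH: "0 \<le> ?q" "?q < ?p" "?r \<le> 0" "?r < ?s" and x: "2 \<le> x" using Cons by auto
  have "2 * ?p \<le> x * ?p" using IH x by (intro mult_right_mono) auto
  moreover have "x * ?r \<le> 2 * ?r" using IH x by (intro mult_right_mono_neg) auto
  ultimately show ?case using IH unfolding cf_act.simps fst_conv snd_conv by linarith
qed simp

lemma neg_cfrac_cf_act:
  assumes "xs \<noteq> []" "\<forall>x \<in> set xs. 2 \<le> x"
  shows "neg_cfrac xs = of_int (fst (cf_act xs (1, 0))) / of_int (snd (cf_act xs (1, 0)))"
  using assms
proof (induction xs rule: neg_cfrac.induct)
  case (3 x y ys)
  let ?p = "fst (cf_act (y # ys) (1, 0))" and ?q = "snd (cf_act (y # ys) (1, 0))"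
  have "0 \<le> ?q" "?q < ?p" using cf_act_bounds[of "y # ys"] 3 by auto
  then have p: "?p > 0" by linarith
  have IH: "neg_cfrac (y # ys) = of_int ?p / of_int ?q" using 3 by (intro "3.IH") auto
  have "neg_cfrac (x # y # ys) = of_int x - of_int ?q / of_int ?p"
    unfolding neg_cfrac.simps IH by simp
  also have "\<dots> = of_int (x * ?p - ?q) / of_int ?p"
  proof -
    have "of_int x - of_int q / of_int p = (of_int (x * p - q) / of_int p :: rat)" if "0 < p" for p q
      using that by (simp add: diff_divide_distrib)
    from this[OF p] show ?thesis .
  qed
  finally show ?case by simp
qed auto

text \<open>The determinant makes the components of \<open>cf_act xs (1, 0)\<close> coprime, so they
  are numerator and denominator of the reduced fraction.\<close>

lemma cf_act_is_neg_cfrac: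
  assumes f: "is_neg_cfrac a b xs" and b: "1 \<le> b" "b < a" and cop: "coprime a b"
  shows "cf_act xs (1, 0) = (a, b)"
proof -
  let ?p = "fst (cf_act xs (1, 0))" and ?q = "snd (cf_act xs (1, 0))"
  have xs: "xs \<noteq> []" "\<forall>x \<in> set xs. 2 \<le> x" using f by (auto simp: is_neg_cfrac_def)
  have "(of_int a / of_int b :: rat) = of_int ?p / of_int ?q"
    using f neg_cfrac_cf_act[OF xs] by (simp add: is_neg_cfrac_def)
  moreover have q: "0 \<le> ?q" "?q < ?p" using cf_act_bounds[OF xs(2)] by auto
  moreover have "?q \<noteq> 0"
  proof
    assume q0: "?q = 0"
    have "neg_cfrac xs = 0" using neg_cfrac_cf_act[OF xs] q0 by simp
    then show False using neg_cfrac_gt_1[OF xs] by simp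
  qed
  ultimately have "(of_int (a * ?q) :: rat) = of_int (?p * b)"
    using b by (simp add: field_simps)
  then have e: "a * ?q = ?p * b" by (simp only: of_int_eq_iff)
  have "coprime ?p ?q"
    using cf_act_det[of xs] by (intro coprimeI) (metis dvd_diff dvd_mult2)
  then have "\<bar>a\<bar> = \<bar>?p\<bar> \<and> \<bar>?q\<bar> = \<bar>b\<bar>"
    using coprime_crossproduct_int[of a b ?p ?q] cop e abs_mult[of a ?q] abs_mult[of ?p b]
    by (simp add: coprime_commute)
  then have "?p = a" "?q = b" using b q by auto
  then show ?thesis by (metis prod.collapse)
qed

text \<open>If \<open>\<alpha> / B\<close> is a neighbour of \<open>a / b\<close>, then \<open>\<alpha> / B = [xs, k]\<close>, hence
  \<open>(a + 2 \<alpha>) / (b + 2 B) = [xs, k + 1 / 2] = [xs, k + 1, 2]\<close>.\<close>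

lemma neg_cfrac_extension:
  assumes f: "is_neg_cfrac a b xs" and b: "1 \<le> b" "b < a" and u: "a * B - b * \<alpha> = 1" and \<alpha>: "0 < \<alpha>"
  obtains k where "1 \<le> k" "cf_act xs (1, 0) = (a, b)" "cf_act xs (k, 1) = (\<alpha>, B)"
    "is_neg_cfrac (a + 2 * \<alpha>) (b + 2 * B) (xs @ [k + 1, 2])"
proof -
  have xs: "xs \<noteq> []" "\<forall>x \<in> set xs. 2 \<le> x" using f by (auto simp: is_neg_cfrac_def)
  have cop: "coprime a b" using u by (intro coprimeI) (metis dvd_diff dvd_mult2)
  have ab: "cf_act xs (1, 0) = (a, b)" by (rule cf_act_is_neg_cfrac[OF f b cop])
  obtain P Q where PQ: "cf_act xs (0, 1) = (P, Q)" by fastforce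
  have det: "a * Q - b * P = 1" using cf_act_det[of xs] ab PQ by simp
  have P: "P \<le> 0" using cf_act_bounds[OF xs(2)] PQ by simp
  \<comment> \<open>Both \<open>(\<alpha>, B)\<close> and the second column \<open>(P, Q)\<close>
    complete \<open>(a, b)\<close> to a matrix of determinant 1, so they differ by a multiple
    \<open>k\<close> of \<open>(a, b)\<close>.\<close>
  have eq: "a * (B - Q) = b * (\<alpha> - P)" using u det by (simp add: algebra_simps)
  then have "a dvd b * (\<alpha> - P)" by (metis dvd_triv_left)
  then have "a dvd \<alpha> - P" using cop by (simp add: coprime_dvd_mult_right_iff)
  then obtain k where k: "\<alpha> - P = a * k" by blast
  then have "a * (B - Q) = a * (b * k)" using eq by (simp add: algebra_simps)
  then have kB: "B - Q = b * k" using b by simp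
  \<comment> \<open>The sign matters: \<open>k + 1\<close> becomes a decoration and has to be at
    least 2.\<close>
  have "0 < a * k" using k \<alpha> P by linarith
  then have k1: "1 \<le> k" using b by (simp add: zero_less_mult_iff)
  have kk: "cf_act xs (k, 1) = (\<alpha>, B)"
    using cf_act_linear[of xs k 1 1 0 0 1] ab PQ k kB by (simp add: algebra_simps)
  \<comment> \<open>\<open>[k + 1, 2]\<close> sends \<open>(1, 0)\<close> to
    \<open>(2 k + 1, 2)\<close>, which is \<open>(1, 0)\<close> plus twice
    \<open>(k, 1)\<close>.\<close>
  have "cf_act (xs @ [k + 1, 2]) (1, 0) = cf_act xs (2 * k + 1, 2)"
    by (simp add: cf_act_append algebra_simps)
  also have "\<dots> = (a + 2 * \<alpha>, b + 2 * B)"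
    using cf_act_linear[of xs 1 1 2 k 0 1] ab kk by (simp add: algebra_simps)
  finally have e: "cf_act (xs @ [k + 1, 2]) (1, 0) = (a + 2 * \<alpha>, b + 2 * B)" .
  have "is_neg_cfrac (a + 2 * \<alpha>) (b + 2 * B) (xs @ [k + 1, 2])"
    unfolding is_neg_cfrac_def
  proof (intro conjI)
    show all: "\<forall>x \<in> set (xs @ [k + 1, 2]). 2 \<le> x" using xs k1 by auto
    show "of_int (a + 2 * \<alpha>) / of_int (b + 2 * B) = neg_cfrac (xs @ [k + 1, 2])"
      using neg_cfrac_cf_act[OF _ all] e by simp
  qed simp
  then show thesis using that k1 ab kk by blast
qed

lemma leg_expansion_eq:
  assumes "1 \<le> q" "q < p" "is_neg_cfrac p q xs"
  shows "leg_expansion p q = xs"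
  unfolding leg_expansion_def by (rule the1_equality[OF neg_cfrac_ex1]) fact+

section \<open>Unimodularity of the lattice\<close>

lemma chain_integral:
  fixes f :: "nat \<Rightarrow> real"
  assumes "\<forall>j < length xs. f j - of_int (xs ! j) * f (Suc j) + f (Suc (Suc j)) \<in> \<int>"
    and "f (Suc (length xs)) = 0" and "cf_act xs (1, 0) = (p, q)"
  shows "of_int p * f 1 - of_int q * f 0 \<in> \<int>"
  using assms
proof (induction xs arbitrary: f p q)
  case (Cons x xs)
  obtain p' q' where pq: "cf_act xs (1, 0) = (p', q')" by fastforce
  have p: "p = x * p' - q'" "q = p'" using Cons.prems(3) pq by auto
  have "of_int p' * f 2 - of_int q' * f 1 \<in> \<int>"
    using Cons.IH[of "\<lambda>j. f (Suc j)", OF _ _ pq] Cons.prems(1,2) by (force simp: numeral_2_eq_2)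
  moreover have "f 0 - of_int x * f 1 + f 2 \<in> \<int>"
    using Cons.prems(1) by (auto simp: numeral_2_eq_2 dest!: spec[of _ 0])
  \<comment> \<open>Eliminating \<open>f 2\<close> with the first row of the chain reproduces the
    recursion of \<open>cf_act\<close>.\<close>
  ultimately have "of_int p' * f 2 - of_int q' * f 1 - of_int p' * (f 0 - of_int x * f 1 + f 2) \<in> \<int>"
    by (rule Ints_diff[OF _ Ints_mult[OF Ints_of_int]])
  also have "of_int p' * f 2 - of_int q' * f 1 - of_int p' * (f 0 - of_int x * f 1 + f 2) =
      of_int p * f 1 - of_int q * f 0"
    by (simp add: p algebra_simps)
  finally show ?case .
qed auto

lemma chain_integral_all:
  fixes f :: "nat \<Rightarrow> real"
  assumes "\<forall>j < length xs. f j - of_int (xs ! j) * f (Suc j) + f (Suc (Suc j)) \<in> \<int>"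
    and "f 0 \<in> \<int>" "f 1 \<in> \<int>"
  shows "j \<le> Suc (length xs) \<Longrightarrow> f j \<in> \<int>"
proof (induction j rule: less_induct)
  case (less j)
  show ?case
  proof (cases "j < 2")
    case True
    then have "j = 0 \<or> j = 1" by linarith
    then show ?thesis using assms by auto
  next
    case False
    then obtain i where i: "j = Suc (Suc i)" by (metis Suc_pred' add_2_eq_Suc le_add_diff_inverse not_less)
    have "f i \<in> \<int>" "f (Suc i) \<in> \<int>" using less i by auto
    moreover have "f i - of_int (xs ! i) * f (Suc i) + f (Suc (Suc i)) \<in> \<int>"
      using assms(1) less.prems i by auto
    ultimately have "(f i - of_int (xs ! i) * f (Suc i) + f (Suc (Suc i))) - f i +
        of_int (xs ! i) * f (Suc i) \<in> \<int>"
      by (intro Ints_add Ints_diff Ints_mult) auto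
    then show ?thesis by (simp add: i)
  qed
qed

text \<open>The Seifert equation says that the determinant is a unit. The legs are eliminated down
  to their first vertices; the equation then yields the centre, congruences modulo the
  \<open>a i\<close> yield the first vertices, and the rows propagate integrality outwards.\<close>

lemma star_unimodular:
  fixes a b :: "nat \<Rightarrow> int"
  assumes y: "star_supported n xs y"
    and int: "\<forall>u \<in> pverts (star_plumbing n e xs). star_lap n e xs y u \<in> \<int>"
    and cf: "\<forall>i \<in> {1..n}. cf_act (xs i) (1, 0) = (a i, b i)"
    and eq: "(\<Sum>i=1..n. b i * (\<Prod>j \<in> {1..n} - {i}. a j)) = - 1 - e * (\<Prod>j=1..n. a j)"
  shows "y \<in> lattice (star_plumbing n e xs)"
proof -
  define P where "P i = (\<Prod>j \<in> {1..n} - {i}. a j)" for i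
  define A where "A = (\<Prod>j=1..n. a j)"
  have PA: "A = a i * P i" if "i \<in> {1..n}" for i
    unfolding A_def P_def using that by (intro prod.remove) auto
  let ?f = "\<lambda>i. case_nat (y Center) (\<lambda>j. y (Leg i j))"
  have row: "\<forall>j < length (xs i). ?f i j - of_int (xs i ! j) * ?f i (Suc j) + ?f i (Suc (Suc j)) \<in> \<int>"
    if "i \<in> {1..n}" for i
  proof (intro allI impI)
    fix j assume "j < length (xs i)"
    then have "Leg i j \<in> pverts (star_plumbing n e xs)" using that by (auto simp: star_pverts)
    then have "star_lap n e xs y (Leg i j) \<in> \<int>" using int by blast
    then show "?f i j - of_int (xs i ! j) * ?f i (Suc j) + ?f i (Suc (Suc j)) \<in> \<int>" by simp
  qed
  have z: "of_int (a i) * y (Leg i 0) - of_int (b i) * y Center \<in> \<int>" if i: "i \<in> {1..n}" for i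
    using chain_integral[OF row[OF i]] cf i y by (force simp: star_supported_def)
  have lc: "star_lap n e xs y Center \<in> \<int>" using int by (auto simp: star_pverts simp del: star_lap.simps)
  \<comment> \<open>With the cofactors as weights the first vertices enter only through the sum in
    the central row, and the Seifert equation leaves \<open>y Center\<close> with coefficient
    1.\<close>
  have "(\<Sum>i=1..n. of_int (P i) * (of_int (a i) * y (Leg i 0) - of_int (b i) * y Center)) =
      (\<Sum>i=1..n. of_int A * y (Leg i 0) - of_int (b i * P i) * y Center)"
    by (rule sum.cong) (auto simp: PA algebra_simps)
  also have "\<dots> = of_int A * (\<Sum>i=1..n. y (Leg i 0)) - of_int (\<Sum>i=1..n. b i * P i) * y Center"
    by (simp add: sum_subtractf sum_distrib_left sum_distrib_right)
  also have "\<dots> = of_int A * star_lap n e xs y Center + y Center"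
    unfolding P_def eq A_def[symmetric] by (simp add: algebra_simps)
  finally have "y Center = (\<Sum>i=1..n. of_int (P i) * (of_int (a i) * y (Leg i 0) - of_int (b i) * y Center)) -
      of_int A * star_lap n e xs y Center" by simp
  also have "\<dots> \<in> \<int>" by (rule Ints_diff) (intro Ints_sum Ints_mult Ints_of_int z lc; simp)+
  finally have yC: "y Center \<in> \<int>" .
  have w: "of_int (a i) * y (Leg i 0) \<in> \<int>" if i: "i \<in> {1..n}" for i
  proof -
    have "(of_int (a i) * y (Leg i 0) - of_int (b i) * y Center) + of_int (b i) * y Center \<in> \<int>"
      using z[OF i] yC by (intro Ints_add Ints_mult) auto
    then show ?thesis by simp
  qed
  have "star_lap n e xs y Center - of_int e * y Center \<in> \<int>" using lc yC by (intro Ints_diff Ints_mult) auto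
  then have s: "(\<Sum>i=1..n. y (Leg i 0)) \<in> \<int>" by simp
  have y0: "y (Leg i 0) \<in> \<int>" if i: "i \<in> {1..n}" for i
  proof -
    \<comment> \<open>\<open>P i\<close> contains the factor \<open>a l\<close> of every other leg,
      which clears the denominator of \<open>y (Leg l 0)\<close>.\<close>
    have Pl: "of_int (P i) * y (Leg l 0) \<in> \<int>" if l: "l \<in> {1..n} - {i}" for l
    proof -
      have "P i = a l * (\<Prod>j \<in> {1..n} - {i} - {l}. a j)"
        unfolding P_def using l by (intro prod.remove) auto
      then have "of_int (P i) * y (Leg l 0) =
          of_int (\<Prod>j \<in> {1..n} - {i} - {l}. a j) * (of_int (a l) * y (Leg l 0))"
        by simp
      also have "\<dots> \<in> \<int>" by (rule Ints_mult[OF Ints_of_int w]) (use l in simp)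
      finally show ?thesis .
    qed
    have "(\<Sum>l=1..n. y (Leg l 0)) = y (Leg i 0) + (\<Sum>l \<in> {1..n} - {i}. y (Leg l 0))"
      using i by (intro sum.remove) auto
    then have "of_int (P i) * y (Leg i 0) =
        of_int (P i) * (\<Sum>l=1..n. y (Leg l 0)) - (\<Sum>l \<in> {1..n} - {i}. of_int (P i) * y (Leg l 0))"
      by (simp add: algebra_simps sum_distrib_left)
    also have "\<dots> \<in> \<int>"
      by (rule Ints_diff[OF Ints_mult[OF Ints_of_int s] Ints_sum]) (rule Pl)
    finally have Pi: "of_int (P i) * y (Leg i 0) \<in> \<int>" .
    \<comment> \<open>\<open>P i\<close> is invertible modulo \<open>a i\<close>, so integrality of
      the multiples by \<open>a i\<close> and by \<open>P i\<close> combines to integrality of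
      \<open>y (Leg i 0)\<close> itself.\<close>
    have "[b i * P i = - 1 - e * A] (mod a i)"
      using sum_cofactor_cong[OF i, of b a] eq unfolding P_def A_def by (metis cong_sym)
    then have "a i dvd b i * P i - (- 1 - e * A)" by (simp add: cong_iff_dvd_diff)
    moreover have "a i dvd e * A" using PA[OF i] by simp
    ultimately have "a i dvd (b i * P i - (- 1 - e * A)) - e * A" by (rule dvd_diff)
    also have "(b i * P i - (- 1 - e * A)) - e * A = b i * P i + 1" by simp
    finally have "a i dvd b i * P i + 1" .
    then obtain r where "b i * P i + 1 = a i * r" by blast
    then have "(of_int (a i * r) :: real) = of_int (b i * P i + 1)" by simp
    then have r: "of_int (a i) * of_int r = of_int (b i) * of_int (P i) + (1 :: real)" by simp
    have "y (Leg i 0) = (of_int (b i) * of_int (P i) + 1) * y (Leg i 0) -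
        of_int (b i) * (of_int (P i) * y (Leg i 0))" by (simp add: algebra_simps)
    also have "\<dots> = of_int r * (of_int (a i) * y (Leg i 0)) - of_int (b i) * (of_int (P i) * y (Leg i 0))"
      unfolding r[symmetric] by simp
    also have "\<dots> \<in> \<int>"
      by (rule Ints_diff[OF Ints_mult[OF Ints_of_int w[OF i]] Ints_mult[OF Ints_of_int Pi]])
    finally show ?thesis .
  qed
  have all: "y (Leg i j) \<in> \<int>" if i: "i \<in> {1..n}" and j: "j < length (xs i)" for i j
    using chain_integral_all[OF row[OF i], of "Suc j"] yC y0[OF i] j by simp
  show ?thesis
    unfolding lattice_def
  proof (intro CollectI conjI)
    show "\<forall>v \<in> pverts (star_plumbing n e xs). y v \<in> \<int>" using all yC by (auto simp: star_pverts)
    show "\<forall>v. v \<notin> pverts (star_plumbing n e xs) \<longrightarrow> y v = 0"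
      using y star_supported_iff by blast
  qed
qed

lemma char_lap_Ints:
  assumes ne: "\<And>i. i \<in> {1..n} \<Longrightarrow> xs i \<noteq> []" and k: "characteristic (star_plumbing n e xs) k"
    and u: "u \<in> pverts (star_plumbing n e xs)"
  shows "star_lap n e xs k u \<in> \<int>"
proof -
  obtain j :: int where "star_lap n e xs k u = of_int (pdec (star_plumbing n e xs) u) + 2 * of_int j"
    using char_basis[OF ne k u] by blast
  also have "\<dots> = of_int (pdec (star_plumbing n e xs) u + 2 * j)" by simp
  finally show ?thesis by simp
qed

section \<open>Adding two vertices to a leg\<close>

lemma star_lap_linear:
  "star_lap n e xs (\<lambda>v. p * x v + q * y v) u = p * star_lap n e xs x u + q * star_lap n e xs y u"
proof (cases u)
  case Center
  then show ?thesis by (simp add: sum.distrib sum_distrib_left algebra_simps)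
next
  case (Leg i j)
  then show ?thesis by (cases j) (simp_all add: algebra_simps)
qed

lemma star_lap_lattice_Ints:
  assumes "y \<in> lattice (star_plumbing n e xs)"
  shows "star_lap n e xs y u \<in> \<int>"
proof (cases u)
  case Center
  then show ?thesis using lattice_Ints[OF assms] by (auto intro!: Ints_add Ints_mult Ints_sum)
next
  case (Leg i j)
  then show ?thesis
    using lattice_Ints[OF assms] by (cases j) (auto intro!: Ints_add Ints_diff Ints_mult)
qed

lemma leg_slope_period_mult:
  assumes "good_leg ds" "cf_act (map fst ds) (1, 0) = (p, q)" "0 \<le> j"
  shows "leg_slope ds (t + j * p) = leg_slope ds t + j * q"
proof -
  have "leg_slope ds (t + int l * p) = leg_slope ds t + int l * q" for l
  proof (induction l)
    case (Suc l)
    have "leg_slope ds (t + int (Suc l) * p) = leg_slope ds ((t + int l * p) + p)"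
      by (simp add: algebra_simps)
    also have "\<dots> = leg_slope ds t + int (Suc l) * q"
      unfolding leg_slope_period[OF assms(1,2)] Suc by (simp add: algebra_simps)
    finally show ?case .
  qed simp
  from this[of "nat j"] show ?thesis using assms(3) by simp
qed

definition cong2 :: "real \<Rightarrow> int \<Rightarrow> bool" where
  "cong2 r d \<longleftrightarrow> (\<exists>j :: int. r = of_int (d + 2 * j))"

lemma cong2_half_diff: "cong2 r d \<Longrightarrow> cong2 s d \<Longrightarrow> (1 / 2) * r + (- 1 / 2) * s \<in> \<int>"
proof -
  assume "cong2 r d" "cong2 s d"
  then obtain i j :: int where "r = of_int (d + 2 * i)" "s = of_int (d + 2 * j)"
    by (auto simp: cong2_def)
  then have "(1 / 2) * r + (- 1 / 2) * s = of_int (i - j)" by (simp add: add_divide_distrib)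
  then show ?thesis by simp
qed

lemma cong2_add_double: "cong2 r d \<Longrightarrow> s \<in> \<int> \<Longrightarrow> cong2 (2 * s + r) d"
proof -
  assume "cong2 r d" "s \<in> \<int>"
  then obtain i j :: int where "r = of_int (d + 2 * i)" "s = of_int j"
    by (auto simp: cong2_def elim: Ints_cases)
  then have "2 * s + r = of_int (d + 2 * (i + j))" by simp
  then show ?thesis unfolding cong2_def by blast
qed

lemma char_cong2:
  assumes "\<And>i. i \<in> {1..n} \<Longrightarrow> xs i \<noteq> []" "characteristic (star_plumbing n e xs) k"
    and "u \<in> pverts (star_plumbing n e xs)"
  shows "cong2 (star_lap n e xs k u) (pdec (star_plumbing n e xs) u)"
  using char_basis[OF assms] by (simp add: cong2_def)

lemma (in star) char_translate:
  assumes x: "x \<in> lattice \<Gamma>" and u: "u \<in> pverts \<Gamma>"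
  shows "cong2 (star_lap n e xs (\<lambda>v. 2 * x v + k v) u) (pdec \<Gamma> u)"
proof -
  have "star_lap n e xs (\<lambda>v. 2 * x v + k v) u = 2 * star_lap n e xs x u + star_lap n e xs k u"
    using star_lap_linear[of n e xs 2 x 1 k u] by simp
  then show ?thesis
    using cong2_add_double[OF char_cong2[OF xs_ne k_char u] star_lap_lattice_Ints[OF x]] by simp
qed

text \<open>As \<open>\<eta>\<close> is dual to the last old vertex, \<open>u1 - \<eta>\<close> is
  orthogonal to the smaller lattice; its square is \<open>- (K + 1) + 2 K - K = - 1\<close>. It
  pairs to 1 with \<open>u2\<close>, so adding \<open>u2\<close> gives a second such vector
  orthogonal to the first. \<open>slope\<close> is the bound behind the monotonicity of
  \<open>tau (t + \<alpha>) - tau t\<close>.\<close>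

locale extended_star = A: star n e xs k + B: star n e xs' k'
  for n e xs k xs' k' +
  fixes K \<alpha> :: int and \<eta> :: "star_vertex \<Rightarrow> real"
  assumes n: "1 \<le> n" and xs': "xs' = xs(n := xs n @ [K + 1, 2])" and \<alpha>: "1 \<le> \<alpha>"
    and \<eta>: "\<eta> \<in> lattice A.\<Gamma>" and \<eta>_Center: "\<eta> Center = - of_int \<alpha>"
    and \<eta>_last: "\<eta> (Leg n (length (xs n) - 1)) = - of_int K"
    and \<eta>_lap: "u \<in> pverts A.\<Gamma> \<Longrightarrow>
      star_lap n e xs \<eta> u = (if u = Leg n (length (xs n) - 1) then 1 else 0)"
    and unimodular: "star_supported n xs y \<Longrightarrow> \<forall>u \<in> pverts A.\<Gamma>. star_lap n e xs y u \<in> \<int> \<Longrightarrow>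
      y \<in> lattice A.\<Gamma>"
    and unimodular': "star_supported n xs' y \<Longrightarrow> \<forall>u \<in> pverts B.\<Gamma>. star_lap n e xs' y u \<in> \<int> \<Longrightarrow>
      y \<in> lattice B.\<Gamma>"
    and slope: "(\<Sum>i=1..n. leg_slope (A.leg i) (t + \<alpha>)) \<le> (\<Sum>i=1..n. leg_slope (A.leg i) t) - e * \<alpha>"
begin

definition last_v where "last_v = Leg n (length (xs n) - 1)"
definition u1 where "u1 = Leg n (length (xs n))"
definition u2 where "u2 = Leg n (Suc (length (xs n)))"

definition ext :: "(star_vertex \<Rightarrow> real) \<Rightarrow> real \<Rightarrow> real \<Rightarrow> star_vertex \<Rightarrow> real" where
  "ext y p q = y(u1 := p, u2 := q)"

lemma n_in: "n \<in> {1..n}"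
  using n by simp

lemma xs_n: "xs n \<noteq> []"
  by (rule A.xs_ne[OF n_in])

lemma verts': "pverts B.\<Gamma> = insert u1 (insert u2 (pverts A.\<Gamma>))"
  unfolding star_pverts u1_def u2_def xs' using n by (auto simp: less_Suc_eq)

lemma new_verts: "u1 \<notin> pverts A.\<Gamma>" "u2 \<notin> pverts A.\<Gamma>" "u1 \<noteq> u2"
  by (auto simp: star_pverts u1_def u2_def)

lemma last_verts: "last_v \<in> pverts A.\<Gamma>"
  using n xs_n by (auto simp: star_pverts last_v_def)

lemma dec': "u \<in> pverts A.\<Gamma> \<Longrightarrow> pdec B.\<Gamma> u = pdec A.\<Gamma> u"
  "pdec B.\<Gamma> u1 = - (K + 1)" "pdec B.\<Gamma> u2 = - 2"
  by (auto simp: star_pverts star_pdec xs' u1_def u2_def nth_append)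

lemma ext_supported: "star_supported n xs y \<Longrightarrow> star_supported n xs' (ext y p q)"
  using n by (auto simp: star_supported_def ext_def xs' u1_def u2_def)

lemma lap_ext:
  assumes y: "star_supported n xs y"
  shows "w \<in> pverts A.\<Gamma> \<Longrightarrow>
      star_lap n e xs' (ext y p q) w = star_lap n e xs y w + (if w = last_v then p else 0)"
    and "star_lap n e xs' (ext y p q) u1 = y last_v - of_int (K + 1) * p + q"
    and "star_lap n e xs' (ext y p q) u2 = p - 2 * q"
proof -
  obtain m where m: "length (xs n) = Suc m" using xs_n by (cases "xs n") auto
  have ym: "y (Leg n (Suc m)) = 0" using y m by (simp add: star_supported_def)
  show "star_lap n e xs' (ext y p q) u1 = y last_v - of_int (K + 1) * p + q"
    by (simp add: u1_def u2_def ext_def m last_v_def xs' nth_append)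
  show "star_lap n e xs' (ext y p q) u2 = p - 2 * q"
    using y m by (simp add: u1_def u2_def ext_def last_v_def xs' nth_append star_supported_def)
  assume w: "w \<in> pverts A.\<Gamma>"
  show "star_lap n e xs' (ext y p q) w = star_lap n e xs y w + (if w = last_v then p else 0)"
  proof (cases w)
    case Center
    then show ?thesis by (simp add: ext_def u1_def u2_def m last_v_def)
  next
    case (Leg i j)
    show ?thesis
    proof (cases "i = n")
      case True
      have j: "j < Suc m" using w Leg True m by (simp add: star_pverts)
      have "case_nat (ext y p q Center) (\<lambda>j. ext y p q (Leg n j)) j = case_nat (y Center) (\<lambda>j. y (Leg n j)) j"
        using j by (cases j) (auto simp: ext_def u1_def u2_def m)
      moreover have "xs' n ! j = xs n ! j" using j m by (simp add: xs' nth_append)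
      moreover have "ext y p q (Leg n j) = y (Leg n j)" using j by (simp add: ext_def u1_def u2_def m)
      moreover have "ext y p q (Leg n (Suc j)) = y (Leg n (Suc j)) + (if j = m then p else 0)"
        using j ym by (auto simp: ext_def u1_def u2_def m)
      ultimately show ?thesis using Leg True by (simp add: last_v_def m)
    next
      case False
      then have "ext y p q (Leg i l) = y (Leg i l)" for l by (simp add: ext_def u1_def u2_def)
      moreover have "ext y p q Center = y Center" by (simp add: ext_def u1_def u2_def)
      ultimately show ?thesis using Leg False by (cases j) (simp_all add: last_v_def xs')
    qed
  qed
qed

lemma pairing_ext:
  assumes y: "star_supported n xs y"
  shows "pairing B.\<Gamma> (ext y p q) (ext y p q) =
    pairing A.\<Gamma> y y + 2 * p * y last_v - of_int (K + 1) * p\<^sup>2 + 2 * p * q - 2 * q\<^sup>2"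
proof -
  let ?z = "ext y p q"
  have fin: "finite (pverts A.\<Gamma>)" by (rule star_finite)
  have zy: "?z w = y w" if "w \<in> pverts A.\<Gamma>" for w
    using that new_verts by (auto simp: ext_def)
  have "pairing B.\<Gamma> ?z ?z = (\<Sum>w \<in> pverts B.\<Gamma>. ?z w * star_lap n e xs' ?z w)"
    by (rule star_pairing[OF B.xs_ne ext_supported[OF y]])
  also have "\<dots> = ?z u1 * star_lap n e xs' ?z u1 + ?z u2 * star_lap n e xs' ?z u2 +
      (\<Sum>w \<in> pverts A.\<Gamma>. ?z w * star_lap n e xs' ?z w)"
    unfolding verts' using fin new_verts by (simp del: star_lap.simps)
  also have "(\<Sum>w \<in> pverts A.\<Gamma>. ?z w * star_lap n e xs' ?z w) =
      (\<Sum>w \<in> pverts A.\<Gamma>. y w * star_lap n e xs y w + (if w = last_v then p * y w else 0))"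
    by (rule sum.cong) (auto simp: lap_ext(1)[OF y] zy distrib_left simp del: star_lap.simps)
  also have "\<dots> = pairing A.\<Gamma> y y + p * y last_v"
    unfolding sum.distrib using fin last_verts star_pairing[OF A.xs_ne y, of e y]
    by (simp add: sum.delta del: star_lap.simps)
  also have "?z u1 = p" using new_verts(3) by (simp add: ext_def)
  also have "?z u2 = q" by (simp add: ext_def)
  finally show ?thesis
    unfolding lap_ext(2,3)[OF y] by (simp add: power2_eq_square algebra_simps)
qed

lemma \<eta>_supported: "star_supported n xs \<eta>"
  by (rule lattice_supported[OF \<eta>])

lemma pairing_\<eta>: "pairing A.\<Gamma> x \<eta> = x last_v"
proof -
  have "pairing A.\<Gamma> x \<eta> = (\<Sum>u \<in> pverts A.\<Gamma>. x u * star_lap n e xs \<eta> u)"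
    by (rule star_pairing[OF A.xs_ne \<eta>_supported])
  also have "\<dots> = (\<Sum>u \<in> pverts A.\<Gamma>. if u = last_v then x u else 0)"
    by (rule sum.cong) (auto simp: \<eta>_lap last_v_def simp del: star_lap.simps)
  also have "\<dots> = x last_v" using star_finite last_verts by (simp add: sum.delta)
  finally show ?thesis .
qed

lemma \<eta>_at_last: "\<eta> last_v = - of_int K"
  using \<eta>_last by (simp add: last_v_def)

text \<open>Parity of \<open>k\<close> on \<open>\<eta>\<close>, whose square is \<open>- K\<close>;
  pairing with \<open>\<eta>\<close> reads off the last coordinate.\<close>

lemma k_last: "cong2 (k last_v) K"
proof -
  obtain j :: int where "pairing A.\<Gamma> k \<eta> = pairing A.\<Gamma> \<eta> \<eta> + 2 * of_int j"
    using A.k_char \<eta> by (auto simp: characteristic_def)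
  then have "k last_v = of_int (K + 2 * (j - K))"
    unfolding pairing_\<eta> \<eta>_at_last by simp
  then show ?thesis unfolding cong2_def by blast
qed

lemma char_last: "x \<in> lattice A.\<Gamma> \<Longrightarrow> cong2 (2 * x last_v + k last_v) K"
  by (rule cong2_add_double[OF k_last lattice_Ints])

lemma translate_supported:
  "x \<in> lattice A.\<Gamma> \<Longrightarrow> star_supported n xs (\<lambda>v. 2 * x v + k v)"
  using lattice_supported[of x n e xs] lattice_supported[OF A.k_lattice]
  by (simp add: star_supported_def)

text \<open>With \<open>c = 2 opt t + k\<close> this equals \<open>- ((c, c) + card) / 4\<close>,
  \<open>card\<close> being the number of vertices. In this form the grading refers only to the
  characteristic vector \<open>c\<close> and can be compared between the two lattices.\<close>

definition G where "G t = A.g0 + 2 * of_int (A.tau t)"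
definition G' where "G' t = B.g0 + 2 * of_int (B.tau t)"

lemma card': "real (card (pverts B.\<Gamma>)) = real (card (pverts A.\<Gamma>)) + 2"
  unfolding verts' using new_verts star_finite by simp

lemma G_eq: "4 * G t = 8 * of_int (A.tau t) - pairing A.\<Gamma> k k - real (card (pverts A.\<Gamma>))"
  by (simp add: G_def A.g0_def field_simps)

lemma G'_eq: "4 * G' t = 8 * of_int (B.tau t) - pairing B.\<Gamma> k' k' - real (card (pverts A.\<Gamma>)) - 2"
  unfolding G'_def B.g0_def card' by (simp add: field_simps)

text \<open>The map \<open>c \<mapsto> c + u2\<close> on characteristic vectors.\<close>

lemma up:
  obtains t' where "2 * t' - B.\<sigma> = 2 * t - A.\<sigma>" "G' t' \<le> G t"
proof -
  let ?x = "A.opt t"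
  let ?c = "\<lambda>v. 2 * ?x v + k v"
  \<comment> \<open>Coefficients - 1 and 1 on the two generators of square - 1: both odd, with
    cancelling central parts. The square drops by 2, which offsets the two additional vertices in
    the grading.\<close>
  let ?c' = "ext ?c 0 1"
  define x' where "x' = (\<lambda>v. (1 / 2) * ?c' v + (- 1 / 2) * k' v)"
  have x: "?x \<in> lattice A.\<Gamma>" by (rule A.opt_lattice)
  note cs = translate_supported[OF x]
  have c': "cong2 (star_lap n e xs' ?c' w) (pdec B.\<Gamma> w)" if w: "w \<in> pverts B.\<Gamma>" for w
  proof -
    consider "w \<in> pverts A.\<Gamma>" | "w = u1" | "w = u2" using w verts' by auto
    then show ?thesis
    proof cases
      case 1
      then show ?thesis using lap_ext(1)[OF cs 1] A.char_translate[OF x 1] dec'(1)[OF 1] by simp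
    next
      case 2
      obtain j where "2 * ?x last_v + k last_v = of_int (K + 2 * j)"
        using char_last[OF x] by (auto simp: cong2_def)
      then have "star_lap n e xs' ?c' u1 = of_int (- (K + 1) + 2 * (K + 1 + j))"
        unfolding lap_ext(2)[OF cs] by simp
      then show ?thesis unfolding 2 dec' cong2_def by blast
    next
      case 3
      have "star_lap n e xs' ?c' u2 = of_int (- 2 + 2 * 0)" unfolding lap_ext(3)[OF cs] by simp
      then show ?thesis unfolding 3 dec' cong2_def by blast
    qed
  qed
  \<comment> \<open>Half the difference of two characteristic vectors pairs integrally with every
    vertex, so by unimodularity it is a lattice vector.\<close>
  have "x' \<in> lattice B.\<Gamma>"
  proof (rule unimodular')
    show "star_supported n xs' x'"
      using ext_supported[OF cs] lattice_supported[OF B.k_lattice]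
      by (simp add: x'_def star_supported_def)
    show "\<forall>u \<in> pverts B.\<Gamma>. star_lap n e xs' x' u \<in> \<int>"
      unfolding x'_def star_lap_linear
      using cong2_half_diff[OF c' char_cong2[OF B.xs_ne B.k_char]] by blast
  qed
  then have x': "x' \<in> lattice B.\<Gamma>" and w: "weight B.\<Gamma> k' x' \<le> - of_int (B.tau \<lfloor>x' Center\<rfloor>)"
    by (auto intro: B.weight_le_tau)
  have xc: "(\<lambda>v. 2 * x' v + k' v) = ?c'" by (simp add: x'_def fun_eq_iff)
  have "8 * weight B.\<Gamma> k' x' = pairing A.\<Gamma> ?c ?c - 2 - pairing B.\<Gamma> k' k'"
    unfolding weight_square[OF star_padj_sym] xc pairing_ext[OF cs] by simp
  moreover have "8 * weight A.\<Gamma> k ?x = pairing A.\<Gamma> ?c ?c - pairing A.\<Gamma> k k"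
    by (rule weight_square[OF star_padj_sym])
  ultimately have "G' \<lfloor>x' Center\<rfloor> \<le> G t"
    using w G_eq[of t] G'_eq[of "\<lfloor>x' Center\<rfloor>"] unfolding A.weight_opt mult_minus_right by linarith
  moreover have "2 * \<lfloor>x' Center\<rfloor> - B.\<sigma> = 2 * t - A.\<sigma>"
  proof -
    obtain j where j: "x' Center = of_int j" using lattice_Ints[OF x'] Ints_cases by metis
    have "2 * x' Center + k' Center = ?c' Center" using xc by (simp only: fun_eq_iff)
    then have "real_of_int (2 * j - B.\<sigma>) = of_int (2 * t - A.\<sigma>)"
      using j A.k_Center B.k_Center by (simp add: ext_def u1_def u2_def)
    then have "2 * j - B.\<sigma> = 2 * t - A.\<sigma>" by (simp only: of_int_eq_iff)
    then show ?thesis using j by simp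
  qed
  ultimately show thesis using that by blast
qed

text \<open>The map \<open>c' \<mapsto> c + p \<eta>\<close>, where \<open>c\<close> is the restriction of \<open>c'\<close> and \<open>p\<close> its \<open>u1\<close> coordinate: the
  orthogonal projection to the smaller lattice.\<close>

lemma down:
  obtains s r where "2 * s - A.\<sigma> = 2 * t - B.\<sigma> + 2 * r * \<alpha>" "G s \<le> G' t"
proof -
  let ?x' = "B.opt t"
  let ?c' = "\<lambda>v. 2 * ?x' v + k' v"
  \<comment> \<open>In the orthogonal decomposition \<open>?c'\<close> is \<open>d\<close> plus
    \<open>p - q\<close> times \<open>u1 - \<eta>\<close> plus \<open>q\<close> times
    \<open>u1 - \<eta> + u2\<close>.\<close>
  define p q where "p = ?c' u1" and "q = ?c' u2"
  define y where "y = (\<lambda>v. if v \<in> pverts A.\<Gamma> then ?c' v else 0)"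
  define d where "d = (\<lambda>v. 1 * y v + p * \<eta> v)"
  define x where "x = (\<lambda>v. (1 / 2) * d v + (- 1 / 2) * k v)"
  have x': "?x' \<in> lattice B.\<Gamma>" by (rule B.opt_lattice)
  have ys: "star_supported n xs y" unfolding star_supported_iff[of n xs y e] by (simp add: y_def)
  have c's: "\<forall>v. v \<notin> pverts B.\<Gamma> \<longrightarrow> ?c' v = 0"
    using x' B.k_lattice by (auto simp: lattice_def)
  have ce: "?c' = ext y p q"
  proof
    fix v show "?c' v = ext y p q v"
      using c's verts' by (auto simp: ext_def p_def q_def y_def)
  qed
  have c'2: "cong2 (star_lap n e xs' (ext y p q) w) (pdec B.\<Gamma> w)" if "w \<in> pverts B.\<Gamma>" for w
    using B.char_translate[OF x' that] unfolding ce .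
  have d2: "cong2 (star_lap n e xs d w) (pdec A.\<Gamma> w)" if w: "w \<in> pverts A.\<Gamma>" for w
  proof -
    have "star_lap n e xs d w = star_lap n e xs' (ext y p q) w"
      unfolding d_def star_lap_linear \<eta>_lap[OF w] lap_ext(1)[OF ys w] by (simp add: last_v_def)
    then show ?thesis using c'2[of w] w verts' dec'(1)[OF w] by simp
  qed
  have xl: "x \<in> lattice A.\<Gamma>"
  proof (rule unimodular)
    show "star_supported n xs x"
      using ys \<eta>_supported lattice_supported[OF A.k_lattice]
      by (simp add: x_def d_def star_supported_def)
    show "\<forall>u \<in> pverts A.\<Gamma>. star_lap n e xs x u \<in> \<int>"
      unfolding x_def star_lap_linear
      using cong2_half_diff[OF d2 char_cong2[OF A.xs_ne A.k_char]] by blast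
  qed
  have xd: "(\<lambda>v. 2 * x v + k v) = d" by (simp add: x_def fun_eq_iff)
  obtain pi qi where pi: "p = of_int pi" and qi: "q = of_int qi"
    using lattice_Ints[OF x'] lattice_Ints[OF B.k_lattice] unfolding p_def q_def
    by (metis Ints_add Ints_cases Ints_mult Ints_numeral)
  have "u2 \<in> pverts B.\<Gamma>" "u1 \<in> pverts B.\<Gamma>" using verts' by auto
  from c'2[OF this(1)] c'2[OF this(2)] obtain j1 j2 :: int
    where "p - 2 * q = of_int (- 2 + 2 * j1)" "y last_v - of_int (K + 1) * p + q = of_int (- (K + 1) + 2 * j2)"
    unfolding lap_ext(2,3)[OF ys] dec' cong2_def by blast
  note j12 = this
  \<comment> \<open>The decoration of \<open>u2\<close> is even, hence so is \<open>p\<close>.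
    Therefore the shift \<open>- p * \<alpha>\<close> of the characteristic vector at the centre
    moves the lattice coordinate by a multiple of \<alpha>.\<close>
  have "real_of_int pi = of_int (2 * (qi + j1 - 1))" using j12(1) pi qi by simp
  then have pe: "pi = 2 * (qi + j1 - 1)" by (simp only: of_int_eq_iff)
  obtain j3 where j3: "d last_v = of_int (K + 2 * j3)"
    using char_last[OF xl] fun_cong[OF xd, of last_v] by (auto simp: cong2_def)
  have "y last_v = of_int (K + 2 * j3 + pi * K)" using j3 pi unfolding d_def \<eta>_at_last by simp
  then have "real_of_int (K + 2 * j3 + pi * K - (K + 1) * pi + qi) = of_int (- (K + 1) + 2 * j2)"
    using j12(2) pi qi by simp
  then have "K + 2 * j3 + pi * K - (K + 1) * pi + qi = - (K + 1) + 2 * j2"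
    by (simp only: of_int_eq_iff)
  then have qe: "qi = 2 * (j2 - j3 - K - 1 + (qi + j1 - 1)) + 1" using pe by (simp add: algebra_simps)
  \<comment> \<open>Each odd coefficient costs at least 1 in the square; together they balance the
    two vertices by which the ranks differ.\<close>
  have "odd qi" "odd (pi - qi)" using pe qe by (metis even_add even_mult_iff even_numeral odd_one, metis even_diff even_mult_iff even_numeral even_add odd_one)
  then have "qi \<noteq> 0" "pi - qi \<noteq> 0" by auto
  then have "1 \<le> qi\<^sup>2" "1 \<le> (pi - qi)\<^sup>2"
    by (simp_all add: int_one_le_iff_zero_less)
  then have "2 \<le> (pi - qi)\<^sup>2 + qi\<^sup>2" by linarith
  then have "real_of_int 2 \<le> of_int ((pi - qi)\<^sup>2 + qi\<^sup>2)" by (simp only: of_int_le_iff)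
  then have pq: "2 \<le> (p - q)\<^sup>2 + q\<^sup>2" using pi qi by simp
  have "pairing A.\<Gamma> d d = pairing A.\<Gamma> y y + 2 * p * y last_v - of_int K * p\<^sup>2"
  proof -
    have d: "d = (\<lambda>v. y v + p * \<eta> v)" by (simp add: d_def)
    have s: "pairing A.\<Gamma> \<eta> y = pairing A.\<Gamma> y \<eta>" by (rule pairing_sym[OF star_padj_sym])
    show ?thesis
      unfolding d pairing_add_left pairing_add_right pairing_scale_left pairing_scale_right s
        pairing_\<eta> \<eta>_at_last
      by (simp add: power2_eq_square algebra_simps)
  qed
  then have dc: "pairing A.\<Gamma> d d = pairing B.\<Gamma> ?c' ?c' + (p - q)\<^sup>2 + q\<^sup>2"
    unfolding ce pairing_ext[OF ys] by (simp add: power2_eq_square algebra_simps)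
  have "8 * weight A.\<Gamma> k x = pairing A.\<Gamma> d d - pairing A.\<Gamma> k k"
    unfolding weight_square[OF star_padj_sym] xd ..
  moreover have "8 * weight B.\<Gamma> k' ?x' = pairing B.\<Gamma> ?c' ?c' - pairing B.\<Gamma> k' k'"
    by (rule weight_square[OF star_padj_sym])
  moreover have "weight A.\<Gamma> k x \<le> - of_int (A.tau \<lfloor>x Center\<rfloor>)" by (rule A.weight_le_tau[OF xl])
  ultimately have "G \<lfloor>x Center\<rfloor> \<le> G' t"
    using dc pq G_eq[of "\<lfloor>x Center\<rfloor>"] G'_eq[of t] unfolding B.weight_opt mult_minus_right by linarith
  moreover have "2 * \<lfloor>x Center\<rfloor> - A.\<sigma> = 2 * t - B.\<sigma> + 2 * (- (qi + j1 - 1)) * \<alpha>"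
  proof -
    obtain j where j: "x Center = of_int j" using lattice_Ints[OF xl] Ints_cases by metis
    have "y Center = of_int (2 * t) - of_int B.\<sigma>" using B.k_Center by (simp add: y_def star_pverts)
    then have "d Center = of_int (2 * t - B.\<sigma> - pi * \<alpha>)" by (simp add: d_def \<eta>_Center pi)
    moreover have "2 * x Center + k Center = d Center" using xd by (simp only: fun_eq_iff)
    ultimately have "real_of_int (2 * j - A.\<sigma>) = of_int (2 * t - B.\<sigma> - pi * \<alpha>)"
      using j A.k_Center by simp
    then have "2 * j - A.\<sigma> = 2 * t - B.\<sigma> - pi * \<alpha>" by (simp only: of_int_eq_iff)
    then show ?thesis using j pe by (simp add: algebra_simps)
  qed
  ultimately show thesis using that by blast
qed

text \<open>By \<open>tau_step\<close> the difference \<open>tau (t + \<alpha>) - tau t\<close>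
  grows in each step by \<open>- e * \<alpha>\<close> minus the growth of the slopes over \<alpha>,
  which is nonnegative by \<open>slope\<close>.\<close>

lemma tau_shift_mono: "A.tau (s + \<alpha>) - A.tau s \<le> A.tau (s + int d + \<alpha>) - A.tau (s + int d)"
proof (induction d)
  case (Suc d)
  let ?u = "s + int d"
  have "A.tau (?u + 1) = A.tau ?u - e * ?u + A.c0 - (\<Sum>i=1..n. leg_slope (A.leg i) ?u)"
    by (rule A.tau_step)
  moreover have "A.tau (?u + \<alpha> + 1) = A.tau (?u + \<alpha>) - e * (?u + \<alpha>) + A.c0 -
      (\<Sum>i=1..n. leg_slope (A.leg i) (?u + \<alpha>))"
    by (rule A.tau_step)
  ultimately have "A.tau (?u + \<alpha>) - A.tau ?u \<le> A.tau (?u + \<alpha> + 1) - A.tau (?u + 1)"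
    using slope[of ?u] by (simp add: distrib_left)
  moreover have "s + int (Suc d) + \<alpha> = ?u + \<alpha> + 1" "s + int (Suc d) = ?u + 1" by simp_all
  ultimately show ?case using Suc.IH by (simp only:)
qed simp

text \<open>\<open>t \<mapsto> tau (t + \<alpha>) - tau t\<close> is nondecreasing and, by the symmetry of \<open>tau\<close>, odd about its centre.\<close>

lemma tau_right:
  assumes "A.\<sigma> \<le> 2 * t + \<alpha>" shows "A.tau t \<le> A.tau (t + \<alpha>)"
proof -
  \<comment> \<open>The interval from \<open>?s\<close> to \<open>?s + \<alpha>\<close> is the
    mirror image of the one from \<open>t\<close> to \<open>t + \<alpha>\<close> and starts no
    later, so the increment of \<open>tau\<close> over the latter is at least its own
    negative.\<close>
  let ?s = "A.\<sigma> - \<alpha> - t"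
  have "A.tau (?s + \<alpha>) - A.tau ?s \<le> A.tau (t + \<alpha>) - A.tau t"
    using tau_shift_mono[of ?s "nat (t - ?s)"] assms by simp
  moreover have "?s + \<alpha> = A.\<sigma> - t" "?s = A.\<sigma> - (t + \<alpha>)" by simp_all
  then have "A.tau (?s + \<alpha>) = A.tau t" "A.tau ?s = A.tau (t + \<alpha>)"
    by (simp_all only: A.tau_sym)
  ultimately show ?thesis by linarith
qed

lemma tau_left:
  assumes "2 * t \<le> A.\<sigma> + \<alpha>" shows "A.tau t \<le> A.tau (t - \<alpha>)"
proof -
  have "A.tau (A.\<sigma> - t) \<le> A.tau (A.\<sigma> - t + \<alpha>)" by (rule tau_right) (use assms in simp)
  moreover have "A.\<sigma> - t + \<alpha> = A.\<sigma> - (t - \<alpha>)" by simp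
  ultimately show ?thesis by (simp only: A.tau_sym)
qed

lemma cover: "\<exists>s. \<bar>2 * s - A.\<sigma>\<bar> \<le> \<alpha> \<and> A.tau s \<le> A.tau t"
proof (induction "nat \<bar>2 * t - A.\<sigma>\<bar>" arbitrary: t rule: less_induct)
  case less
  consider "\<bar>2 * t - A.\<sigma>\<bar> \<le> \<alpha>" | "\<alpha> < 2 * t - A.\<sigma>" | "2 * t - A.\<sigma> < - \<alpha>" by linarith
  then show ?case
  proof cases
    case 1
    then show ?thesis by blast
  next
    case 2
    then have "nat \<bar>2 * (t - \<alpha>) - A.\<sigma>\<bar> < nat \<bar>2 * t - A.\<sigma>\<bar>"
      using \<alpha> unfolding right_diff_distrib by linarith
    from less[OF this] obtain s where "\<bar>2 * s - A.\<sigma>\<bar> \<le> \<alpha>" "A.tau s \<le> A.tau (t - \<alpha>)" by blast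
    moreover have "A.tau (t - \<alpha>) \<le> A.tau t" using tau_right[of "t - \<alpha>"] 2 by simp
    ultimately show ?thesis by (meson order_trans)
  next
    case 3
    then have "nat \<bar>2 * (t + \<alpha>) - A.\<sigma>\<bar> < nat \<bar>2 * t - A.\<sigma>\<bar>"
      using \<alpha> unfolding distrib_left by linarith
    from less[OF this] obtain s where "\<bar>2 * s - A.\<sigma>\<bar> \<le> \<alpha>" "A.tau s \<le> A.tau (t + \<alpha>)" by blast
    moreover have "A.tau (t + \<alpha>) \<le> A.tau t" using tau_left[of "t + \<alpha>"] 3 by simp
    ultimately show ?thesis by (meson order_trans)
  qed
qed

text \<open>Starting in the window, every step by \<alpha> away from it in either direction is
  covered by \<open>tau_right\<close> or \<open>tau_left\<close>.\<close>

lemma window_least: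
  assumes "\<bar>2 * t - A.\<sigma>\<bar> \<le> \<alpha>" shows "A.tau t \<le> A.tau (t + r * \<alpha>)"
proof -
  have "A.tau t \<le> A.tau (t + int d * \<alpha>)" for d
  proof (induction d)
    case (Suc d)
    have "0 \<le> int d * \<alpha>" using \<alpha> by simp
    then have "A.tau (t + int d * \<alpha>) \<le> A.tau (t + int d * \<alpha> + \<alpha>)"
      using assms by (intro tau_right) (unfold distrib_left, linarith)
    then show ?case using Suc by (simp add: algebra_simps)
  qed simp
  moreover have "A.tau t \<le> A.tau (t - int d * \<alpha>)" for d
  proof (induction d)
    case (Suc d)
    have "0 \<le> int d * \<alpha>" using \<alpha> by simp
    then have "A.tau (t - int d * \<alpha>) \<le> A.tau (t - int d * \<alpha> - \<alpha>)"
      using assms by (intro tau_left) (unfold right_diff_distrib, linarith)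
    then show ?case using Suc by (simp add: algebra_simps)
  qed simp
  ultimately show ?thesis
    by (cases r rule: int_cases2) auto
qed

definition \<delta> :: int where "\<delta> = (B.\<sigma> - A.\<sigma>) div 2"

text \<open>A single instance of \<open>up\<close> shows that the two values of
  \<open>\<sigma>\<close> have the same parity, so the halving in \<open>\<delta>\<close> is
  exact.\<close>

lemma \<delta>: "B.\<sigma> = A.\<sigma> + 2 * \<delta>"
proof -
  obtain t' where "2 * t' - B.\<sigma> = 2 * 0 - A.\<sigma>" by (rule up[of 0])
  then have "B.\<sigma> - A.\<sigma> = 2 * t'" by simp
  then show ?thesis by (simp add: \<delta>_def)
qed

lemma up_G: "G' (t + \<delta>) \<le> G t"
proof -
  obtain t' where t': "2 * t' - B.\<sigma> = 2 * t - A.\<sigma>" "G' t' \<le> G t" by (rule up)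
  then have "t' = t + \<delta>" using \<delta> by simp
  then show ?thesis using t' by simp
qed

lemma down_G: "\<exists>r. G (t + r * \<alpha>) \<le> G' (t + \<delta>)"
proof -
  obtain s r where s: "2 * s - A.\<sigma> = 2 * (t + \<delta>) - B.\<sigma> + 2 * r * \<alpha>" "G s \<le> G' (t + \<delta>)" by (rule down)
  then have "s = t + r * \<alpha>" using \<delta> by simp
  then show ?thesis using s by blast
qed

text \<open>\<open>up\<close> gives one inequality. \<open>down\<close> gives the other only up to a
  multiple of \<alpha>, which is harmless because in the window \<open>tau\<close> is least in its
  residue class.\<close>

lemma window_G:
  assumes "\<bar>2 * t - A.\<sigma>\<bar> \<le> \<alpha>" shows "G' (t + \<delta>) = G t"
proof -
  obtain r where "G (t + r * \<alpha>) \<le> G' (t + \<delta>)" using down_G by blast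
  moreover have "G t \<le> G (t + r * \<alpha>)" using window_least[OF assms] by (simp add: G_def)
  ultimately show ?thesis using up_G[of t] by linarith
qed

lemma two_stars: "two_stars n e xs k n e xs' k' \<alpha> \<delta> (A.tau A.c - B.tau (A.c + \<delta>))"
proof unfold_locales
  show "1 \<le> \<alpha>" by (rule \<alpha>)
  show "B.\<sigma> = A.\<sigma> + 2 * \<delta>" by (rule \<delta>)
  \<comment> \<open>The point \<open>c\<close> next to the axis lies in the window, so the equality
    of gradings there determines the difference of the normalisations as an even integer.\<close>
  have "\<bar>2 * A.c - A.\<sigma>\<bar> \<le> \<alpha>" using A.c \<alpha> by linarith
  from window_G[OF this] show g: "B.g0 = A.g0 + 2 * of_int (A.tau A.c - B.tau (A.c + \<delta>))"
    by (simp add: G_def G'_def)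
  show "A.tau t = B.tau (t + \<delta>) + (A.tau A.c - B.tau (A.c + \<delta>))" if "\<bar>2 * t - A.\<sigma>\<bar> \<le> \<alpha>" for t
  proof -
    have "real_of_int (A.tau t) = of_int (B.tau (t + \<delta>) + (A.tau A.c - B.tau (A.c + \<delta>)))"
      using window_G[OF that] unfolding G_def G'_def g by simp
    then show ?thesis by (simp only: of_int_eq_iff)
  qed
  show "\<exists>s. \<bar>2 * s - A.\<sigma>\<bar> \<le> \<alpha> \<and> A.tau s \<le> A.tau t" for t by (rule cover)
  show "\<exists>s. \<bar>2 * s - B.\<sigma>\<bar> \<le> \<alpha> \<and> B.tau s \<le> B.tau t" for t
  proof -
    \<comment> \<open>The estimate for the larger plumbing is borrowed from the smaller one: project
      down, move into the window there, and return by \<open>window_G\<close>.\<close>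
    obtain r where r: "G (t - \<delta> + r * \<alpha>) \<le> G' (t - \<delta> + \<delta>)" using down_G by blast
    obtain s where s: "\<bar>2 * s - A.\<sigma>\<bar> \<le> \<alpha>" "A.tau s \<le> A.tau (t - \<delta> + r * \<alpha>)" using cover by blast
    have "G' (s + \<delta>) \<le> G' t" using window_G[OF s(1)] s(2) r by (simp add: G_def)
    then have "B.tau (s + \<delta>) \<le> B.tau t" by (simp add: G'_def)
    moreover have "\<bar>2 * (s + \<delta>) - B.\<sigma>\<bar> \<le> \<alpha>" using s(1) \<delta> by simp
    ultimately show ?thesis by blast
  qed
qed

end

section \<open>Seifert data\<close>

lemma cf_act_drop:
  assumes "j < length xs"
  shows "fst (cf_act (drop j xs) z) =
      xs ! j * fst (cf_act (drop (Suc j) xs) z) - snd (cf_act (drop (Suc j) xs) z)"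
    and "snd (cf_act (drop j xs) z) = fst (cf_act (drop (Suc j) xs) z)"
  using Cons_nth_drop_Suc[OF assms, symmetric] by simp_all

text \<open>The tails of the continued fraction solve the linear recursion of the leg; the only
  defect is \<open>- snd z\<close> at the outer end.\<close>

lemma cf_act_harmonic:
  assumes "j < length xs"
  shows "fst (cf_act (drop j xs) z) - xs ! j * fst (cf_act (drop (Suc j) xs) z) +
      (if Suc j < length xs then fst (cf_act (drop (Suc (Suc j)) xs) z) else 0) =
    (if Suc j < length xs then 0 else - snd z)"
  using cf_act_drop(1)[OF assms, of z] cf_act_drop(2)[of "Suc j" xs z] by auto

text \<open>Along each leg \<open>\<eta>\<close> is a multiple of the continued fraction tails. The
  factors \<open>q i\<close> make all legs agree on the value at the centre, and the sum condition
  is the central row. Seeds with second component 0 end without defect, while \<open>(K, 1)\<close>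
  leaves the value 1 at the last vertex of leg \<open>n\<close>.\<close>

lemma dual_vector:
  fixes q :: "nat \<Rightarrow> int"
  assumes n: "1 \<le> n" and ne: "\<And>i. i \<in> {1..n} \<Longrightarrow> xs i \<noteq> []"
    and cf: "\<And>i. i \<in> {1..n} \<Longrightarrow> q i * fst (cf_act (xs i) (z i)) = \<alpha>"
    and sum: "(\<Sum>i=1..n. q i * snd (cf_act (xs i) (z i))) = - e * \<alpha>"
    and z: "z n = (K, 1)" "q n = 1" "\<And>i. i \<in> {1..n} \<Longrightarrow> i \<noteq> n \<Longrightarrow> snd (z i) = 0"
  obtains \<eta> where "\<eta> \<in> lattice (star_plumbing n e xs)" "\<eta> Center = - of_int \<alpha>"
    "\<eta> (Leg n (length (xs n) - 1)) = - of_int K"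
    "\<And>u. u \<in> pverts (star_plumbing n e xs) \<Longrightarrow>
      star_lap n e xs \<eta> u = (if u = Leg n (length (xs n) - 1) then 1 else 0)"
proof -
  define g where "g i j = fst (cf_act (drop j (xs i)) (z i))" for i j
  define \<eta> where "\<eta> v = (case v of Center \<Rightarrow> - of_int \<alpha> | Leg i j \<Rightarrow>
    (if i \<in> {1..n} \<and> j < length (xs i) then - of_int (q i * g i (Suc j)) else (0 :: real)))" for v
  have g0: "q i * g i 0 = \<alpha>" if "i \<in> {1..n}" for i using cf[OF that] by (simp add: g_def)
  have \<eta>_leg: "\<eta> (Leg i j) = (if j < length (xs i) then - of_int (q i * g i (Suc j)) else 0)"
    if "i \<in> {1..n}" for i j using that by (simp add: \<eta>_def)
  show thesis
  proof
    show "\<eta> \<in> lattice (star_plumbing n e xs)"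
      unfolding lattice_def
    proof (intro CollectI conjI ballI allI impI)
      fix v show "\<eta> v \<in> \<int>" by (cases v) (auto simp: \<eta>_def)
    next
      fix v assume "v \<notin> pverts (star_plumbing n e xs)"
      then show "\<eta> v = 0" by (cases v) (auto simp: \<eta>_def star_pverts)
    qed
    show "\<eta> Center = - of_int \<alpha>" by (simp add: \<eta>_def)
    have "n \<in> {1..n}" using n by simp
    then show "\<eta> (Leg n (length (xs n) - 1)) = - of_int K"
      using ne[of n] z by (simp add: \<eta>_def g_def)
    fix u assume u: "u \<in> pverts (star_plumbing n e xs)"
    show "star_lap n e xs \<eta> u = (if u = Leg n (length (xs n) - 1) then 1 else 0)"
    proof (cases u)
      case Center
      have "\<eta> (Leg i 0) = - of_int (q i * snd (cf_act (xs i) (z i)))" if i: "i \<in> {1..n}" for i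
        using ne[OF i] \<eta>_leg[OF i, of 0] cf_act_drop(2)[of 0 "xs i" "z i"] by (simp add: g_def)
      then have "(\<Sum>i=1..n. \<eta> (Leg i 0)) = (\<Sum>i=1..n. - of_int (q i * snd (cf_act (xs i) (z i))))"
        by (intro sum.cong) auto
      also have "\<dots> = - of_int (\<Sum>i=1..n. q i * snd (cf_act (xs i) (z i)))"
        by (simp add: sum_negf)
      finally show ?thesis unfolding Center sum by (simp add: \<eta>_def)
    next
      case (Leg i j)
      then have i: "i \<in> {1..n}" and j: "j < length (xs i)" using u by (auto simp: star_pverts)
      have prev: "case_nat (\<eta> Center) (\<lambda>j. \<eta> (Leg i j)) j = - of_int (q i * g i j)"
        using j g0[OF i] \<eta>_leg[OF i] by (cases j) (auto simp: \<eta>_def)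
      have "star_lap n e xs \<eta> u = - of_int (q i * (g i j - xs i ! j * g i (Suc j) +
          (if Suc j < length (xs i) then g i (Suc (Suc j)) else 0)))"
        unfolding Leg star_lap.simps prev using j by (simp add: \<eta>_leg[OF i] algebra_simps)
      also have "\<dots> = of_int (q i * (if Suc j < length (xs i) then 0 else snd (z i)))"
        unfolding g_def cf_act_harmonic[OF j] by simp
      also have "\<dots> = (if u = Leg n (length (xs n) - 1) then 1 else 0)"
      proof (cases "i = n")
        case True
        have "Suc j < length (xs n) \<longleftrightarrow> j \<noteq> length (xs n) - 1" using j True by auto
        then show ?thesis using Leg z True by simp
      next
        case False
        then show ?thesis using Leg z(3)[OF i False] by simp
      qed
      finally show ?thesis .
    qed
  qed
qed

lemma cofactor_sum_split:
  fixes a b :: "nat \<Rightarrow> int"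
  assumes n: "1 \<le> n"
  shows "(\<Prod>j=1..n. a j) = a n * (\<Prod>j=1..n-1. a j)"
    and "(\<Sum>i=1..n. b i * (\<Prod>j \<in> {1..n} - {i}. a j)) =
      b n * (\<Prod>j=1..n-1. a j) + a n * (\<Sum>i=1..n-1. b i * (\<Prod>j \<in> {1..n-1} - {i}. a j))"
proof -
  have s: "{1..n} = insert n {1..n-1}" "n \<notin> {1..n-1}" using n by auto
  show "(\<Prod>j=1..n. a j) = a n * (\<Prod>j=1..n-1. a j)" unfolding s(1) by (rule prod.insert) (use n in auto)
  have "(\<Prod>j \<in> insert n {1..n-1} - {i}. a j) = a n * (\<Prod>j \<in> {1..n-1} - {i}. a j)"
    if "i \<in> {1..n-1}" for i
  proof -
    have "insert n {1..n-1} - {i} = insert n ({1..n-1} - {i})" using that s(2) by auto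
    moreover have "n \<notin> {1..n-1} - {i}" using s(2) by blast
    ultimately show ?thesis by (simp only: prod.insert finite_Diff finite_atLeastAtMost not_False_eq_True)
  qed
  then have "(\<Sum>i=1..n-1. b i * (\<Prod>j \<in> insert n {1..n-1} - {i}. a j)) =
      (\<Sum>i=1..n-1. a n * (b i * (\<Prod>j \<in> {1..n-1} - {i}. a j)))"
    by (intro sum.cong) auto
  moreover have "insert n {1..n-1} - {n} = {1..n-1}" using s(2) by auto
  ultimately show "(\<Sum>i=1..n. b i * (\<Prod>j \<in> {1..n} - {i}. a j)) =
      b n * (\<Prod>j=1..n-1. a j) + a n * (\<Sum>i=1..n-1. b i * (\<Prod>j \<in> {1..n-1} - {i}. a j))"
    unfolding s(1) using s(2) by (simp add: sum_distrib_left)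
qed

lemma seifert_data_eq:
  assumes "\<forall>i \<in> {1..n}. 2 \<le> a i" "seifert_data n a e b"
  shows "(\<Sum>i=1..n. b i * (\<Prod>j \<in> {1..n} - {i}. a j)) = - 1 - e * (\<Prod>j=1..n. a j)"
  using assms(2) unfolding seifert_data_def seifert_data_int[OF assms(1)] by blast

text \<open>A common divisor would divide every term of the Seifert equation except
  \<open>- 1\<close>.\<close>

lemma seifert_data_coprime:
  assumes a: "\<forall>i \<in> {1..n}. 2 \<le> a i" and d: "seifert_data n a e b" and i: "i \<in> {1..n}"
  shows "coprime (a i) (b i)"
proof (rule coprimeI)
  fix t assume t: "t dvd a i" "t dvd b i"
  let ?s = "\<Sum>l=1..n. b l * (\<Prod>j \<in> {1..n} - {l}. a j)"
  have "a i dvd ?s - b i * (\<Prod>j \<in> {1..n} - {i}. a j)"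
    using sum_cofactor_cong[OF i, of b a] by (simp add: cong_iff_dvd_diff)
  then have "t dvd ?s - b i * (\<Prod>j \<in> {1..n} - {i}. a j)" using t(1) by (rule dvd_trans[rotated])
  moreover have "t dvd b i * (\<Prod>j \<in> {1..n} - {i}. a j)" using t(2) by simp
  ultimately have "t dvd ?s - b i * (\<Prod>j \<in> {1..n} - {i}. a j) + b i * (\<Prod>j \<in> {1..n} - {i}. a j)"
    by (rule dvd_add)
  then have "t dvd ?s" by simp
  moreover have "a i dvd (\<Prod>j=1..n. a j)" using i by (intro dvd_prodI) auto
  then have "t dvd e * (\<Prod>j=1..n. a j)" using t by (meson dvd_mult dvd_trans)
  ultimately have "t dvd ?s + e * (\<Prod>j=1..n. a j)" by (rule dvd_add)
  then show "is_unit t" unfolding seifert_data_eq[OF a d] by simp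
qed

text \<open>\<open>B\<close> is chosen so that the Seifert equation reads
  \<open>a n * B - b n * \<alpha> = 1\<close>. This is unchanged when a multiple of
  \<open>(\<alpha>, B)\<close> is added to \<open>(a n, b n)\<close>, so \<open>e\<close> and the
  other \<open>b i\<close> can be kept.\<close>

lemma seifert_data_extend:
  fixes n :: nat and a b :: "nat \<Rightarrow> int" and e :: int
  defines "\<alpha> \<equiv> \<Prod>j=1..n-1. a j"
    and "B \<equiv> - (e * (\<Prod>j=1..n-1. a j) + (\<Sum>i=1..n-1. b i * (\<Prod>j \<in> {1..n-1} - {i}. a j)))"
  assumes n: "2 \<le> n" and a: "\<forall>i \<in> {1..n}. 2 \<le> a i" and d: "seifert_data n a e b"
  shows "a n * B - b n * \<alpha> = 1" "2 \<le> \<alpha>"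
    "seifert_data n (a(n := a n + 2 * \<alpha>)) e (b(n := b n + 2 * B))"
proof -
  let ?B = B and ?a = "a(n := a n + 2 * \<alpha>)"
  let ?b = "b(n := b n + 2 * ?B)"
  have n1: "1 \<le> n" and nn: "n \<in> {1..n}" using n by auto
  have a1: "\<forall>i \<in> {1..n-1}. 2 \<le> a i" using a by auto
  have "(\<Prod>j=1..n-1. a j) = a 1 * (\<Prod>j \<in> {1..n-1} - {1}. a j)" using n by (intro prod.remove) auto
  moreover have "1 \<le> (\<Prod>j \<in> {1..n-1} - {1}. a j)" using a1 by (intro prod_ge_1) force
  moreover have "2 \<le> a 1" using a n by auto
  ultimately show \<alpha>2: "2 \<le> \<alpha>" unfolding \<alpha>_def using mult_mono[of 2 "a 1" 1] by fastforce
  have eq: "b n * \<alpha> + a n * (\<Sum>i=1..n-1. b i * (\<Prod>j \<in> {1..n-1} - {i}. a j)) = - 1 - e * (a n * \<alpha>)"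
    using seifert_data_eq[OF a d] unfolding cofactor_sum_split[OF n1] \<alpha>_def .
  then show one: "a n * ?B - b n * \<alpha> = 1" unfolding B_def \<alpha>_def by (simp add: algebra_simps)
  have bn: "1 \<le> b n" "b n < a n" using d nn by (auto simp: seifert_data_def)
  have "0 < a n * ?B"
  proof -
    have "0 \<le> b n * \<alpha>" using bn \<alpha>2 by simp
    then show ?thesis using one by linarith
  qed
  then have B0: "0 < ?B" using bn by (simp add: zero_less_mult_iff)
  \<comment> \<open>Required for the normalisation \<open>b n + 2 * B < a n + 2 * \<alpha>\<close>
    of the new pair.\<close>
  have B\<alpha>: "?B < \<alpha>"
  proof (rule ccontr)
    assume "\<not> ?B < \<alpha>"
    then have "a n * \<alpha> \<le> a n * ?B" using bn by (intro mult_left_mono) auto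
    moreover have "(b n + 1) * \<alpha> \<le> a n * \<alpha>" using bn \<alpha>2 by (intro mult_right_mono) auto
    ultimately show False using one \<alpha>2 by (simp add: algebra_simps)
  qed
  have "2 \<le> a n + 2 * \<alpha>" using a nn \<alpha>2 by force
  then have a': "\<forall>i \<in> {1..n}. 2 \<le> ?a i" using a by auto
  have p: "(\<Prod>j \<in> F. ?a j) = (\<Prod>j \<in> F. a j)" if "F \<subseteq> {1..n-1}" for F
    using that n by (intro prod.cong) auto
  have "(\<Sum>i=1..n-1. ?b i * (\<Prod>j \<in> {1..n-1} - {i}. ?a j)) =
      (\<Sum>i=1..n-1. b i * (\<Prod>j \<in> {1..n-1} - {i}. a j))"
    using n p by (intro sum.cong) auto
  then have "(\<Sum>i=1..n. ?b i * (\<Prod>j \<in> {1..n} - {i}. ?a j)) = - 1 - e * (\<Prod>j=1..n. ?a j)"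
    unfolding cofactor_sum_split[OF n1] p[OF order_refl] using one
    unfolding B_def \<alpha>_def[symmetric] by (simp add: algebra_simps)
  moreover have "\<forall>i \<in> {1..n}. 1 \<le> ?b i \<and> ?b i < ?a i"
    using d bn B0 B\<alpha> by (auto simp: seifert_data_def)
  moreover have "\<forall>i. i \<notin> {1..n} \<longrightarrow> ?b i = 0" using d nn by (auto simp: seifert_data_def)
  ultimately show "seifert_data n ?a e ?b"
    unfolding seifert_data_def seifert_data_int[OF a'] by blast
qed

theorem theorem1p3:
  fixes n :: nat and a a' :: "nat \<Rightarrow> int" and \<alpha> :: int
    and k k' :: "star_vertex \<Rightarrow> real"
    and T T' :: "int \<times> (star_vertex \<Rightarrow> real) set \<Rightarrow> (int \<times> (star_vertex \<Rightarrow> real) set) set"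
  assumes "2 \<le> n"
    and "\<forall>i \<in> {1..n}. 2 \<le> a i"
    and "\<forall>i \<in> {1..n}. \<forall>j \<in> {1..n}. i \<noteq> j \<longrightarrow> coprime (a i) (a j)"
    and "\<alpha> = (\<Prod>i=1..n-1. a i)"
    and "a' = a(n := a n + 2 * \<alpha>)"
    and "characteristic (seifert_plumbing n a) k"
    and "characteristic (seifert_plumbing n a') k'"
    and "tip_choice (lattice_homology (seifert_plumbing n a) k) T"
    and "tip_choice (lattice_homology (seifert_plumbing n a') k') T'"
  shows "root_iso
    (max_monotone_subroot (lattice_homology (seifert_plumbing n a) k) T)
    (max_monotone_subroot (lattice_homology (seifert_plumbing n a') k') T')"
proof -
  note n = assms(1) and a2 = assms(2) and cop = assms(3) and \<alpha> = assms(4) and a' = assms(5)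
  define e b where "e = seifert_e0 n a" and "b = seifert_b n a"
  define xs where "xs i = leg_expansion (a i) (b i)" for i
  define Q where "Q i = (\<Prod>j \<in> {1..n-1} - {i}. a j)" for i
  define B where "B = - (e * (\<Prod>j=1..n-1. a j) + (\<Sum>i=1..n-1. b i * (\<Prod>j \<in> {1..n-1} - {i}. a j)))"
  define b' where "b' = b(n := b n + 2 * B)"
  have nn: "n \<in> {1..n}" using n by simp
  have d: "seifert_data n a e b" unfolding e_def b_def by (rule seifert_data_e0_b[OF a2 cop])
  note ext = seifert_data_extend[OF n a2 d, folded \<alpha> B_def, folded a' b'_def]
  have "2 \<le> a n + 2 * \<alpha>" using a2 nn ext(2) by force
  then have a2': "\<forall>i \<in> {1..n}. 2 \<le> a' i" using a2 unfolding a' by auto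
  have e': "seifert_e0 n a' = e" and b'': "seifert_b n a' = b'"
    unfolding seifert_e0_def seifert_b_def
    using ext(3) seifert_data_unique[OF a2'] by (intro the_equality; blast)+
  have bb: "1 \<le> b i" "b i < a i" if "i \<in> {1..n}" for i using d that by (auto simp: seifert_data_def)
  have bb': "1 \<le> b' i" "b' i < a' i" if "i \<in> {1..n}" for i
    using ext(3) that by (auto simp: seifert_data_def)
  have f: "is_neg_cfrac (a i) (b i) (xs i)" if "i \<in> {1..n}" for i
    unfolding xs_def b_def by (rule leg_expansion_neg_cfrac[OF a2 cop that])
  obtain K where K: "1 \<le> K" "cf_act (xs n) (1, 0) = (a n, b n)" "cf_act (xs n) (K, 1) = (\<alpha>, B)"
    and fn: "is_neg_cfrac (a n + 2 * \<alpha>) (b n + 2 * B) (xs n @ [K + 1, 2])"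
    by (rule neg_cfrac_extension[OF f[OF nn] bb[OF nn] ext(1)]) (use ext(2) in auto)
  define xs' where "xs' = xs(n := xs n @ [K + 1, 2])"
  have f': "is_neg_cfrac (a' i) (b' i) (xs' i)" if "i \<in> {1..n}" for i
    using f[OF that] fn by (auto simp: a' b'_def xs'_def)
  have xs'_eq: "leg_expansion (a' i) (b' i) = xs' i" for i
  proof (cases "i = n")
    case True
    show ?thesis unfolding True by (rule leg_expansion_eq[OF bb'[OF nn] f'[OF nn]])
  qed (simp add: a' b'_def xs'_def xs_def)
  have \<Gamma>: "seifert_plumbing n a = star_plumbing n e xs"
    by (simp add: seifert_plumbing_def e_def b_def xs_def[abs_def])
  have \<Gamma>': "seifert_plumbing n a' = star_plumbing n e xs'"
    by (simp add: seifert_plumbing_def e' b'' xs'_eq)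
  have cf: "cf_act (xs i) (1, 0) = (a i, b i)" if "i \<in> {1..n}" for i
    by (rule cf_act_is_neg_cfrac[OF f[OF that] bb[OF that] seifert_data_coprime[OF a2 d that]])
  have cf': "cf_act (xs' i) (1, 0) = (a' i, b' i)" if "i \<in> {1..n}" for i
    by (rule cf_act_is_neg_cfrac[OF f'[OF that] bb'[OF that] seifert_data_coprime[OF a2' ext(3) that]])
  have uni: "y \<in> lattice (star_plumbing n e xs)" if "star_supported n xs y"
    "\<forall>u \<in> pverts (star_plumbing n e xs). star_lap n e xs y u \<in> \<int>" for y
    by (rule star_unimodular[OF that _ seifert_data_eq[OF a2 d]]) (use cf in blast)
  have uni': "y \<in> lattice (star_plumbing n e xs')" if "star_supported n xs' y"
    "\<forall>u \<in> pverts (star_plumbing n e xs'). star_lap n e xs' y u \<in> \<int>" for y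
    by (rule star_unimodular[OF that _ seifert_data_eq[OF a2' ext(3)]]) (use cf' in blast)
  have ne: "xs i \<noteq> []" "x \<in> set (xs i) \<Longrightarrow> 2 \<le> x" if "i \<in> {1..n}" for i x
    using f[OF that] by (auto simp: is_neg_cfrac_def)
  have ne': "xs' i \<noteq> []" "x \<in> set (xs' i) \<Longrightarrow> 2 \<le> x" if "i \<in> {1..n}" for i x
    using f'[OF that] by (auto simp: is_neg_cfrac_def)
  have supp: "star_supported n ys k" if "characteristic (star_plumbing n e ys) k" for ys k
    using that unfolding star_supported_iff[of n ys k e] characteristic_def lattice_rat_def by blast
  note k = assms(6)[unfolded \<Gamma>] and k' = assms(7)[unfolded \<Gamma>']
  \<comment> \<open>\<open>k\<close> is given only with rational coordinates; its values on the
    vertices are integers, so unimodularity puts it into the lattice.\<close>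
  interpret A: star n e xs k
    by unfold_locales (use ne k uni[OF supp[OF k]] char_lap_Ints[OF ne(1) k] in blast)+
  interpret B: star n e xs' k'
    by unfold_locales (use ne' k' uni'[OF supp[OF k']] char_lap_Ints[OF ne'(1) k'] in blast)+
  \<comment> \<open>Legs \<open>i < n\<close> reach the common central value as
    \<open>\<alpha> = a i * Q i\<close>, the last leg directly as the numerator of
    \<open>[xs n, K] = \<alpha> / B\<close>.\<close>
  define q where "q i = (if i = n then 1 else Q i)" for i
  define z :: "nat \<Rightarrow> int \<times> int" where "z i = (if i = n then (K, 1) else (1, 0))" for i
  have aQ: "\<alpha> = a i * Q i" if "i \<in> {1..n-1}" for i
    unfolding \<alpha> Q_def using that by (intro prod.remove) auto
  have ins: "{1..n} = insert n {1..n-1}" "n \<notin> {1..n-1}" using n by auto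
  have split: "(\<Sum>i=1..n. h i) = h n + (\<Sum>i=1..n-1. h i)" for h :: "nat \<Rightarrow> int"
    unfolding ins(1) using ins(2) by simp
  have Q0: "0 \<le> Q i" for i unfolding Q_def
  proof (rule prod_nonneg)
    fix j assume "j \<in> {1..n-1} - {i}"
    then have "j \<in> {1..n}" by auto
    then show "0 \<le> a j" using a2 by force
  qed
  \<comment> \<open>The definition of \<open>B\<close> rearranged. It serves twice: as the central
    row for \<open>\<eta>\<close> and as the bound for the total growth of the slopes over a shift
    by \<alpha>.\<close>
  have BQ: "(\<Sum>i=1..n-1. Q i * b i) + B = - e * \<alpha>"
    unfolding B_def \<alpha> Q_def by (simp add: mult.commute)
  obtain \<eta> where \<eta>: "\<eta> \<in> lattice (star_plumbing n e xs)" "\<eta> Center = - of_int \<alpha>"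
    "\<eta> (Leg n (length (xs n) - 1)) = - of_int K"
    "\<And>u. u \<in> pverts (star_plumbing n e xs) \<Longrightarrow>
      star_lap n e xs \<eta> u = (if u = Leg n (length (xs n) - 1) then 1 else 0)"
  proof (rule dual_vector[of n xs q z \<alpha> e K])
    show "1 \<le> n" using n by simp
    show "q i * fst (cf_act (xs i) (z i)) = \<alpha>" if "i \<in> {1..n}" for i
    proof (cases "i = n")
      case False
      then have "i \<in> {1..n-1}" using that by auto
      then show ?thesis using aQ[of i] cf[OF that] False by (simp add: q_def z_def)
    qed (simp add: q_def z_def K)
    have "(\<Sum>i=1..n-1. q i * snd (cf_act (xs i) (z i))) = (\<Sum>i=1..n-1. Q i * b i)"
      by (rule sum.cong) (use cf ins(2) in \<open>auto simp: q_def z_def\<close>)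
    then show "(\<Sum>i=1..n. q i * snd (cf_act (xs i) (z i))) = - e * \<alpha>"
      unfolding split using BQ by (simp add: q_def z_def K)
  qed (use ne in \<open>auto simp: q_def z_def\<close>)
  have slope: "(\<Sum>i=1..n. leg_slope (A.leg i) (t + \<alpha>)) \<le> (\<Sum>i=1..n. leg_slope (A.leg i) t) - e * \<alpha>" for t
  proof -
    \<comment> \<open>The first legs have periods \<open>a i\<close> dividing \<alpha>, hence exact
      growth; the inequality comes from the last leg alone.\<close>
    have "leg_slope (A.leg i) (t + \<alpha>) = leg_slope (A.leg i) t + Q i * b i" if i: "i \<in> {1..n-1}" for i
    proof -
      have i': "i \<in> {1..n}" using i by auto
      show ?thesis
        using leg_slope_period_mult[OF A.good_leg[OF i'] _ Q0, of "a i" "b i" t i] cf[OF i'] aQ[OF i]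
        by (simp add: A.map_fst_leg mult.commute)
    qed
    then have "(\<Sum>i=1..n-1. leg_slope (A.leg i) (t + \<alpha>)) =
        (\<Sum>i=1..n-1. leg_slope (A.leg i) t + Q i * b i)"
      by (rule sum.cong[OF refl])
    moreover have "leg_slope (A.leg n) (t + \<alpha>) \<le> leg_slope (A.leg n) t + B"
      by (rule leg_slope_period_le[OF A.good_leg[OF nn], of K]) (simp add: A.map_fst_leg K(3))
    ultimately show ?thesis unfolding split using BQ by (simp add: sum.distrib)
  qed
  interpret extended_star n e xs k xs' k' K \<alpha> \<eta>
    by unfold_locales (use n ext(2) \<eta> uni uni' slope in \<open>auto simp: xs'_def simp del: star_lap.simps\<close>)
  from two_stars.star_subroots_iso[OF two_stars] show ?thesis
    using assms(8,9) unfolding \<Gamma> \<Gamma>' by blast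
qed

end
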